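(* Let $\Gamma$ be a cuspidal tree lattice acting on the uniform tree $Y$. Then the product $$Z(u)=\prod_c\left(1-w(c)u^{l(c)}\right)^{-1},$$ taken over all prime cycles $c$ in $X=\Gamma\backslash Y$, converges for small $|u|$ to a rational function of $u$.
   Context: Graphs: an oriented edge $e$ has origin $o(e)$, terminus $t(e)$ and reverse $e^{-1}$; $\mathrm{OE}(X)$ is the set of oriented edges of $X$. A path is a sequence $(e_1,\dots,e_n)$ of oriented edges with $t(e_j)=o(e_{j+1})$ for $1\le j\le n-1$; it is reduced if $e_{j+1}\ne e_j^{-1}$ for all $1\le j\le n-1$. Tree lattices: a tree lattice is a group $\Gamma$ with an action on a locally finite tree $Y$ such that all edge stabilizers $\Gamma_e$ are finite and $\sum_{e \bmod \Gamma} 1/|\Gamma_e|<\infty$. Throughout, $Y$ is uniform, i.e. $G\backslash Y$ is finite where $G=\mathrm{Aut}(Y)$, and $\Gamma$ acts orientation preservingly, so that the oriented edges of the quotient graph $X=\Gamma\backslash Y$ are the $\Gamma$-orbits of oriented edges of $Y$. Cusps: a ray in $Y$ is an infinite reduced path; two rays $r,s$ are equivalent if there are $N\in\mathbb N$, $k\in\mathbb Z$ with $r_{j+k}=s_j$ for all $j\ge N$; the set of equivalence classes is the boundary $\partial Y$. For $c\in\partial Y$, two vertices $x,y$ lie in the same horocycle with respect to $c$ if there are rays in $c$ starting at $x$ and $y$ and an $n\ge 0$ such that the two rays have the same $n$-th vertex. Let $P_c$ be the stabilizer of $c$ in $G$ and $N_c\subset P_c$ the subgroup of elements stabilizing one (hence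 every) horocycle with respect to $c$. The point $c$ is a cusp of $\Gamma$ if $\Gamma\cap P_c=\Gamma\cap N_c$ and $\Gamma\cap N_c$ acts transitively on some horocycle with respect to $c$; then a ray in $c$, or rather its image in $X$, is called a cusp section. The cusp is periodic if, along a ray in $c$ with vertices $x_1,x_2,\dots$, the sequence of valencies $\mathrm{val}(x_n)$ (in $Y$) is eventually periodic. The tree lattice $\Gamma$ is cuspidal if $X=\Gamma\backslash Y$ is the union of a finite graph and finitely many periodic cusp sections. Cycles and weights: a path $(e_1,\dots,e_n)$ in $X$ is closed if $t(e_n)=o(e_1)$; a cycle is an equivalence class of closed paths under cyclic shifts; $l(c)$ is its length. A cycle is prime if it is not a power (repetition) of a shorter one. For an oriented edge $e$ of $Y$ put $w(e)=|\Gamma_{o(e)}e|$ (cardinality of the orbit), and for an edge $e$ of $X$ put $w(e)=w(\tilde e)$ for any preimage $\tilde e$ in $Y$. For edges $e,e'$ of $X$ with $t(e)=o(e')$ put $w(e,e')=w(e')$ if $e'\neq e^{-1}$ and $w(e,e')=w(e')-1$ if $e'=e^{-1}$. For a closed path $p=(e_1,\dots,e_n)$ in $X$ let $w(p)=\prod_{j \bmod n}w(e_j,e_{j+1})$; this depends only on the cycle of $p$. *)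

theory Defs
  imports
    "HOL-Analysis.Infinite_Sum"
    "HOL-Computational_Algebra.Polynomial"
    "HOL-Algebra.Group_Action"
    "Graph_Theory.Digraph_Component"
    "Graph_Theory.Bidirected_Digraph"
begin

section \<open>Graphs, trees and rays\<close>

text \<open>
  Graphs are \<^locale>\<open>bidirected_digraph\<close>s: arcs are the oriented edges,
  \<^const>\<open>tail\<close>/\<^const>\<open>head\<close> are origin and terminus, and the fixed-point free involution
  \<open>arev\<close> reverses orientation. Loops and multiple edges are allowed, as needed for quotients.
  Since every edge occurs with both orientations, the valency of a vertex is its
  \<^const>\<open>out_degree\<close>.
\<close>

definition reduced :: "('e \<Rightarrow> 'e) \<Rightarrow> 'e list \<Rightarrow> bool" where
  "reduced arev p \<longleftrightarrow> (\<forall>j. Suc j < length p \<longrightarrow> p ! Suc j \<noteq> arev (p ! j))"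

locale graph_tree = bidirected_digraph Y arev
  for Y :: "('v, 'e) pre_digraph" and arev :: "'e \<Rightarrow> 'e" +
  assumes connected: "Digraph_Component.connected Y"
    and no_closed_reduced: "\<And>x p. pre_digraph.awalk Y x p x \<Longrightarrow> reduced arev p \<Longrightarrow> p = []"

definition locally_finite :: "('v, 'e) pre_digraph \<Rightarrow> bool" where
  "locally_finite Y \<longleftrightarrow> (\<forall>v\<in>verts Y. finite (out_arcs Y v))"

text \<open>An automorphism is a pair of its actions on vertices and on oriented edges.
  Compatibility with \<^const>\<open>head\<close> follows from that with \<^const>\<open>tail\<close> and \<open>arev\<close>.\<close>

definition graph_auts ::
    "('v, 'e) pre_digraph \<Rightarrow> ('e \<Rightarrow> 'e) \<Rightarrow> (('v \<Rightarrow> 'v) \<times> ('e \<Rightarrow> 'e)) set" where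
  "graph_auts Y arev = {(f, h). f \<in> Bij (verts Y) \<and> h \<in> Bij (arcs Y) \<and>
     (\<forall>e\<in>arcs Y. tail Y (h e) = f (tail Y e) \<and> h (arev e) = arev (h e))}"

definition uniform_graph :: "('v, 'e) pre_digraph \<Rightarrow> ('e \<Rightarrow> 'e) \<Rightarrow> bool" where
  "uniform_graph Y arev \<longleftrightarrow>
     finite ((\<lambda>v. (\<lambda>a. fst a v) ` graph_auts Y arev) ` verts Y) \<and>
     finite ((\<lambda>e. (\<lambda>a. snd a e) ` graph_auts Y arev) ` arcs Y)"

text \<open>Rays are indexed from 0; the \<open>n\<close>-th vertex of \<open>r\<close> is \<open>tail Y (r n)\<close>.\<close>

definition rays :: "('v, 'e) pre_digraph \<Rightarrow> ('e \<Rightarrow> 'e) \<Rightarrow> (nat \<Rightarrow> 'e) set" where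
  "rays Y arev = {r. \<forall>j. r j \<in> arcs Y \<and> head Y (r j) = tail Y (r (Suc j)) \<and>
     r (Suc j) \<noteq> arev (r j)}"

definition ray_rel ::
    "('v, 'e) pre_digraph \<Rightarrow> ('e \<Rightarrow> 'e) \<Rightarrow> ((nat \<Rightarrow> 'e) \<times> (nat \<Rightarrow> 'e)) set" where
  "ray_rel Y arev = {(r, s). r \<in> rays Y arev \<and> s \<in> rays Y arev \<and>
     (\<exists>(N::nat) (k::int). \<forall>j\<ge>N. 0 \<le> int j + k \<and> r (nat (int j + k)) = s j)}"

definition boundary :: "('v, 'e) pre_digraph \<Rightarrow> ('e \<Rightarrow> 'e) \<Rightarrow> (nat \<Rightarrow> 'e) set set" where
  "boundary Y arev = rays Y arev // ray_rel Y arev"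

definition horocycle_rel :: "('v, 'e) pre_digraph \<Rightarrow> (nat \<Rightarrow> 'e) set \<Rightarrow> ('v \<times> 'v) set" where
  "horocycle_rel Y c = {(x, y). x \<in> verts Y \<and> y \<in> verts Y \<and>
     (\<exists>r\<in>c. \<exists>s\<in>c. tail Y (r 0) = x \<and> tail Y (s 0) = y \<and> (\<exists>n. tail Y (r n) = tail Y (s n)))}"

definition horocycles :: "('v, 'e) pre_digraph \<Rightarrow> (nat \<Rightarrow> 'e) set \<Rightarrow> 'v set set" where
  "horocycles Y c = verts Y // horocycle_rel Y c"

definition end_stabilizer ::
    "('v, 'e) pre_digraph \<Rightarrow> ('e \<Rightarrow> 'e) \<Rightarrow> (nat \<Rightarrow> 'e) set \<Rightarrow>
     (('v \<Rightarrow> 'v) \<times> ('e \<Rightarrow> 'e)) set" where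
  "end_stabilizer Y arev c = {a \<in> graph_auts Y arev. (\<lambda>r. snd a \<circ> r) ` c = c}"

definition horocycle_stabilizer ::
    "('v, 'e) pre_digraph \<Rightarrow> ('e \<Rightarrow> 'e) \<Rightarrow> (nat \<Rightarrow> 'e) set \<Rightarrow>
     (('v \<Rightarrow> 'v) \<times> ('e \<Rightarrow> 'e)) set" where
  "horocycle_stabilizer Y arev c =
     {a \<in> end_stabilizer Y arev c. \<exists>H\<in>horocycles Y c. fst a ` H = H}"

definition eventually_periodic :: "(nat \<Rightarrow> 'a) \<Rightarrow> bool" where
  "eventually_periodic a \<longleftrightarrow> (\<exists>p>0. \<exists>N. \<forall>n\<ge>N. a (n + p) = a n)"

definition periodic_end :: "('v, 'e) pre_digraph \<Rightarrow> (nat \<Rightarrow> 'e) set \<Rightarrow> bool" where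
  "periodic_end Y c \<longleftrightarrow> (\<exists>r\<in>c. eventually_periodic (\<lambda>n. out_degree Y (tail Y (r n))))"


section \<open>Tree lattices\<close>

text \<open>
  \<open>\<phi>\<close> and \<open>\<psi>\<close> are the actions of \<open>\<Gamma>\<close> on vertices and oriented edges; the action need not be
  faithful. There are no inversions, so an edge and each of its orientations have the same
  stabilizer, and \<open>sum_stabilizers\<close>, which runs over orbits of oriented edges, is twice the
  sum over orbits of unoriented edges. Its terms do not depend on the chosen representative.
\<close>

locale tree_lattice =
  graph_tree Y arev + vert: group_action \<Gamma> "verts Y" \<phi> + edge: group_action \<Gamma> "arcs Y" \<psi>
  for \<Gamma> :: "('g, 'm) monoid_scheme"
    and Y :: "('v, 'e) pre_digraph" and arev :: "'e \<Rightarrow> 'e"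
    and \<phi> :: "'g \<Rightarrow> 'v \<Rightarrow> 'v" and \<psi> :: "'g \<Rightarrow> 'e \<Rightarrow> 'e" +
  assumes locally_finite: "locally_finite Y"
    and uniform: "uniform_graph Y arev"
    and act_auts: "\<And>g. g \<in> carrier \<Gamma> \<Longrightarrow> (\<phi> g, \<psi> g) \<in> graph_auts Y arev"
    and no_inversion: "\<And>g e. g \<in> carrier \<Gamma> \<Longrightarrow> e \<in> arcs Y \<Longrightarrow> \<psi> g e \<noteq> arev e"
    and finite_stabilizers: "\<And>e. e \<in> arcs Y \<Longrightarrow> finite (stabilizer \<Gamma> \<psi> e)"
    and sum_stabilizers:
      "(\<lambda>E. 1 / real (card (stabilizer \<Gamma> \<psi> (SOME e. e \<in> E)))) summable_on orbits \<Gamma> (arcs Y) \<psi>"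

text \<open>The tails of the edges in an orbit form an orbit of vertices, hence the images below.
  \<open>quotient_arev\<close> is the identity off the arcs, as \<^locale>\<open>bidirected_digraph\<close> demands.\<close>

definition quotient_graph ::
    "('g, 'm) monoid_scheme \<Rightarrow> ('v, 'e) pre_digraph \<Rightarrow> ('g \<Rightarrow> 'v \<Rightarrow> 'v) \<Rightarrow> ('g \<Rightarrow> 'e \<Rightarrow> 'e) \<Rightarrow>
     ('v set, 'e set) pre_digraph" where
  "quotient_graph \<Gamma> Y \<phi> \<psi> =
     \<lparr> verts = orbits \<Gamma> (verts Y) \<phi>, arcs = orbits \<Gamma> (arcs Y) \<psi>,
       tail = (\<lambda>E. tail Y ` E), head = (\<lambda>E. head Y ` E) \<rparr>"

definition quotient_arev ::
    "('g, 'm) monoid_scheme \<Rightarrow> ('v, 'e) pre_digraph \<Rightarrow> ('e \<Rightarrow> 'e) \<Rightarrow> ('g \<Rightarrow> 'e \<Rightarrow> 'e) \<Rightarrow>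
     'e set \<Rightarrow> 'e set" where
  "quotient_arev \<Gamma> Y arev \<psi> E = (if E \<in> orbits \<Gamma> (arcs Y) \<psi> then arev ` E else E)"

lemma (in tree_lattice) bidirected_quotient:
  "bidirected_digraph (quotient_graph \<Gamma> Y \<phi> \<psi>) (quotient_arev \<Gamma> Y arev \<psi>)"
proof -
  let ?V = "orbits \<Gamma> (verts Y) \<phi>" and ?A = "orbits \<Gamma> (arcs Y) \<psi>"
  have tl: "tail Y (\<psi> g e) = \<phi> g (tail Y e)" and ar: "\<psi> g (arev e) = arev (\<psi> g e)"
    and cl: "\<psi> g e \<in> arcs Y" if "g \<in> carrier \<Gamma>" "e \<in> arcs Y" for g e
    using act_auts[OF that(1)] that(2) edge.element_image[OF that refl]
    by (auto simp: graph_auts_def)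
  have hd: "head Y (\<psi> g e) = \<phi> g (head Y e)" if "g \<in> carrier \<Gamma>" "e \<in> arcs Y" for g e
    using tl[OF that(1), of "arev e"] ar[OF that] cl[OF that] that by simp
  have t: "tail Y ` Group_Action.orbit \<Gamma> \<psi> e = Group_Action.orbit \<Gamma> \<phi> (tail Y e)"
    and h: "head Y ` Group_Action.orbit \<Gamma> \<psi> e = Group_Action.orbit \<Gamma> \<phi> (head Y e)"
    and r: "arev ` Group_Action.orbit \<Gamma> \<psi> e = Group_Action.orbit \<Gamma> \<psi> (arev e)"
    if "e \<in> arcs Y" for e
    using that by (force simp: Group_Action.orbit_def image_iff tl hd ar)+
  have ne: "Group_Action.orbit \<Gamma> \<psi> (arev e) \<noteq> Group_Action.orbit \<Gamma> \<psi> e" if "e \<in> arcs Y" for e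
  proof
    assume "Group_Action.orbit \<Gamma> \<psi> (arev e) = Group_Action.orbit \<Gamma> \<psi> e"
    then have "arev e \<in> Group_Action.orbit \<Gamma> \<psi> e"
      using edge.orbit_refl[of "arev e"] that by simp
    then show False using no_inversion that by (fastforce simp: Group_Action.orbit_def)
  qed
  have mem: "E \<in> ?A \<longleftrightarrow> (\<exists>e\<in>arcs Y. E = Group_Action.orbit \<Gamma> \<psi> e)" for E
    by (auto simp: orbits_def)
  have memV: "Group_Action.orbit \<Gamma> \<phi> v \<in> ?V" if "v \<in> verts Y" for v
    using that by (auto simp: orbits_def)
  have wf: "wf_digraph (quotient_graph \<Gamma> Y \<phi> \<psi>)"
    by unfold_locales (auto simp: quotient_graph_def mem t h memV)
  have rA: "arev ` E \<in> ?A" if "E \<in> ?A" for E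
    using that r by (force simp: mem)
  show ?thesis
  proof (rule wf_digraph.bidirected_digraphI[OF wf])
    fix E assume "E \<notin> arcs (quotient_graph \<Gamma> Y \<phi> \<psi>)"
    then show "quotient_arev \<Gamma> Y arev \<psi> E = E"
      by (simp add: quotient_graph_def quotient_arev_def)
  next
    fix E assume E: "E \<in> arcs (quotient_graph \<Gamma> Y \<phi> \<psi>)"
    then obtain e where e: "e \<in> arcs Y" "E = Group_Action.orbit \<Gamma> \<psi> e" and A: "E \<in> ?A"
      by (auto simp: quotient_graph_def mem)
    show "quotient_arev \<Gamma> Y arev \<psi> E \<noteq> E"
      using A e ne by (simp add: quotient_arev_def r)
    show "quotient_arev \<Gamma> Y arev \<psi> (quotient_arev \<Gamma> Y arev \<psi> E) = E"
      using A rA[OF A] by (simp add: quotient_arev_def image_image)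
    show "tail (quotient_graph \<Gamma> Y \<phi> \<psi>) (quotient_arev \<Gamma> Y arev \<psi> E) =
        head (quotient_graph \<Gamma> Y \<phi> \<psi>) E"
      using A e by (simp add: quotient_graph_def quotient_arev_def r t h)
  qed
qed

text \<open>For a set \<open>S\<close> of automorphisms, this is \<open>\<Gamma> \<inter> S\<close>.\<close>

definition acting_in ::
    "('g, 'm) monoid_scheme \<Rightarrow> ('g \<Rightarrow> 'v \<Rightarrow> 'v) \<Rightarrow> ('g \<Rightarrow> 'e \<Rightarrow> 'e) \<Rightarrow>
     (('v \<Rightarrow> 'v) \<times> ('e \<Rightarrow> 'e)) set \<Rightarrow> 'g set" where
  "acting_in \<Gamma> \<phi> \<psi> S = {g \<in> carrier \<Gamma>. (\<phi> g, \<psi> g) \<in> S}"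

definition cusps ::
    "('g, 'm) monoid_scheme \<Rightarrow> ('v, 'e) pre_digraph \<Rightarrow> ('e \<Rightarrow> 'e) \<Rightarrow>
     ('g \<Rightarrow> 'v \<Rightarrow> 'v) \<Rightarrow> ('g \<Rightarrow> 'e \<Rightarrow> 'e) \<Rightarrow> (nat \<Rightarrow> 'e) set set" where
  "cusps \<Gamma> Y arev \<phi> \<psi> = {c \<in> boundary Y arev.
     acting_in \<Gamma> \<phi> \<psi> (end_stabilizer Y arev c) = acting_in \<Gamma> \<phi> \<psi> (horocycle_stabilizer Y arev c) \<and>
     (\<exists>H\<in>horocycles Y c. \<forall>x\<in>H. \<forall>y\<in>H.
        \<exists>g\<in>acting_in \<Gamma> \<phi> \<psi> (horocycle_stabilizer Y arev c). \<phi> g x = y)}"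

text \<open>\<open>R\<close> consists of rays in \<open>Y\<close>; the cusp sections are their images in the quotient,
  which contain every edge with both orientations.\<close>

locale cuspidal_tree_lattice = tree_lattice +
  assumes cuspidal: "\<exists>F R.
    subgraph F (quotient_graph \<Gamma> Y \<phi> \<psi>) \<and> fin_digraph F \<and>
    (\<forall>E\<in>arcs F. quotient_arev \<Gamma> Y arev \<psi> E \<in> arcs F) \<and>
    finite R \<and> (\<forall>r\<in>R. \<exists>c\<in>cusps \<Gamma> Y arev \<phi> \<psi>. periodic_end Y c \<and> r \<in> c) \<and>
    verts (quotient_graph \<Gamma> Y \<phi> \<psi>) = verts F \<union> {Group_Action.orbit \<Gamma> \<phi> (tail Y (r n)) | r n. r \<in> R} \<and>
    arcs (quotient_graph \<Gamma> Y \<phi> \<psi>) = arcs F \<union> {Group_Action.orbit \<Gamma> \<psi> (r n) | r n. r \<in> R}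
      \<union> {Group_Action.orbit \<Gamma> \<psi> (arev (r n)) | r n. r \<in> R}"


section \<open>Cycles and weights\<close>

text \<open>A cycle is the set of all cyclic shifts of a nonempty closed path. Length and weight of
  a cycle, and the weight of an edge of the quotient, do not depend on the representative
  picked by \<open>SOME\<close>.\<close>

definition shift_class :: "'e list \<Rightarrow> 'e list set" where
  "shift_class p = {rotate k p | k. True}"

definition cycles :: "('v, 'e) pre_digraph \<Rightarrow> 'e list set set" where
  "cycles X = {shift_class p | p. wf_digraph.closed_w X p}"

definition prime_cycles :: "('v, 'e) pre_digraph \<Rightarrow> 'e list set set" where
  "prime_cycles X = {c \<in> cycles X.
     \<not> (\<exists>q n. wf_digraph.closed_w X q \<and> n \<ge> 2 \<and> c = shift_class (concat (replicate n q)))}"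

definition cycle_length :: "'e list set \<Rightarrow> nat" where
  "cycle_length c = length (SOME p. p \<in> c)"

definition edge_weight ::
    "('g, 'm) monoid_scheme \<Rightarrow> ('v, 'e) pre_digraph \<Rightarrow> ('g \<Rightarrow> 'v \<Rightarrow> 'v) \<Rightarrow> ('g \<Rightarrow> 'e \<Rightarrow> 'e) \<Rightarrow>
     'e \<Rightarrow> nat" where
  "edge_weight \<Gamma> Y \<phi> \<psi> e = card ((\<lambda>g. \<psi> g e) ` stabilizer \<Gamma> \<phi> (tail Y e))"

definition quotient_weight ::
    "('g, 'm) monoid_scheme \<Rightarrow> ('v, 'e) pre_digraph \<Rightarrow> ('g \<Rightarrow> 'v \<Rightarrow> 'v) \<Rightarrow> ('g \<Rightarrow> 'e \<Rightarrow> 'e) \<Rightarrow>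
     'e set \<Rightarrow> nat" where
  "quotient_weight \<Gamma> Y \<phi> \<psi> E = edge_weight \<Gamma> Y \<phi> \<psi> (SOME e. e \<in> E)"

definition step_weight :: "('e \<Rightarrow> nat) \<Rightarrow> ('e \<Rightarrow> 'e) \<Rightarrow> 'e \<Rightarrow> 'e \<Rightarrow> int" where
  "step_weight w arev e e' = (if e' = arev e then int (w e') - 1 else int (w e'))"

definition path_weight :: "('e \<Rightarrow> nat) \<Rightarrow> ('e \<Rightarrow> 'e) \<Rightarrow> 'e list \<Rightarrow> int" where
  "path_weight w arev p =
     (\<Prod>j<length p. step_weight w arev (p ! j) (p ! (Suc j mod length p)))"

definition cycle_weight :: "('e \<Rightarrow> nat) \<Rightarrow> ('e \<Rightarrow> 'e) \<Rightarrow> 'e list set \<Rightarrow> int" where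
  "cycle_weight w arev c = path_weight w arev (SOME p. p \<in> c)"


section \<open>Unordered infinite products\<close>

text \<open>
  As usual for infinite products, convergence includes that neither the limit nor any factor
  vanishes. For a factor \<open>inverse z\<close> the latter says \<open>z \<noteq> 0\<close>, since \<open>inverse 0 = 0\<close>.
  Convergence is along the net of finite subsets of \<open>A\<close>, as for \<^const>\<open>has_sum\<close>.
\<close>

definition has_prod_on :: "('a \<Rightarrow> complex) \<Rightarrow> complex \<Rightarrow> 'a set \<Rightarrow> bool" where
  "has_prod_on f L A \<longleftrightarrow> (\<forall>x\<in>A. f x \<noteq> 0) \<and> L \<noteq> 0 \<and>
     (prod f \<longlongrightarrow> L) (finite_subsets_at_top A)"

definition zeta_factor ::
    "('g, 'm) monoid_scheme \<Rightarrow> ('v, 'e) pre_digraph \<Rightarrow> ('e \<Rightarrow> 'e) \<Rightarrow>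
     ('g \<Rightarrow> 'v \<Rightarrow> 'v) \<Rightarrow> ('g \<Rightarrow> 'e \<Rightarrow> 'e) \<Rightarrow> complex \<Rightarrow> 'e set list set \<Rightarrow> complex" where
  "zeta_factor \<Gamma> Y arev \<phi> \<psi> u c = inverse (1 -
     of_int (cycle_weight (quotient_weight \<Gamma> Y \<phi> \<psi>) (quotient_arev \<Gamma> Y arev \<psi>) c) *
     u ^ cycle_length c)"

end

theory Submission
  imports Defs "HOL-Analysis.Complex_Transcendental" "Jordan_Normal_Form.Schur_Decomposition"
begin

text \<open>For composable oriented edges of the quotient \<open>X\<close> put \<open>t(e, e') = u w(e, e')\<close>. Every closed path is a power
of exactly one primitive closed path, and a prime cycle of length \<open>l\<close> has exactly \<open>l\<close> representatives.
Therefore the logarithm of the Euler product is the sum of \<open>t(p) / |p|\<close> over all nonempty closed paths \<open>p\<close>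
(\<open>has_prod_prime_cycles\<close>). For a finite set of edges the same sum is \<open>- log det(1 - t)\<close>, because the closed
paths of length \<open>n\<close> add up to the trace of \<open>t\<^sup>n\<close> (\<open>exp_cyclic_sum_eq_det\<close>).

The graph \<open>X\<close> may be infinite, but outside a finite part it has a simple shape. Let \<open>r\<close> be a ray towards a cusp, with
edges \<open>r\<^sub>n\<close> and vertices \<open>x\<^sub>n\<close>. Far out, the stabilizer of \<open>x\<^sub>n\<close> fixes the outward edge \<open>r\<^sub>n\<close> and permutes
all other edges at \<open>x\<^sub>n\<close> transitively. So \<open>X\<close> is a finite core to which finitely many half-lines are attached;
on them the outward edges have weight \<open>1\<close> and the inward edges at \<open>x\<^sub>n\<close> have weight \<open>q\<^sub>n = val(x\<^sub>n) - 1\<close>. The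
step from an inward edge back to its reverse has weight \<open>1 - 1 = 0\<close>: a path of nonzero weight that turns
inward returns to the core, and an excursion into a cusp is determined by the level at which it turns.

Cut the cusps at level \<open>k\<close>. The cusp edges carry no closed path of nonzero weight, so they can be eliminated
by a Schur complement without changing the determinant (\<open>det_eliminate_block\<close>, \<open>truncated_zeta\<close>). What remains
is a determinant indexed by the core. If the levels of a cusp are numbered from the core, the cusp enters it only
through a partial sum of \<open>\<Sum>\<^sub>m (q\<^sub>m\<^sub>+\<^sub>1 - 1) q\<^sub>0 \<dots> q\<^sub>m u\<^sup>2\<^sup>m\<^sup>+\<^sup>3\<close>. The valencies are eventually periodic, so up to finitely many terms this
series is a finite sum of geometric series and hence rational in \<open>u\<close>. As \<open>k\<close> grows, the determinants converge
to a rational function with value \<open>1\<close> at \<open>u = 0\<close>, which is the reciprocal of the Euler product.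

The shape of the cusps comes from the transitivity on a horocycle. A ray from \<open>x\<^sub>n\<close> that does not begin with
\<open>r\<^sub>n\<close> descends to that horocycle, and an element that carries \<open>r\<close> to the place where it arrives fixes \<open>r\<close> from
\<open>x\<^sub>n\<close> on and maps the edge before \<open>x\<^sub>n\<close> onto the reverse of the first edge of the ray (\<open>cusp_branching\<close>). What
has to be excluded is that the image of \<open>r\<close> folds back in \<open>X\<close> again and again. In that case \<open>r\<close> would meet only
finitely many orbits of edges, the stabilizers along \<open>r\<close> would be bounded, from some point on \<open>r\<close> would be the
only way down, and \<open>\<Gamma>\<close> would contain a translation along \<open>r\<close>. This contradicts the condition that
elements of \<open>\<Gamma>\<close> fixing a cusp preserve its horocycles (\<open>cusp_infinite_orbits\<close>, \<open>cusp_unfolded_beyond\<close>).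
Further orbits of edges at \<open>x\<^sub>n\<close>, and coincidences between rays whose images in \<open>X\<close> do not merge, occur for finitely
many \<open>n\<close> only.\<close>

section \<open>Cyclic products and matrices\<close>

definition cyclic_prod :: "('a \<Rightarrow> 'a \<Rightarrow> 'b::comm_monoid_mult) \<Rightarrow> 'a list \<Rightarrow> 'b" where
  "cyclic_prod t p = (\<Prod>j<length p. t (p ! j) (p ! (Suc j mod length p)))"

text \<open>Unlike the cyclic product, the product along a walk with a fixed starting point obeys a recursion on the
word. Sums over all words of a given length are computed through it.\<close>

fun walk_prod :: "('a \<Rightarrow> 'a \<Rightarrow> 'b::comm_monoid_mult) \<Rightarrow> 'a \<Rightarrow> 'a list \<Rightarrow> 'b" where
  "walk_prod t x [] = 1"
| "walk_prod t x (y # p) = t x y * walk_prod t y p"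

lemma walk_prod_nth: "walk_prod t x p = (\<Prod>j<length p. t ((x # p) ! j) (p ! j))"
  by (induction t x p rule: walk_prod.induct) (simp_all add: prod.lessThan_Suc_shift del: prod.lessThan_Suc)

lemma cyclic_prod_Cons: "cyclic_prod t (x # p) = walk_prod t x (p @ [x])"
  unfolding cyclic_prod_def walk_prod_nth
  by (intro prod.cong) (auto simp: nth_append nth_Cons mod_if split: nat.splits)

definition words :: "'a set \<Rightarrow> nat \<Rightarrow> 'a list set" where
  "words J n = {p. set p \<subseteq> J \<and> length p = n}"

lemma finite_words: "finite J \<Longrightarrow> finite (words J n)"
  unfolding words_def using finite_lists_length_eq by auto

lemma words_Suc: "words J (Suc n) = (\<lambda>(x, p). x # p) ` (J \<times> words J n)"
  by (auto simp: words_def length_Suc_conv image_iff)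

lemma sum_words_Suc:
  "(\<Sum>p\<in>words J (Suc n). f p) = (\<Sum>x\<in>J. \<Sum>p\<in>words J n. f (x # p))"
  unfolding words_Suc by (subst sum.reindex) (auto simp: inj_on_def sum.cartesian_product intro!: sum.cong)

lemma words_0: "words J 0 = {[]}"
  by (auto simp: words_def)

text \<open>Every step multiplies the total weight by a row sum of \<open>t\<close>, hence by at most \<open>\<rho>\<close>; the closing step to \<open>z\<close>
is a single term of such a row sum.\<close>

lemma sum_walk_prod_le:
  fixes t :: "'a \<Rightarrow> 'a \<Rightarrow> real" and \<rho> :: real
  assumes "\<And>x y. t x y \<ge> 0" "\<And>x. x \<in> J \<Longrightarrow> (\<Sum>y\<in>J. t x y) \<le> \<rho>" "\<rho> \<ge> 0" "finite J" "x \<in> J" "z \<in> J"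
  shows "(\<Sum>p\<in>words J n. walk_prod t x (p @ [z])) \<le> \<rho> ^ Suc n"
  using \<open>x \<in> J\<close>
proof (induction n arbitrary: x)
  case 0
  have "t x z \<le> (\<Sum>y\<in>J. t x y)"
    using assms by (intro member_le_sum) auto
  then show ?case using assms(2)[OF 0] by (simp add: words_0)
next
  case (Suc n)
  have "(\<Sum>p\<in>words J (Suc n). walk_prod t x (p @ [z]))
      = (\<Sum>y\<in>J. t x y * (\<Sum>p\<in>words J n. walk_prod t y (p @ [z])))"
    by (simp add: sum_words_Suc sum_distrib_left)
  also have "\<dots> \<le> (\<Sum>y\<in>J. t x y * \<rho> ^ Suc n)"
    by (intro sum_mono mult_left_mono Suc.IH assms)
  also have "\<dots> = (\<Sum>y\<in>J. t x y) * \<rho> ^ Suc n"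
    by (simp add: sum_distrib_right)
  also have "\<dots> \<le> \<rho> * \<rho> ^ Suc n"
    using assms Suc.prems by (intro mult_right_mono) auto
  finally show ?case by simp
qed

lemma sum_cyclic_prod_le:
  fixes t :: "'a \<Rightarrow> 'a \<Rightarrow> real" and \<rho> :: real
  assumes "\<And>x y. t x y \<ge> 0" "\<And>x. x \<in> J \<Longrightarrow> (\<Sum>y\<in>J. t x y) \<le> \<rho>" "\<rho> \<ge> 0" "finite J"
  shows "(\<Sum>p\<in>words J (Suc n). cyclic_prod t p) \<le> card J * \<rho> ^ Suc n"
proof -
  have "(\<Sum>p\<in>words J (Suc n). cyclic_prod t p) = (\<Sum>x\<in>J. \<Sum>p\<in>words J n. walk_prod t x (p @ [x]))"
    by (simp add: sum_words_Suc cyclic_prod_Cons)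
  also have "\<dots> \<le> (\<Sum>x\<in>J. \<rho> ^ Suc n)"
    by (intro sum_mono sum_walk_prod_le assms)
  finally show ?thesis by simp
qed

text \<open>The empty word contributes nothing, since division by \<open>0\<close> yields \<open>0\<close>.\<close>

abbreviation has_word_sum :: "('a \<Rightarrow> 'a \<Rightarrow> complex) \<Rightarrow> 'a set \<Rightarrow> complex \<Rightarrow> bool" where
  "has_word_sum t A S \<equiv> ((\<lambda>p. cyclic_prod t p / of_nat (length p)) has_sum S) (lists A)"

lemma norm_cyclic_prod:
  fixes t :: "'a \<Rightarrow> 'a \<Rightarrow> 'b::real_normed_field"
  shows "norm (cyclic_prod t p) = cyclic_prod (\<lambda>x y. norm (t x y)) p"
  by (simp add: cyclic_prod_def prod_norm)

lemma lists_words: "bij_betw snd (SIGMA n:UNIV. words J n) (lists J)"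
  by (rule bij_betwI[where g="\<lambda>p. (length p, p)"]) (auto simp: words_def)

definition kernel_mat :: "('a \<Rightarrow> 'a \<Rightarrow> complex) \<Rightarrow> 'a list \<Rightarrow> 'a list \<Rightarrow> complex mat" where
  "kernel_mat t xs ys = mat (length xs) (length ys) (\<lambda>(i, j). t (xs ! i) (ys ! j))"

lemma kernel_mat_carrier [simp]: "kernel_mat t xs ys \<in> carrier_mat (length xs) (length ys)"
  by (simp add: kernel_mat_def)

lemma dim_kernel_mat [simp]: "dim_row (kernel_mat t xs ys) = length xs" "dim_col (kernel_mat t xs ys) = length ys"
  by (simp_all add: kernel_mat_def)

lemma kernel_mat_index [simp]:
  "i < length xs \<Longrightarrow> j < length ys \<Longrightarrow> kernel_mat t xs ys $$ (i, j) = t (xs ! i) (ys ! j)"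
  by (simp add: kernel_mat_def)

lemma sum_set_conv_nth: "distinct xs \<Longrightarrow> (\<Sum>x\<in>set xs. f x) = (\<Sum>i = 0..<length xs. f (xs ! i))"
  by (simp add: sum.distinct_set_conv_list sum_list_sum_nth)

lemma kernel_mat_mult:
  assumes "distinct ys"
  shows "kernel_mat s xs ys * kernel_mat t ys zs = kernel_mat (\<lambda>x z. \<Sum>y\<in>set ys. s x y * t y z) xs zs"
  by (rule eq_matI) (auto simp: scalar_prod_def sum_set_conv_nth[OF assms])

lemma pow_mat_Suc_left:
  assumes "A \<in> carrier_mat n n"
  shows "A ^\<^sub>m Suc k = A * A ^\<^sub>m k"
proof (induction k)
  case 0
  show ?case using assms by simp
next
  case (Suc k)
  have "A ^\<^sub>m Suc (Suc k) = (A * A ^\<^sub>m k) * A"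
    using Suc by simp
  also have "\<dots> = A * A ^\<^sub>m Suc k"
    using assms by (simp add: assoc_mult_mat[of _ n n _ n _ n])
  finally show ?case .
qed

text \<open>The entries of a matrix power collect the walks of fixed length between two entries of \<open>xs\<close>; on the diagonal
these walks are closed and carry cyclic products.\<close>

lemma kernel_mat_pow:
  assumes "distinct xs"
  shows "kernel_mat t xs xs ^\<^sub>m Suc n =
    kernel_mat (\<lambda>x z. \<Sum>p\<in>words (set xs) n. walk_prod t x (p @ [z])) xs xs"
proof (induction n)
  case 0
  show ?case
    by (rule eq_matI) (auto simp: words_0)
next
  case (Suc n)
  have "kernel_mat t xs xs ^\<^sub>m Suc (Suc n) = kernel_mat t xs xs * kernel_mat t xs xs ^\<^sub>m Suc n"
    by (rule pow_mat_Suc_left[OF kernel_mat_carrier])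
  also have "\<dots> = kernel_mat (\<lambda>x z. \<Sum>p\<in>words (set xs) (Suc n). walk_prod t x (p @ [z])) xs xs"
    unfolding Suc.IH by (subst kernel_mat_mult[OF assms]) (simp add: sum_words_Suc sum_distrib_left)
  finally show ?case .
qed

definition mat_trace :: "'a::semiring_1 mat \<Rightarrow> 'a" where
  "mat_trace A = (\<Sum>i<dim_row A. A $$ (i, i))"

lemma mat_trace_mult_comm:
  fixes A :: "'a::comm_semiring_1 mat"
  assumes "A \<in> carrier_mat n m" "B \<in> carrier_mat m n"
  shows "mat_trace (A * B) = mat_trace (B * A)"
proof -
  have "mat_trace (A * B) = (\<Sum>i<n. \<Sum>j<m. A $$ (i, j) * B $$ (j, i))"
    using assms by (auto simp: mat_trace_def scalar_prod_def atLeast0LessThan intro!: sum.cong)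
  also have "\<dots> = (\<Sum>j<m. \<Sum>i<n. B $$ (j, i) * A $$ (i, j))"
    by (subst sum.swap) (simp add: mult.commute)
  also have "\<dots> = mat_trace (B * A)"
    using assms by (auto simp: mat_trace_def scalar_prod_def atLeast0LessThan intro!: sum.cong)
  finally show ?thesis .
qed

lemma mat_trace_similar:
  fixes A :: "'a::comm_semiring_1 mat"
  assumes "similar_mat_wit A B P Q"
  shows "mat_trace A = mat_trace B"
proof -
  define n where "n = dim_row A"
  have c: "A \<in> carrier_mat n n" "B \<in> carrier_mat n n" "P \<in> carrier_mat n n" "Q \<in> carrier_mat n n"
    and QP: "Q * P = 1\<^sub>m n" and A: "A = P * B * Q"
    using assms unfolding similar_mat_wit_def n_def Let_def by blast+
  have "mat_trace A = mat_trace (Q * (P * B))"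
    unfolding A using c by (intro mat_trace_mult_comm[of _ n n]) auto
  also have "Q * (P * B) = B"
    using c QP assoc_mult_mat[of Q n n P n B n] by simp
  finally show ?thesis .
qed

lemma upper_triangular_pow:
  fixes B :: "'a::comm_semiring_1 mat"
  assumes B: "B \<in> carrier_mat n n" "upper_triangular B"
  shows "upper_triangular (B ^\<^sub>m k) \<and> (\<forall>i<n. (B ^\<^sub>m k) $$ (i, i) = (B $$ (i, i)) ^ k)"
proof (induction k)
  case 0
  show ?case using B by (auto simp: upper_triangular_def)
next
  case (Suc k)
  let ?P = "B ^\<^sub>m k"
  have P: "?P \<in> carrier_mat n n" using B by simp
  have entry: "(?P * B) $$ (i, j) = (\<Sum>l<n. ?P $$ (i, l) * B $$ (l, j))" if "i < n" "j < n" for i j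
    using that B P by (auto simp: scalar_prod_def atLeast0LessThan intro!: sum.cong)
  have up: "?P $$ (i, l) = 0" if "l < i" "i < n" for i l
    using Suc that P B by (auto simp: upper_triangular_def)
  have uB: "B $$ (i, l) = 0" if "l < i" "i < n" for i l
    using B that by (auto simp: upper_triangular_def)
  have "(?P * B) $$ (i, j) = 0" if "j < i" "i < n" for i j
    unfolding entry[OF that(2) less_trans[OF that]]
  proof (rule sum.neutral, rule ballI)
    fix l assume "l \<in> {..<n}"
    then show "?P $$ (i, l) * B $$ (l, j) = 0"
      using up[of l i] uB[of j l] that by (cases "l < i") auto
  qed
  moreover have "(?P * B) $$ (i, i) = (B $$ (i, i)) ^ Suc k" if "i < n" for i
  proof -
    have "(\<Sum>l<n. ?P $$ (i, l) * B $$ (l, i)) = (\<Sum>l<n. if l = i then ?P $$ (i, i) * B $$ (i, i) else 0)"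
    proof (intro sum.cong refl)
      fix l assume "l \<in> {..<n}"
      then show "?P $$ (i, l) * B $$ (l, i) = (if l = i then ?P $$ (i, i) * B $$ (i, i) else 0)"
        using up[of l i] uB[of i l] that by (cases "l < i"; cases "l = i") auto
    qed
    then show ?thesis
      using that Suc entry[OF that that] by (simp add: mult.commute)
  qed
  ultimately show ?case using B P by (auto simp: upper_triangular_def)
qed

text \<open>A complex matrix is similar to an upper triangular one, whose traces of powers and determinant of \<open>1 - A\<close>
are read off the diagonal.\<close>

lemma trace_powers_eigenvalues:
  fixes A :: "complex mat"
  assumes A: "A \<in> carrier_mat n n"
  obtains ev where "\<And>k. mat_trace (A ^\<^sub>m k) = (\<Sum>i<n. ev i ^ k)"
    and "det (1\<^sub>m n - A) = (\<Prod>i<n. 1 - ev i)"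
    and "\<And>i. i < n \<Longrightarrow> eigenvalue A (ev i)"
proof -
  obtain as where as: "char_poly A = (\<Prod>a\<leftarrow>as. [:- a, 1:])"
    using char_poly_factorized[OF A] by blast
  obtain B where B: "B \<in> carrier_mat n n" "upper_triangular B" "similar_mat A B"
    using schur_decomposition_exists[OF A as] by blast
  obtain P Q where wit: "similar_mat_wit A B P Q"
    using B(3) by (auto simp: similar_mat_def)
  have c: "P \<in> carrier_mat n n" "Q \<in> carrier_mat n n" and PQ: "P * Q = 1\<^sub>m n" "Q * P = 1\<^sub>m n"
    and AB: "A = P * B * Q"
    using wit A by (auto simp: similar_mat_wit_def Let_def)
  define ev where "ev i = B $$ (i, i)" for i
  show ?thesis
  proof
    fix k
    have "mat_trace (A ^\<^sub>m k) = mat_trace (B ^\<^sub>m k)"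
      by (rule mat_trace_similar[OF similar_mat_wit_pow[OF wit]])
    also have "\<dots> = (\<Sum>i<n. ev i ^ k)"
      using upper_triangular_pow[OF B(1,2), of k] B(1)
      by (auto simp: mat_trace_def ev_def intro!: sum.cong)
    finally show "mat_trace (A ^\<^sub>m k) = (\<Sum>i<n. ev i ^ k)" .
  next
    have "P * (1\<^sub>m n - B) * Q = 1\<^sub>m n - A"
      using A B c PQ by (simp add: AB mult_minus_distrib_mat[of _ n n _ n] minus_mult_distrib_mat[of _ n n _ _ n])
    then have "similar_mat_wit (1\<^sub>m n - A) (1\<^sub>m n - B) P Q"
      using A B c PQ by (auto simp: similar_mat_wit_def Let_def)
    then have "det (1\<^sub>m n - A) = det (1\<^sub>m n - B)"
      by (intro det_similar) (auto simp: similar_mat_def)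
    also have "\<dots> = prod_list (diag_mat (1\<^sub>m n - B))"
      using B by (intro det_upper_triangular) (auto simp: upper_triangular_def)
    also have "\<dots> = (\<Prod>i<n. 1 - ev i)"
      using B by (simp add: diag_mat_def prod.list_conv_set_nth ev_def atLeast0LessThan)
    finally show "det (1\<^sub>m n - A) = (\<Prod>i<n. 1 - ev i)" .
  next
    fix i assume "i < n"
    have "char_poly A = char_poly B"
      by (rule char_poly_similar[OF B(3)])
    also have "\<dots> = (\<Prod>a\<leftarrow>diag_mat B. [:- a, 1:])"
      by (rule char_poly_upper_triangular[OF B(1,2)])
    finally have "poly (char_poly A) (ev i) = (\<Prod>a\<leftarrow>diag_mat B. ev i - a)"
      by (simp add: poly_prod_list o_def)
    also have "\<dots> = 0"
      using \<open>i < n\<close> B by (auto simp: prod_list_zero_iff diag_mat_def ev_def)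
    finally show "eigenvalue A (ev i)"
      by (simp add: eigenvalue_root_char_poly[OF A])
  qed
qed

text \<open>Evaluate the eigenvalue equation at an entry of the eigenvector of largest modulus.\<close>

lemma norm_eigenvalue_le_row_sums:
  fixes A :: "complex mat"
  assumes A: "A \<in> carrier_mat n n" and ev: "eigenvalue A k"
    and row: "\<And>i. i < n \<Longrightarrow> (\<Sum>j<n. norm (A $$ (i, j))) \<le> \<rho>"
  shows "norm k \<le> \<rho>"
proof -
  obtain v where v: "v \<in> carrier_vec n" "v \<noteq> 0\<^sub>v n" "A *\<^sub>v v = k \<cdot>\<^sub>v v"
    using ev A by (auto simp: eigenvalue_def eigenvector_def)
  have n: "{..<n} \<noteq> {}"
    using v by (auto simp: vec_eq_iff)
  define M where "M = Max ((\<lambda>i. norm (v $ i)) ` {..<n})"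
  have le: "norm (v $ i) \<le> M" if "i < n" for i
    unfolding M_def using that by (intro Max_ge) auto
  have "M \<in> (\<lambda>i. norm (v $ i)) ` {..<n}"
    unfolding M_def using n by (intro Max_in) auto
  then obtain i where i: "i < n" "norm (v $ i) = M" by auto
  have "M > 0"
  proof -
    obtain j where "j < n" "v $ j \<noteq> 0" using v by (auto simp: vec_eq_iff)
    then show ?thesis using le[of j] by (smt (verit) zero_less_norm_iff)
  qed
  have "k * v $ i = (A *\<^sub>v v) $ i"
    using v i by simp
  also have "\<dots> = (\<Sum>j<n. A $$ (i, j) * v $ j)"
    using A v(1) i by (auto simp: scalar_prod_def atLeast0LessThan intro!: sum.cong)
  finally have "norm k * M = norm (\<Sum>j<n. A $$ (i, j) * v $ j)"
    using i by (metis norm_mult)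
  also have "\<dots> \<le> (\<Sum>j<n. norm (A $$ (i, j)) * M)"
    by (rule order_trans[OF norm_sum]) (auto simp: norm_mult intro!: sum_mono mult_left_mono le)
  also have "\<dots> \<le> \<rho> * M"
    unfolding sum_distrib_right[symmetric] using row[OF i(1)] \<open>M > 0\<close> by (intro mult_right_mono) auto
  finally show ?thesis using \<open>M > 0\<close> by simp
qed

lemma kernel_trace_pow:
  assumes "distinct xs"
  shows "mat_trace (kernel_mat t xs xs ^\<^sub>m Suc n) = (\<Sum>p\<in>words (set xs) (Suc n). cyclic_prod t p)"
  unfolding kernel_mat_pow[OF assms] mat_trace_def
  by (simp add: sum_words_Suc cyclic_prod_Cons sum_set_conv_nth[OF assms] atLeast0LessThan)

lemma Ln_one_minus_sums:
  assumes "norm (z::complex) < 1"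
  shows "(\<lambda>n. z ^ n / of_nat n) sums - Ln (1 - z)"
  using sums_minus[OF Ln_series'[of "- z"]] assms by simp

text \<open>The words of length \<open>k\<close> contribute \<open>tr(t\<^sup>k) / k\<close>, a sum of \<open>ev\<^sup>k / k\<close> over the eigenvalues, and
\<open>\<Sum>\<^sub>k ev\<^sup>k / k = - log(1 - ev)\<close>. The bound on the row sums puts the eigenvalues into the unit disc and makes the
sum over all words converge absolutely.\<close>

theorem exp_cyclic_sum_eq_det:
  fixes t :: "'a \<Rightarrow> 'a \<Rightarrow> complex" and \<rho> :: real
  assumes dist: "distinct xs" and row: "\<And>x. x \<in> set xs \<Longrightarrow> (\<Sum>y\<in>set xs. norm (t x y)) \<le> \<rho>"
    and \<rho>: "0 \<le> \<rho>" "\<rho> < 1"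
  shows "\<exists>S. has_word_sum t (set xs) S \<and>
    exp (- S) = det (1\<^sub>m (length xs) - kernel_mat t xs xs)"
proof -
  define J where "J = set xs"
  define n where "n = length xs"
  define A where "A = kernel_mat t xs xs"
  define f where "f p = cyclic_prod t p / of_nat (length p)" for p
  have A: "A \<in> carrier_mat n n" by (simp add: A_def n_def)
  obtain ev where tr: "\<And>k. mat_trace (A ^\<^sub>m k) = (\<Sum>i<n. ev i ^ k)"
    and det: "det (1\<^sub>m n - A) = (\<Prod>i<n. 1 - ev i)" and ev: "\<And>i. i < n \<Longrightarrow> eigenvalue A (ev i)"
    using trace_powers_eigenvalues[OF A] by metis
  have small: "norm (ev i) < 1" if "i < n" for i
  proof -
    have "norm (ev i) \<le> \<rho>"
    proof (rule norm_eigenvalue_le_row_sums[OF A ev[OF that]])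
      fix i assume "i < n"
      then show "(\<Sum>j<n. norm (A $$ (i, j))) \<le> \<rho>"
        using row[of "xs ! i"] by (simp add: A_def n_def sum_set_conv_nth[OF dist] atLeast0LessThan)
    qed
    then show ?thesis using \<rho> by simp
  qed
  have fin: "finite (words J k)" for k
    by (simp add: finite_words J_def)
  have sum_f: "(\<Sum>p\<in>words J k. f p) = (\<Sum>i<n. ev i ^ k / of_nat k)" for k
  proof (cases k)
    case 0
    then show ?thesis by (simp add: words_0 f_def)
  next
    case (Suc m)
    have "(\<Sum>p\<in>words J k. f p) = (\<Sum>p\<in>words J k. cyclic_prod t p / of_nat k)"
      by (intro sum.cong) (auto simp: f_def words_def)
    also have "\<dots> = (\<Sum>p\<in>words J k. cyclic_prod t p) / of_nat k"
      by (simp add: sum_divide_distrib)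
    also have "(\<Sum>p\<in>words J k. cyclic_prod t p) = mat_trace (A ^\<^sub>m k)"
      unfolding A_def Suc J_def by (rule kernel_trace_pow[OF dist, symmetric])
    finally show ?thesis by (simp add: tr sum_divide_distrib)
  qed
  have abs_f: "(\<Sum>p\<in>words J k. norm (f p)) \<le> card J * \<rho> ^ k" for k
  proof (cases k)
    case 0
    then show ?thesis by (simp add: words_0 f_def)
  next
    case (Suc m)
    have "(\<Sum>p\<in>words J k. norm (f p)) \<le> (\<Sum>p\<in>words J k. cyclic_prod (\<lambda>x y. norm (t x y)) p)"
    proof (rule sum_mono)
      fix p assume "p \<in> words J k"
      then have "real (length p) \<ge> 1" by (simp add: words_def Suc)
      then have "norm (cyclic_prod t p) / real (length p) \<le> norm (cyclic_prod t p) / 1"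
        by (intro divide_left_mono) auto
      then show "norm (f p) \<le> cyclic_prod (\<lambda>x y. norm (t x y)) p"
        by (simp add: f_def norm_divide norm_cyclic_prod)
    qed
    also have "\<dots> \<le> card J * \<rho> ^ k"
      unfolding Suc J_def by (intro sum_cyclic_prod_le) (use row \<rho> in auto)
    finally show ?thesis .
  qed
  define S where "S = (\<Sum>i<n. - Ln (1 - ev i))"
  have "(\<lambda>x. f (snd x)) abs_summable_on (SIGMA k:UNIV. words J k)"
    unfolding abs_summable_on_Sigma_iff
  proof (intro conjI ballI)
    fix k :: nat
    show "(\<lambda>p. f (snd (k, p))) abs_summable_on words J k"
      using fin by simp
  next
    have "summable (\<lambda>k. norm (\<Sum>p\<in>words J k. norm (f p)))"
    proof (rule summable_comparison_test')
      show "summable (\<lambda>k. card J * \<rho> ^ k)" using \<rho> by (intro summable_mult summable_geometric) auto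
      show "norm (norm (\<Sum>p\<in>words J k. norm (f p))) \<le> card J * \<rho> ^ k" for k
        using abs_f[of k] by (simp add: sum_nonneg)
    qed
    then show "(\<lambda>k. \<Sum>\<^sub>\<infinity>p\<in>words J k. norm (f (snd (k, p)))) abs_summable_on UNIV"
      using fin by (simp add: norm_summable_imp_summable_on)
  qed
  then have "(\<lambda>x. f (snd x)) summable_on (SIGMA k:UNIV. words J k)"
    by (rule abs_summable_summable)
  then obtain S' where S': "((\<lambda>x. f (snd x)) has_sum S') (SIGMA k:UNIV. words J k)"
    by (auto simp: summable_on_def)
  have "((\<lambda>k. \<Sum>p\<in>words J k. f p) has_sum S') UNIV"
    by (rule has_sum_SigmaD[OF S']) (use fin in auto)
  then have "(\<lambda>k. \<Sum>p\<in>words J k. f p) sums S'"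
    by (rule has_sum_imp_sums)
  moreover have "(\<lambda>k. \<Sum>p\<in>words J k. f p) sums S"
    unfolding sum_f S_def by (intro sums_sum Ln_one_minus_sums small) auto
  ultimately have "S' = S" by (rule sums_unique2)
  then have "(f has_sum S) (lists J)"
    using S' has_sum_reindex_bij_betw[OF lists_words, where f=f and S=S] by simp
  moreover have "exp (- S) = det (1\<^sub>m (length xs) - kernel_mat t xs xs)"
  proof -
    have "exp (- S) = (\<Prod>i<n. exp (Ln (1 - ev i)))"
      unfolding S_def by (simp add: sum_negf exp_sum)
    also have "\<dots> = (\<Prod>i<n. 1 - ev i)"
    proof (intro prod.cong refl exp_Ln)
      fix i assume "i \<in> {..<n}"
      then show "1 - ev i \<noteq> 0" using small[of i] by auto
    qed
    also have "\<dots> = det (1\<^sub>m n - A)" by (rule det[symmetric])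
    finally show ?thesis by (simp only: A_def n_def)
  qed
  ultimately show ?thesis
    unfolding f_def J_def by blast
qed

section \<open>Elimination of a block\<close>

abbreviation kdelta :: "'a \<Rightarrow> 'a \<Rightarrow> complex" where
  "kdelta x y \<equiv> (if x = y then 1 else 0)"

lemma one_minus_kernel_mat:
  assumes "distinct xs"
  shows "1\<^sub>m (length xs) - kernel_mat t xs xs = kernel_mat (\<lambda>x y. kdelta x y - t x y) xs xs"
  by (rule eq_matI) (auto simp: nth_eq_iff_index_eq[OF assms])

lemma kernel_mat_append:
  "kernel_mat t (xs @ ys) (xs @ ys) =
    four_block_mat (kernel_mat t xs xs) (kernel_mat t xs ys) (kernel_mat t ys xs) (kernel_mat t ys ys)"
  by (rule eq_matI) (auto simp: nth_append)

lemma det_kernel_mat_append: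
  assumes "\<And>x y. x \<in> set ys \<Longrightarrow> y \<in> set xs \<Longrightarrow> t x y = 0"
  shows "det (kernel_mat t (xs @ ys) (xs @ ys)) = det (kernel_mat t xs xs) * det (kernel_mat t ys ys)"
proof -
  have "kernel_mat t ys xs = 0\<^sub>m (length ys) (length xs)"
    by (rule eq_matI) (auto simp: assms)
  then show ?thesis
    unfolding kernel_mat_append by (intro det_four_block_mat_lower_left_zero) auto
qed

lemma det_kernel_mat_append':
  assumes "\<And>x y. x \<in> set xs \<Longrightarrow> y \<in> set ys \<Longrightarrow> t x y = 0"
  shows "det (kernel_mat t (xs @ ys) (xs @ ys)) = det (kernel_mat t xs xs) * det (kernel_mat t ys ys)"
proof -
  have "kernel_mat t xs ys = 0\<^sub>m (length xs) (length ys)"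
    by (rule eq_matI) (auto simp: assms)
  then show ?thesis
    unfolding kernel_mat_append by (intro det_four_block_mat_upper_right_zero) auto
qed

lemma kernel_mat_cong:
  "(\<And>x y. x \<in> set xs \<Longrightarrow> y \<in> set ys \<Longrightarrow> s x y = t x y) \<Longrightarrow> kernel_mat s xs ys = kernel_mat t xs ys"
  by (rule eq_matI) auto

lemma kernel_mat_kdelta: "distinct xs \<Longrightarrow> kernel_mat kdelta xs xs = 1\<^sub>m (length xs)"
  by (rule eq_matI) (auto simp: nth_eq_iff_index_eq)

lemma sum_kdelta:
  assumes "finite A"
  shows "x \<in> A \<Longrightarrow> (\<Sum>y\<in>A. kdelta x y * f y) = f x" "x \<notin> A \<Longrightarrow> (\<Sum>y\<in>A. kdelta x y * f y) = 0"
    "x \<in> A \<Longrightarrow> (\<Sum>y\<in>A. f y * kdelta y x) = f x" "x \<notin> A \<Longrightarrow> (\<Sum>y\<in>A. f y * kdelta y x) = 0"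
  using assms by (auto simp: sum.delta sum.delta' if_distrib[of "\<lambda>z. z * _"] if_distrib[of "\<lambda>z. _ * z"] cong: if_cong)

text \<open>The Schur complement. The hypothesis says that \<open>G\<close> solves \<open>(1 - t\<^sub>C\<^sub>C) G = t\<^sub>C\<^sub>F\<close>, where \<open>F\<close> and \<open>C\<close> are the sets of
entries of \<open>fs\<close> and \<open>cs\<close>; multiplication by the unipotent block matrix with lower left block \<open>G\<close> then clears
the lower left block of \<open>1 - t\<close>. With \<open>G\<close> given explicitly, no inverse of \<open>1 - t\<^sub>C\<^sub>C\<close> has to be formed.\<close>

theorem det_eliminate_block:
  assumes dist: "distinct (fs @ cs)"
    and G: "\<And>c f. c \<in> set cs \<Longrightarrow> f \<in> set fs \<Longrightarrow> G c f = t c f + (\<Sum>d\<in>set cs. t c d * G d f)"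
  shows "det (1\<^sub>m (length (fs @ cs)) - kernel_mat t (fs @ cs) (fs @ cs)) =
    det (1\<^sub>m (length fs) - kernel_mat (\<lambda>f g. t f g + (\<Sum>c\<in>set cs. t f c * G c g)) fs fs) *
    det (1\<^sub>m (length cs) - kernel_mat t cs cs)"
proof -
  define s where "s x y = kdelta x y - t x y" for x y
  \<comment> \<open>the unipotent matrix by which \<open>s = 1 - t\<close> is multiplied\<close>
  define v where "v x y = (if x \<in> set cs \<and> y \<in> set fs then G x y else kdelta x y)" for x y
  let ?n = "length (fs @ cs)" and ?xs = "fs @ cs"
  have dF: "distinct fs" and dC: "distinct cs" and disj: "set fs \<inter> set cs = {}"
    using dist by auto
  define w where "w x z = (\<Sum>y\<in>set ?xs. s x y * v y z)" for x z
  have w: "w x z = (\<Sum>y\<in>set fs. s x y * v y z) + (\<Sum>y\<in>set cs. s x y * v y z)" for x z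
    unfolding w_def set_append by (intro sum.union_disjoint) (use disj in auto)
  have wF: "w x z = s x z + (\<Sum>c\<in>set cs. s x c * G c z)" if "z \<in> set fs" for x z
  proof -
    have "(\<Sum>y\<in>set fs. s x y * v y z) = (\<Sum>y\<in>set fs. s x y * kdelta y z)"
      using disj by (intro sum.cong) (auto simp: v_def)
    moreover have "(\<Sum>y\<in>set cs. s x y * v y z) = (\<Sum>c\<in>set cs. s x c * G c z)"
      using that by (intro sum.cong) (auto simp: v_def)
    ultimately show ?thesis using that sum_kdelta(3)[of "set fs" z "s x"] by (simp add: w)
  qed
  have wC: "w x z = s x z" if "z \<in> set cs" for x z
  proof -
    have "z \<notin> set fs" using that disj by auto
    moreover have "(\<Sum>y\<in>set fs. s x y * v y z) = (\<Sum>y\<in>set fs. s x y * kdelta y z)"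
      using that disj by (intro sum.cong) (auto simp: v_def)
    moreover have "(\<Sum>y\<in>set cs. s x y * v y z) = (\<Sum>y\<in>set cs. s x y * kdelta y z)"
      using that disj by (intro sum.cong) (auto simp: v_def)
    ultimately show ?thesis
      using that sum_kdelta(3)[of "set cs" z "s x"] sum_kdelta(4)[of "set fs" z "s x"] by (simp add: w)
  qed
  have low: "w c f = 0" if "c \<in> set cs" "f \<in> set fs" for c f
  proof -
    have "(\<Sum>d\<in>set cs. s c d * G d f) = G c f - (\<Sum>d\<in>set cs. t c d * G d f)"
      using sum_kdelta(1)[of "set cs" c "\<lambda>d. G d f"] that by (simp add: s_def left_diff_distrib sum_subtractf)
    moreover have "c \<noteq> f" using that disj by auto
    moreover have "s c f = - t c f" using that disj by (auto simp: s_def)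
    ultimately show ?thesis
      using G[OF that] wF[OF that(2), of c] by (metis (no_types, lifting) add.commute add_diff_cancel_right' add_uminus_conv_diff diff_self)
  qed
  have "det (kernel_mat s ?xs ?xs * kernel_mat v ?xs ?xs) = det (kernel_mat s ?xs ?xs) * det (kernel_mat v ?xs ?xs)"
    by (rule det_mult[of _ ?n]) auto
  also have "det (kernel_mat v ?xs ?xs) = det (kernel_mat v fs fs) * det (kernel_mat v cs cs)"
    using disj by (intro det_kernel_mat_append') (auto simp: v_def)
  also have "kernel_mat v fs fs = kernel_mat kdelta fs fs"
    using disj by (intro kernel_mat_cong) (auto simp: v_def)
  also have "kernel_mat v cs cs = kernel_mat kdelta cs cs"
    using disj by (intro kernel_mat_cong) (auto simp: v_def)
  also have "kernel_mat s ?xs ?xs * kernel_mat v ?xs ?xs = kernel_mat w ?xs ?xs"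
    unfolding w_def by (rule kernel_mat_mult[OF dist])
  also have "det (kernel_mat w ?xs ?xs) = det (kernel_mat w fs fs) * det (kernel_mat w cs cs)"
    by (intro det_kernel_mat_append low)
  also have "kernel_mat w cs cs = kernel_mat s cs cs"
    by (intro kernel_mat_cong wC)
  also have "kernel_mat w fs fs = kernel_mat (\<lambda>f g. kdelta f g - (t f g + (\<Sum>c\<in>set cs. t f c * G c g))) fs fs"
  proof (rule kernel_mat_cong)
    fix f g assume fg: "f \<in> set fs" "g \<in> set fs"
    have "(\<Sum>c\<in>set cs. s f c * G c g) = (\<Sum>c\<in>set cs. - (t f c * G c g))"
      using fg disj by (intro sum.cong) (auto simp: s_def)
    then show "w f g = kdelta f g - (t f g + (\<Sum>c\<in>set cs. t f c * G c g))"
      using fg by (simp add: wF s_def sum_negf)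
  qed
  finally show ?thesis
    unfolding one_minus_kernel_mat[OF dist] one_minus_kernel_mat[OF dF] one_minus_kernel_mat[OF dC]
    by (simp add: s_def kernel_mat_kdelta dF dC)
qed

section \<open>Rational functions and limits\<close>

text \<open>The disc is fixed in advance and contains no zero of the denominator, so that finite sums and products of
such functions are again of this kind on the same disc.\<close>

definition rational_on :: "real \<Rightarrow> (complex \<Rightarrow> complex) \<Rightarrow> bool" where
  "rational_on e f \<longleftrightarrow> (\<exists>P Q. \<forall>u. norm u < e \<longrightarrow> poly Q u \<noteq> 0 \<and> f u = poly P u / poly Q u)"

lemma rational_onI:
  "(\<And>u. norm u < e \<Longrightarrow> poly Q u \<noteq> 0) \<Longrightarrow> (\<And>u. norm u < e \<Longrightarrow> f u = poly P u / poly Q u) \<Longrightarrow> rational_on e f"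
  unfolding rational_on_def by blast

lemma rational_on_poly: "rational_on e (poly P)"
  by (rule rational_onI[of e 1 _ P]) auto

lemma rational_on_const: "rational_on e (\<lambda>_. c)"
  using rational_on_poly[of e "[:c:]"] by (simp add: rational_on_def)

lemma rational_on_id: "rational_on e (\<lambda>u. u)"
  by (rule rational_onI[of e 1 _ "[:0, 1:]"]) auto

lemma rational_on_add:
  assumes "rational_on e f" "rational_on e g"
  shows "rational_on e (\<lambda>u. f u + g u)"
proof -
  obtain P Q R S where "\<And>u. norm u < e \<Longrightarrow> poly Q u \<noteq> 0 \<and> f u = poly P u / poly Q u"
      "\<And>u. norm u < e \<Longrightarrow> poly S u \<noteq> 0 \<and> g u = poly R u / poly S u"
    using assms unfolding rational_on_def by metis
  then show ?thesis
    by (intro rational_onI[of e "Q * S" _ "P * S + R * Q"]) (auto simp: add_frac_eq)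
qed

lemma rational_on_mult:
  assumes "rational_on e f" "rational_on e g"
  shows "rational_on e (\<lambda>u. f u * g u)"
proof -
  obtain P Q R S where "\<And>u. norm u < e \<Longrightarrow> poly Q u \<noteq> 0 \<and> f u = poly P u / poly Q u"
      "\<And>u. norm u < e \<Longrightarrow> poly S u \<noteq> 0 \<and> g u = poly R u / poly S u"
    using assms unfolding rational_on_def by metis
  then show ?thesis
    by (intro rational_onI[of e "Q * S" _ "P * R"]) auto
qed

lemma rational_on_sum: "(\<And>x. x \<in> A \<Longrightarrow> rational_on e (f x)) \<Longrightarrow> rational_on e (\<lambda>u. \<Sum>x\<in>A. f x u)"
  by (induction A rule: infinite_finite_induct) (auto intro: rational_on_const rational_on_add)

lemma rational_on_prod: "(\<And>x. x \<in> A \<Longrightarrow> rational_on e (f x)) \<Longrightarrow> rational_on e (\<lambda>u. \<Prod>x\<in>A. f x u)"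
  by (induction A rule: infinite_finite_induct) (auto intro: rational_on_const rational_on_mult)

lemma rational_on_power: "rational_on e f \<Longrightarrow> rational_on e (\<lambda>u. f u ^ n)"
  by (induction n) (auto intro: rational_on_const rational_on_mult)

text \<open>By the Leibniz formula determinants inherit rationality and convergence from the entries.\<close>

lemma det_kernel_mat:
  "det (kernel_mat t xs xs) = (\<Sum>p | p permutes {0..<length xs}. signof p * (\<Prod>i = 0..<length xs. t (xs ! i) (xs ! p i)))"
  unfolding det_def'[OF kernel_mat_carrier[of t xs xs]]
  by (intro sum.cong refl arg_cong2[where f="(*)"] prod.cong) (auto simp: permutes_in_image)

lemma rational_on_det:
  assumes "\<And>x y. rational_on e (\<lambda>u. t u x y)"
  shows "rational_on e (\<lambda>u. det (kernel_mat (t u) xs xs))"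
  unfolding det_kernel_mat by (intro rational_on_sum rational_on_mult rational_on_prod assms rational_on_const)

lemma tendsto_det_kernel_mat:
  assumes "\<And>x y. ((\<lambda>k. t k x y) \<longlongrightarrow> s x y) F"
  shows "((\<lambda>k. det (kernel_mat (t k) xs xs)) \<longlongrightarrow> det (kernel_mat s xs xs)) F"
  unfolding det_kernel_mat by (intro tendsto_sum tendsto_mult tendsto_prod assms tendsto_const)

text \<open>Shifting the index by \<open>p\<close> multiplies the tail \<open>R\<close> of the series by \<open>K(u)\<close>. Hence \<open>R\<close> is its first \<open>p\<close> terms
plus \<open>K(u) R\<close>, which determines \<open>R\<close>.\<close>

lemma rational_on_suminf_quasi_periodic:
  fixes f :: "complex \<Rightarrow> nat \<Rightarrow> complex"
  assumes summ: "\<And>u. norm u < e \<Longrightarrow> summable (f u)"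
    and rat: "\<And>m. rational_on e (\<lambda>u. f u m)"
    and rec: "\<And>u m. norm u < e \<Longrightarrow> m \<ge> N \<Longrightarrow> f u (m + p) = poly K u * f u m"
    and K: "\<And>u. norm u < e \<Longrightarrow> norm (poly K u) < 1"
  shows "rational_on e (\<lambda>u. suminf (f u))"
proof -
  have K1: "poly K u \<noteq> 1" if "norm u < e" for u using K[OF that] by auto
  have "suminf (f u) = (\<Sum>m<N. f u m) + (\<Sum>m<p. f u (m + N)) * inverse (1 - poly K u)" if u: "norm u < e" for u
  proof -
    define R where "R = (\<Sum>m. f u (m + N))"
    have s: "summable (\<lambda>m. f u (m + N))" using summ[OF u] by (simp add: summable_iff_shift)
    have "R = (\<Sum>m. f u (m + p + N)) + (\<Sum>m<p. f u (m + N))"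
      unfolding R_def by (rule suminf_split_initial_segment[OF s])
    also have "(\<lambda>m. f u (m + p + N)) = (\<lambda>m. poly K u * f u (m + N))"
      using rec[OF u, of "_ + N"] by (auto simp: add.assoc add.commute[of p N])
    also have "(\<Sum>m. poly K u * f u (m + N)) = poly K u * R"
      unfolding R_def by (rule suminf_mult[OF s])
    finally have "R * (1 - poly K u) = (\<Sum>m<p. f u (m + N))" by (simp add: algebra_simps)
    then have "R = (\<Sum>m<p. f u (m + N)) * inverse (1 - poly K u)"
      using K1[OF u] by (simp add: field_simps)
    then show ?thesis
      using suminf_split_initial_segment[OF summ[OF u], of N] by (simp add: R_def)
  qed
  moreover have "rational_on e (\<lambda>u. inverse (1 - poly K u))"
    by (rule rational_onI[of e "1 - K" _ 1]) (use K1 in \<open>auto simp: field_simps\<close>)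
  then have "rational_on e (\<lambda>u. (\<Sum>m<N. f u m) + (\<Sum>m<p. f u (m + N)) * inverse (1 - poly K u))"
    by (intro rational_on_add rational_on_mult rational_on_sum rat)
  ultimately show ?thesis unfolding rational_on_def by auto
qed

text \<open>The successor of an entry of maximal rank cannot have a larger rank, so that step has weight \<open>0\<close>.\<close>

lemma cyclic_prod_eq_0_of_rank:
  fixes t :: "'a \<Rightarrow> 'a \<Rightarrow> 'b::comm_semiring_1" and rank :: "'a \<Rightarrow> nat"
  assumes "p \<noteq> []" and "\<And>x y. x \<in> set p \<Longrightarrow> y \<in> set p \<Longrightarrow> t x y \<noteq> 0 \<Longrightarrow> rank x < rank y"
  shows "cyclic_prod t p = 0"
proof (rule ccontr)
  assume *: "cyclic_prod t p \<noteq> 0"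
  have "Max (rank ` set p) \<in> rank ` set p" using assms(1) by (intro Max_in) auto
  then obtain j where j: "j < length p" "rank (p ! j) = Max (rank ` set p)"
    by (auto simp: in_set_conv_nth)
  let ?y = "p ! (Suc j mod length p)"
  have y: "?y \<in> set p" using assms(1) by (intro nth_mem mod_less_divisor) simp
  have "t (p ! j) ?y \<noteq> 0" using * j(1) unfolding cyclic_prod_def by (metis finite_lessThan lessThan_iff prod_zero)
  then have "rank (p ! j) < rank ?y" using assms(2) y j(1) by auto
  moreover have "rank ?y \<le> Max (rank ` set p)" using y by (intro Max_ge) auto
  ultimately show False using j by simp
qed

text \<open>A finite set of terms that brings all larger partial sums close to \<open>S\<close> is eventually contained in \<open>B k\<close>.\<close>

lemma has_sum_increasing_union:
  fixes f :: "'a \<Rightarrow> 'b::real_normed_vector"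
  assumes S: "(f has_sum S) A" and s: "\<And>k. (f has_sum s k) (B k)" and sub: "\<And>k. B k \<subseteq> A"
    and ev: "\<And>T. finite T \<Longrightarrow> T \<subseteq> A \<Longrightarrow> eventually (\<lambda>k. T \<subseteq> B k) sequentially"
  shows "s \<longlonglongrightarrow> S"
proof (rule tendstoI)
  fix e :: real assume "e > 0"
  then have "eventually (\<lambda>T. dist (sum f T) S < e / 2) (finite_subsets_at_top A)"
    using tendstoD[OF S[unfolded has_sum_def], of "e / 2"] by simp
  then obtain X where X': "finite X \<and> X \<subseteq> A \<and> (\<forall>Y. finite Y \<and> X \<subseteq> Y \<and> Y \<subseteq> A \<longrightarrow> dist (sum f Y) S < e / 2)"
    unfolding eventually_finite_subsets_at_top by (elim exE)
  then have X: "finite X" "X \<subseteq> A" by simp_all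
  have "dist (s k) S < e" if k: "X \<subseteq> B k" for k
  proof -
    have "eventually (\<lambda>T. dist (sum f T) S \<le> e / 2) (finite_subsets_at_top (B k))"
      unfolding eventually_finite_subsets_at_top
    proof (intro exI[of _ X] conjI allI impI)
      fix Y assume Y: "finite Y \<and> X \<subseteq> Y \<and> Y \<subseteq> B k"
      then have "Y \<subseteq> A" using sub[of k] by blast
      then have "dist (sum f Y) S < e / 2" using X' Y by blast
      then show "dist (sum f Y) S \<le> e / 2" by simp
    next
      show "finite X" by (rule X(1))
      show "X \<subseteq> B k" by (rule k)
    qed
    moreover have "((\<lambda>T. dist (sum f T) S) \<longlongrightarrow> dist (s k) S) (finite_subsets_at_top (B k))"
      by (rule tendsto_dist[OF s[of k, unfolded has_sum_def] tendsto_const])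
    ultimately have "dist (s k) S \<le> e / 2"
      using tendsto_upperbound[OF _ _ finite_subsets_at_top_neq_bot] by fast
    then show ?thesis using \<open>e > 0\<close> by simp
  qed
  then show "eventually (\<lambda>k. dist (s k) S < e) sequentially"
    by (rule eventually_mono[OF ev[OF X(1,2)]])
qed

section \<open>A finite core with cusps\<close>

text \<open>The oriented edges of a finite graph with half-lines attached: \<open>Up i n\<close> and \<open>Down i n\<close> are the two orientations
of the edge at level \<open>n\<close> of the cusp \<open>i\<close>, and \<open>Up i n\<close> leads away from the core.\<close>

datatype ('f, 'i) cusp_edge = Core 'f | Up 'i nat | Down 'i nat

text \<open>The step weights on a quotient with cusps. Outward steps have weight \<open>1\<close>. At the vertex between the levels
\<open>n - 1\<close> and \<open>n\<close> there are \<open>q i n\<close> ways inward, one of which reverses the step if that vertex was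
reached by \<open>Up i (n - 1)\<close>. An inward edge is never followed by an outward one. The core edge \<open>\<alpha> i\<close> leads into the cusp \<open>i\<close>
and \<open>\<beta> i\<close> is the core edge by which it is left.\<close>

fun cusp_kernel :: "('f \<Rightarrow> 'f \<Rightarrow> real) \<Rightarrow> ('i \<Rightarrow> 'f) \<Rightarrow> ('i \<Rightarrow> 'f) \<Rightarrow> ('i \<Rightarrow> nat \<Rightarrow> real) \<Rightarrow>
    ('f, 'i) cusp_edge \<Rightarrow> ('f, 'i) cusp_edge \<Rightarrow> real" where
  "cusp_kernel W \<alpha> \<beta> q (Core f) (Core g) = W f g"
| "cusp_kernel W \<alpha> \<beta> q (Core f) (Up i n) = of_bool (n = 0 \<and> f = \<alpha> i)"
| "cusp_kernel W \<alpha> \<beta> q (Core f) (Down i n) = 0"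
| "cusp_kernel W \<alpha> \<beta> q (Up i n) (Core f) = 0"
| "cusp_kernel W \<alpha> \<beta> q (Up i n) (Up j m) = of_bool (j = i \<and> m = Suc n)"
| "cusp_kernel W \<alpha> \<beta> q (Up i n) (Down j m) = of_bool (j = i \<and> m = n) * (q i (Suc n) - 1)"
| "cusp_kernel W \<alpha> \<beta> q (Down i n) (Core f) = of_bool (n = 0 \<and> f = \<beta> i) * q i 0"
| "cusp_kernel W \<alpha> \<beta> q (Down i n) (Up j m) = 0"
| "cusp_kernel W \<alpha> \<beta> q (Down i n) (Down j m) = of_bool (j = i \<and> n = Suc m) * q i n"

definition cusp_edges :: "'f set \<Rightarrow> 'i set \<Rightarrow> ('f, 'i) cusp_edge set" where
  "cusp_edges F I = Core ` F \<union> {Up i n | i n. i \<in> I} \<union> {Down i n | i n. i \<in> I}"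

text \<open>The uniform bound \<open>D\<close> on the row sums fixes a disc of convergence that does not depend on where the cusps are cut.\<close>

locale cusp_system =
  fixes W :: "'f \<Rightarrow> 'f \<Rightarrow> real" and \<alpha> \<beta> :: "'i \<Rightarrow> 'f" and q :: "'i \<Rightarrow> nat \<Rightarrow> real"
    and F :: "'f set" and I :: "'i set" and D :: real
  assumes finF: "finite F" and finI: "finite I" and D: "D \<ge> 1"
    and attach: "\<And>i. i \<in> I \<Longrightarrow> \<alpha> i \<in> F \<and> \<beta> i \<in> F"
    and nonneg: "\<And>x y. x \<in> cusp_edges F I \<Longrightarrow> y \<in> cusp_edges F I \<Longrightarrow> 0 \<le> cusp_kernel W \<alpha> \<beta> q x y"
    and row: "\<And>x T. x \<in> cusp_edges F I \<Longrightarrow> finite T \<Longrightarrow> T \<subseteq> cusp_edges F I \<Longrightarrow>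
        (\<Sum>y\<in>T. cusp_kernel W \<alpha> \<beta> q x y) \<le> D"
    and periodic: "\<And>i. i \<in> I \<Longrightarrow> \<exists>p>0. \<exists>N. \<forall>n\<ge>N. q i (n + p) = q i n"
begin

abbreviation K where "K \<equiv> cusp_kernel W \<alpha> \<beta> q"

lemma q_bounds: assumes "i \<in> I" shows "0 \<le> q i n" "q i n \<le> D" "0 \<le> q i (Suc n) - 1"
proof -
  have D: "Down i n \<in> cusp_edges F I" "Up i n \<in> cusp_edges F I" for n using assms by (auto simp: cusp_edges_def)
  have C: "Core (\<beta> i) \<in> cusp_edges F I" using attach[OF assms] by (auto simp: cusp_edges_def)
  have "0 \<le> q i n \<and> q i n \<le> D"
  proof (cases n)
    case 0
    then show ?thesis
      using nonneg[OF D(1) C, of 0] row[OF D(1), of "{Core (\<beta> i)}" 0] C by auto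
  next
    case (Suc m)
    then show ?thesis
      using nonneg[OF D(1) D(1), of "Suc m" m] row[OF D(1), of "{Down i m}" "Suc m"] D by auto
  qed
  then show "0 \<le> q i n" "q i n \<le> D" by auto
  show "0 \<le> q i (Suc n) - 1" using nonneg[OF D(2) D(1), of n n] by simp
qed

abbreviation T where "T u x y \<equiv> u * complex_of_real (K x y)"

text \<open>The weight of the unique way from \<open>Down i n\<close> to \<open>\<beta> i\<close>.\<close>

definition down_weight :: "complex \<Rightarrow> 'i \<Rightarrow> nat \<Rightarrow> complex" where
  "down_weight u i n = (\<Prod>j\<le>n. u * of_real (q i j))"

text \<open>The weight of the excursion from \<open>\<alpha> i\<close> to \<open>\<beta> i\<close> that turns at level \<open>m\<close>: it makes \<open>m + 1\<close> outward
steps and a turn, which together account for \<open>u ^ (m + 2)\<close>.\<close>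

definition excursion :: "complex \<Rightarrow> 'i \<Rightarrow> nat \<Rightarrow> complex" where
  "excursion u i m = u ^ (m + 2) * of_real (q i (Suc m) - 1) * down_weight u i m"

text \<open>The total weight of the ways from \<open>Up i n\<close> to \<open>\<beta> i\<close> that turn at one of the levels \<open>n, \<dots>, n + k - 1\<close>.\<close>

fun up_weight :: "complex \<Rightarrow> 'i \<Rightarrow> nat \<Rightarrow> nat \<Rightarrow> complex" where
  "up_weight u i n 0 = 0"
| "up_weight u i n (Suc k) = u * of_real (q i (Suc n) - 1) * down_weight u i n + u * up_weight u i (Suc n) k"

lemma up_weight_eq: "u ^ Suc n * up_weight u i n k = (\<Sum>m<k. excursion u i (n + m))"
proof (induction k arbitrary: n)
  case (Suc k)
  have "u ^ Suc n * up_weight u i n (Suc k) = excursion u i n + u ^ Suc (Suc n) * up_weight u i (Suc n) k"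
    by (simp add: excursion_def algebra_simps)
  also have "\<dots> = (\<Sum>m<Suc k. excursion u i (n + m))"
    unfolding Suc.IH by (simp add: sum.lessThan_Suc_shift del: sum.lessThan_Suc)
  finally show ?case .
qed simp

definition cusp_part :: "nat \<Rightarrow> ('f, 'i) cusp_edge set" where
  "cusp_part k = (\<lambda>(i, n). Up i n) ` (I \<times> {..<k}) \<union> (\<lambda>(i, n). Down i n) ` (I \<times> {..<k})"

lemma finite_cusp_part: "finite (cusp_part k)"
  using finI by (simp add: cusp_part_def)

lemma sum_cusp_part:
  "(\<Sum>c\<in>cusp_part k. f c) = (\<Sum>i\<in>I. \<Sum>n<k. f (Up i n) + f (Down i n))"
proof -
  have "(\<Sum>c\<in>cusp_part k. f c) = (\<Sum>x\<in>I \<times> {..<k}. f (Up (fst x) (snd x))) + (\<Sum>x\<in>I \<times> {..<k}. f (Down (fst x) (snd x)))"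
    unfolding cusp_part_def using finI
    by (subst sum.union_disjoint) (auto simp: sum.reindex inj_on_def case_prod_unfold)
  also have "\<dots> = (\<Sum>i\<in>I. \<Sum>n<k. f (Up i n) + f (Down i n))"
    by (simp add: sum.distrib sum.cartesian_product case_prod_unfold)
  finally show ?thesis .
qed

definition trunc :: "nat \<Rightarrow> ('f, 'i) cusp_edge set" where
  "trunc k = Core ` F \<union> cusp_part k"

lemma trunc_subset: "trunc k \<subseteq> cusp_edges F I" "cusp_part k \<subseteq> trunc k"
  by (auto simp: trunc_def cusp_part_def cusp_edges_def)

lemma finite_trunc: "finite (trunc k)"
  using finF by (simp add: trunc_def finite_cusp_part)

lemma row_small:
  assumes "B \<subseteq> trunc k" "x \<in> B"
  shows "(\<Sum>y\<in>B. norm (T u x y)) \<le> norm u * D"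
proof -
  have B: "finite B" "B \<subseteq> cusp_edges F I" using assms finite_trunc[of k] trunc_subset[of k] by (auto intro: finite_subset)
  then have "(\<Sum>y\<in>B. norm (T u x y)) = norm u * (\<Sum>y\<in>B. K x y)"
    using nonneg[of x] assms(2) unfolding sum_distrib_left by (intro sum.cong) (auto simp: norm_mult subset_iff)
  also have "\<dots> \<le> norm u * D"
    using row[OF _ B] assms B by (intro mult_left_mono) auto
  finally show ?thesis .
qed

text \<open>What the elimination of the cusps leaves on the core: the step from \<open>\<alpha> i\<close> to \<open>\<beta> i\<close> receives in addition the
weight \<open>s u i\<close> of the excursions into the cusp \<open>i\<close>.\<close>

definition reduced_kernel :: "(complex \<Rightarrow> 'i \<Rightarrow> complex) \<Rightarrow> complex \<Rightarrow> ('f, 'i) cusp_edge \<Rightarrow> ('f, 'i) cusp_edge \<Rightarrow> complex" where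
  "reduced_kernel s u x y = T u x y + (\<Sum>i\<in>I. of_bool (x = Core (\<alpha> i)) * of_bool (y = Core (\<beta> i)) * s u i)"

text \<open>Fixing one enumeration of the core makes the reduced determinants for different \<open>k\<close> and \<open>u\<close> comparable
entry by entry.\<close>

definition core_list :: "('f, 'i) cusp_edge list" where
  "core_list = (SOME xs. distinct xs \<and> set xs = Core ` F)"

lemma core_list: "distinct core_list" "set core_list = Core ` F"
proof -
  have "\<exists>xs::('f, 'i) cusp_edge list. distinct xs \<and> set xs = Core ` F"
    using finite_distinct_list[of "Core ` F"] finF by blast
  from someI_ex[OF this] show "distinct core_list" "set core_list = Core ` F" by (auto simp: core_list_def)
qed

definition reduced_det :: "(complex \<Rightarrow> 'i \<Rightarrow> complex) \<Rightarrow> complex \<Rightarrow> complex" where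
  "reduced_det s u = det (kernel_mat (\<lambda>x y. kdelta x y - reduced_kernel s u x y) core_list core_list)"

text \<open>The total weight of the ways from a cusp edge back to a given core edge when the cusps are cut at level \<open>k\<close>; it is the
matrix \<open>G\<close> of the elimination.\<close>

fun return_weight :: "complex \<Rightarrow> nat \<Rightarrow> ('f, 'i) cusp_edge \<Rightarrow> ('f, 'i) cusp_edge \<Rightarrow> complex" where
  "return_weight u k (Up i n) y = of_bool (y = Core (\<beta> i)) * up_weight u i n (k - n)"
| "return_weight u k (Down i n) y = of_bool (y = Core (\<beta> i)) * down_weight u i n"
| "return_weight u k (Core f) y = 0"

lemma sum_single: "finite A \<Longrightarrow> (\<Sum>x\<in>A. of_bool (x = a) * f x) = (if a \<in> A then f a else (0::complex))"
  by (simp add: of_bool_def if_distrib[of "\<lambda>z. z * _"] cong: if_cong)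

text \<open>The equation expresses the return weight through the first step on the way.\<close>

lemma return_weight_solves:
  assumes c: "c \<in> cusp_part k" and f: "f \<in> F"
  shows "return_weight u k c (Core f) = T u c (Core f) + (\<Sum>d\<in>cusp_part k. T u c d * return_weight u k d (Core f))"
proof -
  let ?b = "\<lambda>i. of_bool (f = \<beta> i) :: complex"
  consider i n where "c = Up i n" "i \<in> I" "n < k" | i n where "c = Down i n" "i \<in> I" "n < k"
    using c by (auto simp: cusp_part_def)
  then show ?thesis
  proof cases
    case 1
    have "(\<Sum>d\<in>cusp_part k. T u c d * return_weight u k d (Core f)) =
        (\<Sum>j\<in>I. of_bool (j = i) * (\<Sum>m<k. of_bool (m = Suc n) * (u * ?b j * up_weight u j m (k - m)) +
          of_bool (m = n) * (u * (of_real (q i (Suc n)) - 1) * ?b j * down_weight u j m)))"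
      unfolding sum_cusp_part 1(1) sum_distrib_left by (intro sum.cong refl) auto
    also have "\<dots> = ?b i * up_weight u i n (k - n)"
    proof (cases "Suc n < k")
      case True
      then have "k - n = Suc (k - Suc n)" by simp
      then show ?thesis
        using 1 True by (cases "f = \<beta> i") (simp_all add: sum_single finI sum.distrib)
    next
      case False
      then have "k = Suc n" using 1 by simp
      then show ?thesis using 1 by (cases "f = \<beta> i") (simp_all add: sum_single finI sum.distrib del: sum.lessThan_Suc)
    qed
    finally show ?thesis using 1 by simp
  next
    case 2
    show ?thesis
    proof (cases n)
      case 0
      have "(\<Sum>d\<in>cusp_part k. T u c d * return_weight u k d (Core f)) = 0"
        unfolding sum_cusp_part 2(1) 0 by (intro sum.neutral ballI) auto
      then show ?thesis using 2 0 by (simp add: down_weight_def)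
    next
      case (Suc l)
      have "(\<Sum>d\<in>cusp_part k. T u c d * return_weight u k d (Core f)) =
        (\<Sum>j\<in>I. of_bool (j = i) * (\<Sum>m<k. of_bool (m = l) * (u * of_real (q i n) * ?b j * down_weight u j m)))"
        unfolding sum_cusp_part 2(1) sum_distrib_left Suc by (intro sum.cong refl) auto
      also have "\<dots> = ?b i * down_weight u i n"
        using 2 Suc by (simp add: sum_single finI down_weight_def)
      finally show ?thesis using 2 Suc by simp
    qed
  qed
qed

definition partial_excursions :: "nat \<Rightarrow> complex \<Rightarrow> 'i \<Rightarrow> complex" where
  "partial_excursions k u i = (\<Sum>m<k. excursion u i m)"

lemma reduced_kernel_eq:
  assumes "f \<in> F" "g \<in> F"
  shows "T u (Core f) (Core g) + (\<Sum>c\<in>cusp_part k. T u (Core f) c * return_weight u k c (Core g))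
    = reduced_kernel (partial_excursions k) u (Core f) (Core g)"
proof -
  have "(\<Sum>c\<in>cusp_part k. T u (Core f) c * return_weight u k c (Core g)) =
     (\<Sum>i\<in>I. \<Sum>m<k. of_bool (m = 0) * (u * of_bool (f = \<alpha> i) * of_bool (g = \<beta> i) * up_weight u i m (k - m)))"
    unfolding sum_cusp_part by (intro sum.cong refl) auto
  also have "\<dots> = (\<Sum>i\<in>I. of_bool (f = \<alpha> i) * of_bool (g = \<beta> i) * partial_excursions k u i)"
  proof (intro sum.cong refl)
    fix i
    let ?c = "of_bool (f = \<alpha> i) * of_bool (g = \<beta> i) :: complex"
    have "(\<Sum>m<k. of_bool (m = 0) * (u * of_bool (f = \<alpha> i) * of_bool (g = \<beta> i) * up_weight u i m (k - m)))
        = (if 0 \<in> {..<k} then u * of_bool (f = \<alpha> i) * of_bool (g = \<beta> i) * up_weight u i 0 (k - 0) else 0)"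
      by (rule sum_single) simp
    also have "\<dots> = ?c * (u ^ Suc 0 * up_weight u i 0 k)"
      by (cases k) auto
    also have "u ^ Suc 0 * up_weight u i 0 k = partial_excursions k u i"
      by (simp only: up_weight_eq partial_excursions_def add_0)
    finally show "(\<Sum>m<k. of_bool (m = 0) * (u * of_bool (f = \<alpha> i) * of_bool (g = \<beta> i) * up_weight u i m (k - m)))
        = ?c * partial_excursions k u i" .
  qed
  finally show ?thesis by (simp add: reduced_kernel_def)
qed

text \<open>Below level \<open>k\<close>, every step of nonzero weight between cusp edges raises the rank: it grows with \<open>n\<close> on the way up, jumps
from \<open>n\<close> to \<open>2 * k - n\<close> at the turn, and grows as \<open>n\<close> falls on the way down.\<close>

fun rank :: "nat \<Rightarrow> ('f, 'i) cusp_edge \<Rightarrow> nat" where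
  "rank k (Up i n) = n" | "rank k (Down i n) = 2 * k - n" | "rank k (Core f) = 0"

lemma rank_less:
  "x \<in> cusp_part k \<Longrightarrow> y \<in> cusp_part k \<Longrightarrow> T u x y \<noteq> 0 \<Longrightarrow> rank k x < rank k y"
  by (cases x; cases y) (auto simp: cusp_part_def)

text \<open>No closed word consisting of cusp edges has nonzero weight, so the block of the cusp edges has determinant
\<open>1\<close> and the determinant on the whole truncated set equals its Schur complement on the core.\<close>

lemma truncated_zeta:
  assumes u: "norm u * D < 1"
  shows "\<exists>S. has_word_sum (T u) (trunc k) S \<and>
    exp (- S) = reduced_det (partial_excursions k) u"
proof -
  obtain cs where cs: "distinct cs" "set cs = cusp_part k"
    using finite_distinct_list[OF finite_cusp_part] by blast
  have set: "set (core_list @ cs) = trunc k" by (simp add: core_list cs trunc_def)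
  have dist: "distinct (core_list @ cs)" by (auto simp: core_list cs cusp_part_def)
  have uD: "0 \<le> norm u * D" using D by simp
  have "det (1\<^sub>m (length cs) - kernel_mat (T u) cs cs) = 1"
  proof -
    have rs: "(\<Sum>y\<in>set cs. norm (T u x y)) \<le> norm u * D" if "x \<in> set cs" for x
      using that unfolding cs by (rule row_small[OF trunc_subset(2)])
    have "\<exists>S. has_word_sum (T u) (set cs) S \<and>
        exp (- S) = det (1\<^sub>m (length cs) - kernel_mat (T u) cs cs)"
      using rs by (rule exp_cyclic_sum_eq_det[OF cs(1) _ uD u])
    then obtain S where S: "has_word_sum (T u) (cusp_part k) S"
      and e: "exp (- S) = det (1\<^sub>m (length cs) - kernel_mat (T u) cs cs)"
      unfolding cs by (elim exE conjE)
    have "cyclic_prod (T u) p / of_nat (length p) = 0" if p: "p \<in> lists (cusp_part k)" for p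
    proof (cases "p = []")
      case False
      have "cyclic_prod (T u) p = 0"
        using p by (intro cyclic_prod_eq_0_of_rank[OF False, where rank="rank k"] rank_less) auto
      then show ?thesis by simp
    qed simp
    then have "has_word_sum (T u) (cusp_part k) 0"
      by (intro has_sum_0) auto
    then have "S = 0" using S has_sum_unique by blast
    then show ?thesis using e by simp
  qed
  moreover have "kernel_mat (\<lambda>f g. T u f g + (\<Sum>c\<in>set cs. T u f c * return_weight u k c g)) core_list core_list
      = kernel_mat (reduced_kernel (partial_excursions k) u) core_list core_list"
    unfolding cs core_list by (rule kernel_mat_cong) (auto simp: core_list reduced_kernel_eq simp del: cusp_kernel.simps)
  moreover have "det (1\<^sub>m (length (core_list @ cs)) - kernel_mat (T u) (core_list @ cs) (core_list @ cs)) =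
    det (1\<^sub>m (length core_list) - kernel_mat (\<lambda>f g. T u f g + (\<Sum>c\<in>set cs. T u f c * return_weight u k c g)) core_list core_list) *
    det (1\<^sub>m (length cs) - kernel_mat (T u) cs cs)"
  proof (rule det_eliminate_block[OF dist])
    fix c f assume "c \<in> set cs" "f \<in> set core_list"
    then show "return_weight u k c f = T u c f + (\<Sum>d\<in>set cs. T u c d * return_weight u k d f)"
      using return_weight_solves by (auto simp: core_list cs)
  qed
  ultimately have det: "det (1\<^sub>m (length (core_list @ cs)) - kernel_mat (T u) (core_list @ cs) (core_list @ cs))
      = reduced_det (partial_excursions k) u"
    by (simp only: reduced_det_def one_minus_kernel_mat[OF core_list(1)] mult_1_right)
  have rs: "(\<Sum>y\<in>set (core_list @ cs). norm (T u x y)) \<le> norm u * D" if "x \<in> set (core_list @ cs)" for x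
    using that unfolding set by (rule row_small[OF order_refl])
  have "\<exists>S. has_word_sum (T u) (set (core_list @ cs)) S \<and>
      exp (- S) = det (1\<^sub>m (length (core_list @ cs)) - kernel_mat (T u) (core_list @ cs) (core_list @ cs))"
    using rs by (rule exp_cyclic_sum_eq_det[OF dist _ uD u])
  then show ?thesis unfolding set det .
qed

end

context cusp_system
begin

lemma small_disc: assumes "norm u < 1 / D" shows "norm u * D < 1" "norm u \<le> 1"
proof -
  show "norm u * D < 1" using assms D by (simp add: field_simps)
  have "1 / D \<le> 1" using D by simp
  then show "norm u \<le> 1" using assms by linarith
qed

lemma norm_excursion:
  assumes i: "i \<in> I" and u: "norm u < 1 / D"
  shows "norm (excursion u i m) \<le> D * (norm u * D) ^ Suc m"
proof -
  have "norm (down_weight u i m) = (\<Prod>j\<le>m. norm u * q i j)"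
    unfolding down_weight_def prod_norm[symmetric] using q_bounds(1)[OF i] by (simp add: norm_mult)
  also have "\<dots> \<le> (\<Prod>j\<le>m. norm u * D)"
    using q_bounds[OF i] by (intro prod_mono) (auto intro!: mult_left_mono)
  finally have d: "norm (down_weight u i m) \<le> (norm u * D) ^ Suc m" by simp
  have "norm u ^ (m + 2) \<le> 1" using small_disc[OF u] by (intro power_le_one) auto
  moreover have "norm (complex_of_real (q i (Suc m) - 1)) \<le> D"
    using q_bounds(2,3)[OF i, of m] q_bounds(2)[OF i, of "Suc m"] by (subst norm_of_real) linarith
  ultimately have "norm u ^ (m + 2) * norm (complex_of_real (q i (Suc m) - 1)) * norm (down_weight u i m)
      \<le> 1 * D * (norm u * D) ^ Suc m"
    using d D by (intro mult_mono) auto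
  then show ?thesis unfolding excursion_def norm_mult norm_power by simp
qed

lemma summable_excursion:
  assumes i: "i \<in> I" and u: "norm u < 1 / D"
  shows "summable (excursion u i)"
proof (rule summable_comparison_test')
  show "summable (\<lambda>m. D * (norm u * D) ^ Suc m)"
    using small_disc[OF u] D by (intro summable_mult summable_Suc_iff[THEN iffD2] summable_geometric) simp
  show "norm (excursion u i m) \<le> D * (norm u * D) ^ Suc m" for m by (rule norm_excursion[OF i u])
qed

lemma rational_on_excursion: "rational_on e (\<lambda>u. excursion u i m)"
  unfolding excursion_def down_weight_def
  by (intro rational_on_mult rational_on_const rational_on_prod rational_on_power rational_on_id)

text \<open>A shift by a period \<open>p\<close> multiplies the weight of an excursion by \<open>u\<^sup>2\<^sup>p\<close> times the product of \<open>q i\<close> over a full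
period, and this product does not depend on where the period begins.\<close>

lemma rational_on_total_excursion:
  assumes i: "i \<in> I"
  shows "rational_on (1 / D) (\<lambda>u. suminf (excursion u i))"
proof -
  obtain p N where p: "p > 0" "\<And>n. n \<ge> N \<Longrightarrow> q i (n + p) = q i n"
    using periodic[OF i] by metis
  define w where "w m = (\<Prod>l<p. q i (m + 1 + l))" for m
  have w_Suc: "w (Suc m) = w m" if "m \<ge> N" for m
  proof -
    have "q i (m + 1) * w (Suc m) = (\<Prod>l<Suc p. q i (m + 1 + l))"
      by (simp add: w_def prod.lessThan_Suc_shift del: prod.lessThan_Suc)
    also have "\<dots> = w m * q i (m + 1)"
      using p(2)[of "m + 1"] that by (simp add: w_def algebra_simps)
    finally show ?thesis using q_bounds(3)[OF i, of m] by simp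
  qed
  have w: "w m = w N" if "m \<ge> N" for m
    using that by (induction m rule: dec_induct) (simp_all add: w_Suc)
  have shift: "(\<Prod>j\<le>m + k. g j) = (\<Prod>j\<le>m. g j) * (\<Prod>l<k. g (m + 1 + l))" for g :: "nat \<Rightarrow> complex" and m k
    by (induction k) (simp_all add: algebra_simps)
  show ?thesis
  proof (rule rational_on_suminf_quasi_periodic[where K="monom (of_real (w N)) (2 * p)" and p=p and N=N])
    fix u :: complex and m assume m: "m \<ge> N"
    have "down_weight u i (m + p) = down_weight u i m * (u ^ p * of_real (w N))"
      unfolding down_weight_def shift w[OF m, symmetric] by (simp add: w_def prod.distrib)
    then show "excursion u i (m + p) = poly (monom (of_real (w N)) (2 * p)) u * excursion u i m"
      using p(2)[of "Suc m"] m by (simp add: excursion_def poly_monom power_add power_mult power2_eq_square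
          power_mult_distrib algebra_simps)
  next
    fix u :: complex assume u: "norm u < 1 / D"
    have "\<bar>w N\<bar> = (\<Prod>l<p. q i (N + 1 + l))"
      unfolding w_def abs_prod using q_bounds(1)[OF i] by simp
    also have "\<dots> \<le> (\<Prod>l<p. D)" using q_bounds[OF i] by (intro prod_mono) auto
    finally have "\<bar>w N\<bar> \<le> D ^ p" by simp
    then have "norm u ^ p * (norm u ^ p * \<bar>w N\<bar>) \<le> 1 * (norm u ^ p * D ^ p)"
      using small_disc[OF u] by (intro mult_mono power_le_one) auto
    also have "\<dots> = (norm u * D) ^ p" by (simp add: power_mult_distrib)
    also have "\<dots> < 1" using small_disc[OF u] p(1) D by (simp add: power_less_one_iff)
    finally show "norm (poly (monom (complex_of_real (w N)) (2 * p)) u) < 1"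
      unfolding poly_monom norm_mult norm_power mult_2 power_add norm_of_real by (simp add: mult_ac)
  qed (use summable_excursion[OF i] rational_on_excursion in auto)
qed

definition total_excursions :: "complex \<Rightarrow> 'i \<Rightarrow> complex" where
  "total_excursions u i = suminf (excursion u i)"

lemma reduced_det_tendsto:
  assumes u: "norm u < 1 / D"
  shows "(\<lambda>k. reduced_det (partial_excursions k) u) \<longlonglongrightarrow> reduced_det total_excursions u"
  unfolding reduced_det_def reduced_kernel_def partial_excursions_def total_excursions_def
  by (intro tendsto_det_kernel_mat tendsto_intros summable_LIMSEQ summable_excursion u)

lemma rational_reduced_det: "rational_on (1 / D) (reduced_det total_excursions)"
proof -
  have "rational_on (1 / D) (\<lambda>u. det (kernel_mat (\<lambda>x y. kdelta x y + (- 1) * reduced_kernel total_excursions u x y)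
      core_list core_list))"
    unfolding reduced_kernel_def total_excursions_def
    by (intro rational_on_det rational_on_add rational_on_mult rational_on_const rational_on_sum
        rational_on_total_excursion rational_on_id)
  moreover have "reduced_det total_excursions =
      (\<lambda>u. det (kernel_mat (\<lambda>x y. kdelta x y + (- 1) * reduced_kernel total_excursions u x y) core_list core_list))"
    by (rule ext) (simp add: reduced_det_def)
  ultimately show ?thesis by simp
qed

lemma reduced_det_0: "reduced_det total_excursions 0 = 1"
proof -
  have "total_excursions 0 i = 0" for i 
  proof -
    have "excursion 0 i = (\<lambda>_. 0)" by (rule ext) (simp add: excursion_def)
    then show ?thesis by (simp add: total_excursions_def)
  qed
  then show ?thesis
    by (simp add: reduced_det_def reduced_kernel_def kernel_mat_kdelta core_list)
qed

lemma eventually_in_trunc: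
  assumes "finite P" "P \<subseteq> lists (cusp_edges F I)"
  shows "eventually (\<lambda>k. P \<subseteq> lists (trunc k)) sequentially"
proof -
  have "eventually (\<lambda>k. x \<in> trunc k) sequentially" if "x \<in> cusp_edges F I" for x
  proof (cases x)
    case (Up i n)
    then show ?thesis using that
      by (intro eventually_mono[OF eventually_gt_at_top[of n]]) (auto simp: trunc_def cusp_part_def cusp_edges_def)
  next
    case (Down i n)
    then show ?thesis using that
      by (intro eventually_mono[OF eventually_gt_at_top[of n]]) (auto simp: trunc_def cusp_part_def cusp_edges_def)
  qed (use that in \<open>auto simp: trunc_def cusp_edges_def\<close>)
  moreover have "finite (\<Union>p\<in>P. set p)" "(\<Union>p\<in>P. set p) \<subseteq> cusp_edges F I" using assms by auto
  ultimately have "eventually (\<lambda>k. \<forall>x\<in>(\<Union>p\<in>P. set p). x \<in> trunc k) sequentially"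
    by (intro eventually_ball_finite) auto
  then show ?thesis by (rule eventually_mono) auto
qed

lemma truncated_zeta_sequence:
  assumes "norm u < 1 / D"
  shows "\<exists>s. (\<forall>k. has_word_sum (T u) (trunc k) (s k)) \<and>
    (\<forall>k. exp (- s k) = reduced_det (partial_excursions k) u)"
proof -
  have "\<forall>k. \<exists>S. has_word_sum (T u) (trunc k) S \<and>
      exp (- S) = reduced_det (partial_excursions k) u"
    by (intro allI truncated_zeta small_disc(1) assms)
  from choice[OF this] show ?thesis unfolding all_conj_distrib .
qed

lemma norm_cyclic_prod_T:
  assumes p: "p \<in> lists (cusp_edges F I)"
  shows "norm (cyclic_prod (T u) p) = cyclic_prod (\<lambda>a b. norm u * K a b) p"
  unfolding norm_cyclic_prod unfolding cyclic_prod_def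
proof (intro prod.cong refl)
  fix j assume "j \<in> {..<length p}"
  then have j: "j < length p" "Suc j mod length p < length p" by (auto intro: mod_less_divisor)
  then have "p ! j \<in> cusp_edges F I" "p ! (Suc j mod length p) \<in> cusp_edges F I"
    using p unfolding in_lists_conv_set by (meson nth_mem)+
  from nonneg[OF this] show "norm (T u (p ! j) (p ! (Suc j mod length p))) = norm u * K (p ! j) (p ! (Suc j mod length p))"
    by (simp add: norm_mult)
qed

text \<open>At the real number \<open>x = |u|\<close> all terms are nonnegative and equal the norms of the terms at \<open>u\<close>. The sums over
the truncated sets are bounded there, since their negatives have exponentials that converge to a nonzero number.\<close>

lemma abs_summable_words:
  assumes u: "norm u < 1 / D" and ne: "reduced_det total_excursions (of_real (norm u)) \<noteq> 0"
  shows "(\<lambda>p. cyclic_prod (T u) p / of_nat (length p)) abs_summable_on lists (cusp_edges F I)"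
proof -
  define x where "x = complex_of_real (norm u)"
  define f where "f p = cyclic_prod (\<lambda>a b. norm u * K a b) p / real (length p)" for p
  have x: "norm x < 1 / D" using u by (simp add: x_def)
  obtain s where s': "\<forall>k. has_word_sum (T x) (trunc k) (s k)"
    and e': "\<forall>k. exp (- s k) = reduced_det (partial_excursions k) x"
    using truncated_zeta_sequence[OF x] by (elim exE conjE)
  note s = s'[rule_format] and e = e'[rule_format]
  have f_complex: "cyclic_prod (T x) p / of_nat (length p) = of_real (f p)" for p
    unfolding f_def x_def cyclic_prod_def by simp
  have f_norm: "norm (cyclic_prod (T u) p / of_nat (length p)) = f p" if "p \<in> lists (cusp_edges F I)" for p
    using norm_cyclic_prod_T[OF that, of u] by (simp only: f_def norm_divide norm_of_nat)
  have f_nonneg: "f p \<ge> 0" if "p \<in> lists (cusp_edges F I)" for p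
    using f_norm[OF that] by (metis norm_ge_zero)
  have sub: "lists (trunc k) \<subseteq> lists (cusp_edges F I)" for k
    using trunc_subset(1)[of k] by (rule lists_mono)
  have fs: "(f has_sum Re (s k)) (lists (trunc k))" for k
    using has_sum_Re[OF s[of k]] by (simp add: f_complex)
  have "Im (s k) = 0" for k
  proof -
    have "((\<lambda>p. 0) has_sum Im (s k)) (lists (trunc k))"
      using has_sum_Im[OF s[of k]] by (simp add: f_complex)
    then show ?thesis using has_sum_unique[OF _ has_sum_0] by blast
  qed
  then have "norm (exp (- s k)) = exp (- Re (s k))" for k by (simp add: norm_exp_eq_Re)
  then have "(\<lambda>k. exp (- Re (s k))) \<longlonglongrightarrow> norm (reduced_det total_excursions x)"
    using tendsto_norm[OF reduced_det_tendsto[OF x]] unfolding e[symmetric] by simp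
  moreover have "norm (reduced_det total_excursions x) / 2 < norm (reduced_det total_excursions x)"
    using ne by (simp add: x_def)
  ultimately have low: "eventually (\<lambda>k. norm (reduced_det total_excursions x) / 2 < exp (- Re (s k))) sequentially"
    by (rule order_tendstoD)
  \<comment> \<open>half the limit is an eventual lower bound of the exponentials, which bounds the sums from above\<close>
  define B where "B = - ln (norm (reduced_det total_excursions x) / 2)"
  have upper: "Re (s k) \<le> B" if "norm (reduced_det total_excursions x) / 2 < exp (- Re (s k))" for k
  proof -
    have "ln (norm (reduced_det total_excursions x) / 2) < ln (exp (- Re (s k)))"
      using that ne by (subst ln_less_cancel_iff) (auto simp: x_def)
    then show ?thesis by (simp add: B_def)
  qed
  have "f summable_on lists (cusp_edges F I)"
  proof (rule nonneg_bdd_above_summable_on)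
    show "bdd_above (sum f ` {P. P \<subseteq> lists (cusp_edges F I) \<and> finite P})"
    proof (rule bdd_aboveI2[where M=B])
      fix P assume P: "P \<in> {P. P \<subseteq> lists (cusp_edges F I) \<and> finite P}"
      then have "eventually (\<lambda>k. P \<subseteq> lists (trunc k) \<and> Re (s k) \<le> B) sequentially"
        using eventually_conj[OF eventually_in_trunc[of P] eventually_mono[OF low upper]] by simp
      then obtain k where k: "P \<subseteq> lists (trunc k)" "Re (s k) \<le> B"
        using eventually_happens'[OF sequentially_bot] by blast
      have "sum f P \<le> Re (s k)"
      proof (rule has_sum_mono_neutral[OF has_sum_finite fs[of k]])
        show "0 \<le> f p" if "p \<in> lists (trunc k) - P" for p
          using that sub[of k] by (intro f_nonneg) blast
        show "finite P" using P by blast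
        show "f p \<le> 0" if "p \<in> P - lists (trunc k)" for p
          using that k(1) by blast
      qed simp
      then show "sum f P \<le> B" using k by simp
    qed
  qed (rule f_nonneg)
  moreover have "(\<lambda>p. norm (cyclic_prod (T u) p / of_nat (length p))) summable_on lists (cusp_edges F I) \<longleftrightarrow>
      f summable_on lists (cusp_edges F I)"
    by (rule summable_on_cong) (rule f_norm)
  ultimately show ?thesis by simp
qed

lemma words_sum_exp:
  assumes u: "norm u < 1 / D" and ne: "reduced_det total_excursions (of_real (norm u)) \<noteq> 0"
  shows "\<exists>S. has_word_sum (T u) (cusp_edges F I) S \<and>
    exp (- S) = reduced_det total_excursions u"
proof -
  let ?f = "\<lambda>p. cyclic_prod (T u) p / of_nat (length p)"
  obtain S where S: "(?f has_sum S) (lists (cusp_edges F I))"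
    using abs_summable_summable[OF abs_summable_words[OF assms]] by (auto simp: summable_on_def)
  obtain s where s': "\<forall>k. (?f has_sum s k) (lists (trunc k))"
    and e': "\<forall>k. exp (- s k) = reduced_det (partial_excursions k) u"
    using truncated_zeta_sequence[OF u] by (elim exE conjE)
  note s = s'[rule_format] and e = e'[rule_format]
  have "s \<longlonglongrightarrow> S"
    by (rule has_sum_increasing_union[OF S s lists_mono[OF trunc_subset(1)] eventually_in_trunc])
  then have "(\<lambda>k. exp (- s k)) \<longlonglongrightarrow> exp (- S)" by (intro tendsto_exp tendsto_minus)
  then have "exp (- S) = reduced_det total_excursions u"
    using LIMSEQ_unique[OF _ reduced_det_tendsto[OF u]] unfolding e by auto
  then show ?thesis using S by blast
qed

text \<open>The reduced determinant is rational and equals \<open>1\<close> at \<open>0\<close>, so its numerator has no zero near \<open>0\<close>.\<close>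

theorem cusp_system_zeta_rational:
  "\<exists>P Q e. 0 < e \<and> e \<le> 1 / D \<and> (\<forall>u. norm u < e \<longrightarrow> poly P u \<noteq> 0 \<and> poly Q u \<noteq> 0 \<and>
     (\<exists>S. has_word_sum (T u) (cusp_edges F I) S \<and>
       exp S = poly P u / poly Q u))"
proof -
  obtain P Q where PQ: "\<And>u. norm u < 1 / D \<Longrightarrow> poly Q u \<noteq> 0"
      "\<And>u. norm u < 1 / D \<Longrightarrow> reduced_det total_excursions u = poly P u / poly Q u"
    using rational_reduced_det unfolding rational_on_def by auto
  have "poly P 0 \<noteq> 0" using PQ[of 0] reduced_det_0 D by auto
  moreover have "isCont (poly P) 0" by simp
  ultimately obtain d where d: "d > 0" "\<And>u. norm u < d \<Longrightarrow> poly P u \<noteq> 0"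
    using continuous_at_avoid[of 0 "poly P" 0] by (auto simp: dist_norm)
  define e where "e = min d (1 / D)"
  show ?thesis
  proof (rule exI[of _ Q], rule exI[of _ P], rule exI[of _ e], intro conjI allI impI)
    show "0 < e" "e \<le> 1 / D" using d D by (auto simp: e_def)
    fix u :: complex assume "norm u < e"
    then have u: "norm u < 1 / D" "norm u < d" by (auto simp: e_def)
    show "poly P u \<noteq> 0" "poly Q u \<noteq> 0" using u PQ d by auto
    have "reduced_det total_excursions (of_real (norm u)) \<noteq> 0"
      using PQ[of "of_real (norm u)"] d(2)[of "of_real (norm u)"] u by auto
    from words_sum_exp[OF u(1) this] obtain S where
      S: "has_word_sum (T u) (cusp_edges F I) S"
      "exp (- S) = poly P u / poly Q u"
      using PQ u by auto
    have "exp S = inverse (exp (- S))" by (simp add: exp_minus)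
    also have "\<dots> = poly Q u / poly P u" unfolding S(2) by simp
    finally show "\<exists>S. has_word_sum (T u) (cusp_edges F I) S \<and>
       exp S = poly Q u / poly P u"
      using S(1) by blast
  qed
qed

end

section \<open>Powers and rotations of words\<close>

abbreviation word_pow :: "'a list \<Rightarrow> nat \<Rightarrow> 'a list" where
  "word_pow q n \<equiv> concat (replicate n q)"

definition primitive :: "'a list \<Rightarrow> bool" where
  "primitive q \<longleftrightarrow> q \<noteq> [] \<and> (\<forall>r n. q = word_pow r n \<longrightarrow> n = 1)"

lemma length_word_pow: "length (word_pow q n) = n * length q"
  by (induction n) auto

lemma nth_word_pow: "j < n * length q \<Longrightarrow> word_pow q n ! j = q ! (j mod length q)"
proof (induction n arbitrary: j)
  case (Suc n)
  then show ?case
    by (cases "j < length q") (auto simp: nth_append mod_if[of j])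
qed simp

lemma word_pow_snoc: "word_pow q n @ q = q @ word_pow q n"
  by (induction n) auto

lemma rotate1_word_pow: "rotate1 (word_pow q n) = word_pow (rotate1 q) n"
proof (cases q)
  case (Cons a r)
  have *: "a # word_pow (r @ [a]) n = word_pow (a # r) n @ [a]" for n
    by (induction n) auto
  show ?thesis using Cons *[of "n - 1"] by (cases n) auto
qed (simp add: concat_replicate_trivial)

lemma rotate_word_pow: "rotate i (word_pow q n) = word_pow (rotate i q) n"
  by (induction i) (simp_all add: rotate1_word_pow)

lemma primitive_root_exists:
  assumes "p \<noteq> []"
  shows "\<exists>q k. primitive q \<and> k \<ge> 1 \<and> p = word_pow q k"
  using assms
proof (induction "length p" arbitrary: p rule: less_induct)
  case less
  show ?case
  proof (cases "primitive p")
    case True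
    then show ?thesis by (intro exI[of _ p] exI[of _ 1]) auto
  next
    case False
    then obtain r n where rn: "p = word_pow r n" "n \<noteq> 1" using less by (auto simp: primitive_def)
    have "n > 0" "r \<noteq> []" using rn less(2) by (auto simp: concat_replicate_trivial intro!: gr0I)
    then have "length r < length p" using rn by (simp add: length_word_pow)
    then obtain q k where q: "primitive q" "k \<ge> 1" "r = word_pow q k" using less(1) \<open>r \<noteq> []\<close> by blast
    have "word_pow (word_pow q k) n = word_pow q (k * n)"
      by (induction n) (simp_all add: replicate_add)
    then show ?thesis using q rn \<open>n > 0\<close> by (intro exI[of _ q] exI[of _ "k * n"]) auto
  qed
qed

text \<open>Both words commute with their common power \<open>p\<close>. Hence \<open>u @ v\<close> and \<open>v @ u\<close> are initial segments of the same
length of a high power of \<open>p\<close>.\<close>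

lemma equal_powers_commute:
  assumes "word_pow u k = word_pow v m" "k \<ge> 1" "m \<ge> 1" "u \<noteq> []" "v \<noteq> []"
  shows "u @ v = v @ u"
proof -
  define p where "p = word_pow u k"
  have p: "p \<noteq> []" "p @ u = u @ p" "p @ v = v @ p"
    using assms word_pow_snoc[of k u] word_pow_snoc[of m v] unfolding p_def by (auto simp: Suc_le_eq)
  \<comment> \<open>\<open>p\<close> is nonempty, so its \<open>N\<close>-th power is long enough to contain \<open>u @ v\<close>\<close>
  define N where "N = length u + length v"
  have c: "word_pow p n @ x = x @ word_pow p n" if "p @ x = x @ p" for x n
  proof (induction n)
    case (Suc n)
    have "word_pow p (Suc n) @ x = p @ x @ word_pow p n" by (simp add: Suc)
    also have "\<dots> = x @ word_pow p (Suc n)" using that by (metis append.assoc concat.simps(2) replicate_Suc)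
    finally show ?case .
  qed simp
  have len: "N \<le> length (word_pow p N)" using p(1) by (simp add: length_word_pow Suc_le_eq)
  have "word_pow p N @ (u @ v) = (u @ v) @ word_pow p N" "word_pow p N @ (v @ u) = (v @ u) @ word_pow p N"
    using p by (intro c; metis append.assoc)+
  then have "take N (word_pow p N) = u @ v" "take N (word_pow p N) = v @ u"
    using len by (metis N_def append_eq_append_conv_if append_eq_conv_conj length_append add.commute take_append
        append_take_drop_id diff_is_0_eq take0 append_Nil2)+
  then show ?thesis by simp
qed

lemma primitive_root_unique:
  assumes "word_pow q k = word_pow r m" "primitive q" "primitive r" "k \<ge> 1" "m \<ge> 1"
  shows "q = r \<and> k = m"
proof -
  have ne: "q \<noteq> []" "r \<noteq> []" using assms by (auto simp: primitive_def)
  obtain a b z where "word_pow z a = q" "word_pow z b = r"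
    using comm_append_are_replicate[OF equal_powers_commute[OF assms(1,4,5) ne]] by blast
  then have "q = z" "r = z" using assms unfolding primitive_def by (metis concat.simps replicate_Suc replicate_0 append_Nil2 One_nat_def)+
  moreover have "k * length q = m * length r" using arg_cong[OF assms(1), of length] by (simp add: length_word_pow)
  ultimately show ?thesis using ne by simp
qed

lemma rotate_inverse: "\<exists>j. rotate j (rotate i q) = q"
proof (cases "q = []")
  case False
  then have "rotate (length q - i mod length q) (rotate i q) = q"
    unfolding rotate_conv_mod[of i] rotate_rotate using mod_less_divisor[of "length q" i]
    by (simp add: le_add_diff_inverse2 less_imp_le)
  then show ?thesis by blast
qed simp

lemma primitive_rotate:
  assumes "primitive q"
  shows "primitive (rotate i q)"
proof -
  obtain j where "rotate j (rotate i q) = q" using rotate_inverse by blast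
  then have "q = word_pow (rotate j r) n" if "rotate i q = word_pow r n" for r n
    using that rotate_word_pow by metis
  then show ?thesis using assms unfolding primitive_def by (metis rotate_is_Nil_conv)
qed

text \<open>If a proper rotation fixes \<open>q\<close>, the two pieces that it exchanges commute and are powers of a common word.\<close>

lemma rotation_eq_self:
  assumes "primitive q" "rotate d q = q" "d < length q"
  shows "d = 0"
proof (rule ccontr)
  assume "d \<noteq> 0"
  define xs ys where "xs = take d q" and "ys = drop d q"
  have ne: "xs \<noteq> []" "ys \<noteq> []" using \<open>d \<noteq> 0\<close> assms(3) by (auto simp: xs_def ys_def)
  have "ys @ xs = q" using assms(2,3) by (simp add: rotate_drop_take xs_def ys_def)
  moreover have "xs @ ys = q" by (simp add: xs_def ys_def)
  ultimately have "xs @ ys = ys @ xs" by simp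
  then obtain n z where "n > 1" "word_pow z n = xs @ ys" using comm_append_is_replicate ne by blast
  then show False using assms(1) \<open>xs @ ys = q\<close> unfolding primitive_def by (metis less_irrefl)
qed

lemma shift_class_eq: "q \<noteq> [] \<Longrightarrow> shift_class q = (\<lambda>i. rotate i q) ` {..<length q}"
  unfolding shift_class_def using rotate_conv_mod[of _ q] mod_less_divisor[of "length q"] by fastforce

lemma card_shift_class:
  assumes "primitive q"
  shows "card (shift_class q) = length q" "finite (shift_class q)"
proof -
  have q: "q \<noteq> []" using assms by (simp add: primitive_def)
  have aux: "i = j" if "rotate i q = rotate j q" "i \<le> j" "j < length q" for i j
  proof -
    have "rotate i (rotate (j - i) q) = rotate i q" using that by (simp add: rotate_rotate)
    then have "rotate (j - i) q = q" by (metis rotate_inverse rotate_rotate add.commute)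
    then show ?thesis using rotation_eq_self[OF assms, of "j - i"] that by (simp add: less_imp_diff_less)
  qed
  have "inj_on (\<lambda>i. rotate i q) {..<length q}"
    by (rule inj_onI) (metis aux lessThan_iff nle_le)
  then show "card (shift_class q) = length q" using card_image by (simp add: shift_class_eq[OF q] card_image)
  show "finite (shift_class q)" by (simp add: shift_class_eq[OF q])
qed

lemma shift_class_self: "q \<in> shift_class q"
  unfolding shift_class_def by (auto intro: exI[of _ 0])

lemma shift_class_mem: "p \<in> shift_class q \<Longrightarrow> shift_class p = shift_class q"
  unfolding shift_class_def by (auto simp: rotate_rotate) (metis rotate_inverse rotate_rotate)

lemma cyclic_prod_rotate1: "cyclic_prod t (rotate1 p) = (cyclic_prod t p :: 'b::comm_monoid_mult)"
proof (cases "p = []")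
  case False
  define n where "n = length p"
  have n: "n > 0" using False by (simp add: n_def)
  have "cyclic_prod t (rotate1 p) = (\<Prod>j<n. t (p ! (Suc j mod n)) (p ! (Suc (Suc j mod n) mod n)))"
    unfolding cyclic_prod_def using n by (intro prod.cong) (auto simp: n_def nth_rotate1)
  also have "\<dots> = (\<Prod>i<n. t (p ! i) (p ! (Suc i mod n)))"
  proof (rule prod.reindex_bij_betw[where h="\<lambda>j. Suc j mod n" and g="\<lambda>i. t (p ! i) (p ! (Suc i mod n))"])
    show "bij_betw (\<lambda>j. Suc j mod n) {..<n} {..<n}"
      by (rule bij_betwI[where g="\<lambda>i. if i = 0 then n - 1 else i - 1"]) (use n in \<open>auto simp: mod_if\<close>)
  qed
  finally show ?thesis by (simp add: cyclic_prod_def n_def)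
qed simp

lemma cyclic_prod_rotate: "cyclic_prod t (rotate i p) = cyclic_prod t p"
  by (induction i) (simp_all add: cyclic_prod_rotate1)

lemma cyclic_prod_shift_class: "p \<in> shift_class q \<Longrightarrow> cyclic_prod t p = cyclic_prod t q"
  by (auto simp: shift_class_def cyclic_prod_rotate)

lemma prod_lessThan_add:
  "(\<Prod>j<a + b. g j) = (\<Prod>j<a. g j) * (\<Prod>j<b. g (a + j :: nat))" for g :: "nat \<Rightarrow> 'b::comm_monoid_mult"
  by (induction b) (simp_all add: mult_ac)

lemma cyclic_prod_word_pow: "cyclic_prod t (word_pow q k) = (cyclic_prod t q :: 'b::comm_monoid_mult) ^ k"
proof (cases "q = []")
  case False
  define n where "n = length q"
  have n: "n > 0" using False by (simp add: n_def)
  have "cyclic_prod t (word_pow q k) = (\<Prod>j<k * n. t (q ! (j mod n)) (q ! (Suc (j mod n) mod n)))"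
    unfolding cyclic_prod_def length_word_pow
  proof (intro prod.cong)
    fix j assume "j \<in> {..<k * n}"
    then have j: "j < k * n" "Suc j mod (k * n) < k * n" by (auto intro!: mod_less_divisor gr0I)
    have "Suc j mod (k * n) mod n = Suc (j mod n) mod n" by (simp add: mod_mult_self2_is_0 mod_mod_cancel mod_Suc_eq)
    then show "t (word_pow q k ! j) (word_pow q k ! (Suc j mod (k * length q))) = t (q ! (j mod n)) (q ! (Suc (j mod n) mod n))"
      using j by (simp add: nth_word_pow n_def)
  qed (simp add: n_def)
  also have "\<dots> = (\<Prod>j<n. t (q ! j) (q ! (Suc j mod n))) ^ k"
  proof (induction k)
    case (Suc k)
    have "(\<Prod>j<Suc k * n. t (q ! (j mod n)) (q ! (Suc (j mod n) mod n)))
      = (\<Prod>j<k * n. t (q ! (j mod n)) (q ! (Suc (j mod n) mod n))) * (\<Prod>j<n. t (q ! ((k * n + j) mod n)) (q ! (Suc ((k * n + j) mod n) mod n)))"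
      by (simp only: mult_Suc add.commute[of n] prod_lessThan_add)
    then show ?case using Suc by (simp add: mult.commute)
  qed simp
  finally show ?thesis by (simp add: cyclic_prod_def n_def)
qed (simp add: cyclic_prod_def concat_replicate_trivial)

lemma cyclic_prod_map: "cyclic_prod t (map f p) = cyclic_prod (\<lambda>x y. t (f x) (f y)) p"
proof -
  have "Suc j mod length p < length p" if "j < length p" for j
    using that by (intro mod_less_divisor) linarith
  then show ?thesis by (simp add: cyclic_prod_def)
qed

lemma bij_betw_lists_map:
  assumes "bij_betw f A B"
  shows "bij_betw (map f) (lists A) (lists B)"
proof (rule bij_betwI[where g="map (inv_into A f)"])
  show "map f \<in> lists A \<rightarrow> lists B" using assms by (auto simp: bij_betw_def)
  show "map (inv_into A f) \<in> lists B \<rightarrow> lists A" using assms by (auto simp: bij_betw_def inv_into_into)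
  show "map (inv_into A f) (map f p) = p" if "p \<in> lists A" for p
    unfolding map_map using that assms by (intro map_idI) (auto simp: bij_betw_inv_into_left)
  show "map f (map (inv_into A f) p) = p" if "p \<in> lists B" for p
    unfolding map_map using that assms by (intro map_idI) (auto simp: bij_betw_inv_into_right)
qed

section \<open>Prime cycles of a directed graph\<close>

context wf_digraph
begin

lemma cas_nth:
  assumes "p \<noteq> []"
  shows "cas u p v \<longleftrightarrow> tail G (hd p) = u \<and> head G (last p) = v \<and>
    (\<forall>j. Suc j < length p \<longrightarrow> head G (p ! j) = tail G (p ! Suc j))"
  using assms
proof (induction p arbitrary: u)
  case (Cons e p)
  show ?case
  proof (cases "p = []")
    case False
    have "(\<forall>j. Suc j < length (e # p) \<longrightarrow> head G ((e # p) ! j) = tail G ((e # p) ! Suc j)) \<longleftrightarrow>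
        head G e = tail G (hd p) \<and> (\<forall>j. Suc j < length p \<longrightarrow> head G (p ! j) = tail G (p ! Suc j))"
      using False by (auto simp: hd_conv_nth nth_Cons split: nat.splits)
    then show ?thesis using Cons False by auto
  qed auto
qed simp

text \<open>The condition that the walk closes up is included as the step from the last edge to the first.\<close>

lemma closed_w_iff:
  "closed_w p \<longleftrightarrow> p \<noteq> [] \<and> set p \<subseteq> arcs G \<and> (\<forall>j<length p. head G (p ! j) = tail G (p ! (Suc j mod length p)))"
proof (cases "p = []")
  case False
  define n where "n = length p"
  have n: "n > 0" using False by (simp add: n_def)
  have hd: "hd p = p ! 0" and last: "last p = p ! (n - 1)" using False by (auto simp: hd_conv_nth last_conv_nth n_def)
  have "(\<forall>j<n. head G (p ! j) = tail G (p ! (Suc j mod n))) \<longleftrightarrow>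
      head G (p ! (n - 1)) = tail G (p ! 0) \<and> (\<forall>j. Suc j < n \<longrightarrow> head G (p ! j) = tail G (p ! Suc j))"
    (is "?L \<longleftrightarrow> ?R")
  proof
    assume L: ?L
    show ?R
    proof (intro conjI allI impI)
      show "head G (p ! (n - 1)) = tail G (p ! 0)" using L[rule_format, of "n - 1"] n by simp
      fix j assume "Suc j < n"
      then show "head G (p ! j) = tail G (p ! Suc j)" using L[rule_format, of j] by simp
    qed
  next
    assume R: ?R
    show ?L
    proof (intro allI impI)
      fix j assume "j < n"
      then consider "Suc j < n" | "j = n - 1" by linarith
      then show "head G (p ! j) = tail G (p ! (Suc j mod n))" using R n by cases auto
    qed
  qed
  moreover have "tail G (hd p) \<in> verts G" if "set p \<subseteq> arcs G" using that False by (auto intro!: tail_in_verts)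
  ultimately show ?thesis
    using False unfolding closed_w_def awalk_def cas_nth[OF False] hd last n_def by auto
qed (simp add: closed_w_def)

text \<open>In this form closedness inherits its behaviour under rotations and powers from that of cyclic products.\<close>

lemma closed_w_iff_cyclic_prod:
  "closed_w p \<longleftrightarrow> p \<noteq> [] \<and> set p \<subseteq> arcs G \<and> cyclic_prod (\<lambda>e e'. of_bool (head G e = tail G e') :: nat) p = 1"
  unfolding closed_w_iff cyclic_prod_def prod_eq_1_iff[OF finite_lessThan] by auto

lemma closed_w_word_pow:
  assumes "k \<ge> 1"
  shows "closed_w (word_pow q k) \<longleftrightarrow> closed_w q"
proof -
  have "word_pow q k \<noteq> [] \<longleftrightarrow> q \<noteq> []" "set (word_pow q k) = set q" using assms by auto
  then show ?thesis
    using assms unfolding closed_w_iff_cyclic_prod cyclic_prod_word_pow by (auto simp: power_eq_1_iff)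
qed

lemma closed_w_rotate: "closed_w p \<Longrightarrow> closed_w (rotate i p)"
  by (simp add: closed_w_iff_cyclic_prod cyclic_prod_rotate)

definition primitive_closed :: "'b list set" where
  "primitive_closed = {q. closed_w q \<and> primitive q}"

text \<open>The primitive root of a closed walk is itself a closed walk, so that a prime cycle is represented by a
primitive word.\<close>

lemma prime_cycles_eq: "prime_cycles G = shift_class ` primitive_closed"
proof (intro equalityI subsetI)
  fix c assume c: "c \<in> prime_cycles G"
  then obtain p where p: "c = shift_class p" "closed_w p" by (auto simp: prime_cycles_def cycles_def)
  obtain q k where q: "primitive q" "k \<ge> 1" "p = word_pow q k"
    using primitive_root_exists[of p] p(2) by (auto simp: closed_w_def)
  have cq: "closed_w q" using p(2) closed_w_word_pow[OF q(2)] q(3) by simp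
  then have "\<not> k \<ge> 2" using c p(1) q(3) by (auto simp: prime_cycles_def)
  then have "k = 1" using q(2) by simp
  then show "c \<in> shift_class ` primitive_closed"
    using p(1) q cq by (auto simp: primitive_closed_def)
next
  fix c assume "c \<in> shift_class ` primitive_closed"
  then obtain q where q: "c = shift_class q" "closed_w q" "primitive q" by (auto simp: primitive_closed_def)
  have False if r: "n \<ge> 2" "c = shift_class (word_pow r n)" for r n
  proof -
    have "q \<in> shift_class (word_pow r n)" using q(1) r(2) shift_class_self by metis
    then obtain i where "q = word_pow (rotate i r) n" by (auto simp: shift_class_def rotate_word_pow)
    then show False using q(3) r(1) unfolding primitive_def by (metis Suc_1 not_less_eq_eq le_refl)
  qed
  then show "c \<in> prime_cycles G" using q by (auto simp: prime_cycles_def cycles_def)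
qed

lemma prime_cycle_mem:
  assumes "c \<in> prime_cycles G" "p \<in> c"
  shows "p \<in> primitive_closed" "shift_class p = c"
proof -
  obtain q where q: "c = shift_class q" "closed_w q" "primitive q"
    using assms(1) by (auto simp: prime_cycles_eq primitive_closed_def)
  show "p \<in> primitive_closed"
    using assms(2) q by (auto simp: shift_class_def primitive_closed_def closed_w_rotate primitive_rotate)
  show "shift_class p = c" using assms(2) q(1) shift_class_mem by simp
qed

lemma bij_betw_powers:
  "bij_betw (\<lambda>(q, k). word_pow q k) (primitive_closed \<times> {1..}) {p. closed_w p}"
  unfolding bij_betw_def
proof
  show "inj_on (\<lambda>(q, k). word_pow q k) (primitive_closed \<times> {1..})"
    by (rule inj_onI) (auto simp: primitive_closed_def dest: primitive_root_unique)
  show "(\<lambda>(q, k). word_pow q k) ` (primitive_closed \<times> {1..}) = {p. closed_w p}"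
  proof (intro equalityI subsetI)
    fix p assume "p \<in> {p. closed_w p}"
    then have p: "closed_w p" by simp
    obtain q k where q: "primitive q" "k \<ge> 1" "p = word_pow q k"
      using primitive_root_exists[of p] p by (auto simp: closed_w_def)
    then have "closed_w q" using p closed_w_word_pow by simp
    then show "p \<in> (\<lambda>(q, k). word_pow q k) ` (primitive_closed \<times> {1..})"
      using q by (intro image_eqI[of _ _ "(q, k)"]) (auto simp: primitive_closed_def)
  qed (auto simp: primitive_closed_def closed_w_word_pow)
qed

lemma bij_betw_prime_cycles:
  "bij_betw snd (SIGMA c:prime_cycles G. c) primitive_closed"
  by (rule bij_betwI[where g="\<lambda>q. (shift_class q, q)"])
     (auto simp: prime_cycle_mem shift_class_self, auto simp: prime_cycles_eq)

lemma has_sum_log_primitive: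
  fixes z :: complex
  assumes "norm z < 1" "l > (0::nat)"
  shows "((\<lambda>k. z ^ k / of_nat (k * l)) has_sum (- Ln (1 - z) / of_nat l)) {1..}"
proof -
  have "summable (\<lambda>k. norm (z ^ k / of_nat k))"
  proof (rule summable_comparison_test'[where N=1])
    show "summable (\<lambda>k. norm z ^ k)" using assms by (intro summable_geometric) simp
    fix k :: nat assume "k \<ge> 1"
    then have "norm z ^ k / real k \<le> norm z ^ k / 1" by (intro divide_left_mono) auto
    then show "norm (norm (z ^ k / of_nat k)) \<le> norm z ^ k" by (simp add: norm_divide norm_power)
  qed
  then have "((\<lambda>k. z ^ k / of_nat k) has_sum (- Ln (1 - z))) UNIV"
    by (rule norm_summable_imp_has_sum[OF _ Ln_one_minus_sums[OF assms(1)]])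
  then have "((\<lambda>k. z ^ k / of_nat k) has_sum (- Ln (1 - z))) {1..}"
    by (subst (asm) has_sum_cong_neutral[where T="{1..}" and g="\<lambda>k. z ^ k / of_nat k"]) (auto simp: not_le)
  then have "((\<lambda>k. z ^ k / of_nat k * inverse (of_nat l)) has_sum (- Ln (1 - z) * inverse (of_nat l))) {1..}"
    by (rule has_sum_cmult_left)
  then show ?thesis by (simp add: field_simps)
qed

text \<open>A primitive closed walk of length \<open>l\<close> and weight \<open>z\<close> contributes \<open>\<Sum>\<^sub>k z\<^sup>k / (k l) = - log(1 - z) / l\<close> through its
powers, and each prime cycle consists of \<open>l\<close> such walks of equal weight.\<close>

theorem has_prod_prime_cycles:
  fixes t :: "'b \<Rightarrow> 'b \<Rightarrow> complex" and z :: "'b list set \<Rightarrow> complex"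
  assumes supp: "\<And>e e'. e \<in> arcs G \<Longrightarrow> e' \<in> arcs G \<Longrightarrow> t e e' \<noteq> 0 \<Longrightarrow> head G e = tail G e'"
    and S: "has_word_sum t (arcs G) S"
    and z: "\<And>c p. c \<in> prime_cycles G \<Longrightarrow> p \<in> c \<Longrightarrow> z c = cyclic_prod t p"
    and small: "\<And>c. c \<in> prime_cycles G \<Longrightarrow> norm (z c) < 1"
  shows "has_prod_on (\<lambda>c. inverse (1 - z c)) (exp S) (prime_cycles G)"
proof -
  let ?f = "\<lambda>p. cyclic_prod t p / complex_of_nat (length p)"
  have zero: "cyclic_prod t p = 0" if p: "p \<in> lists (arcs G)" "p \<noteq> []" "\<not> closed_w p" for p
  proof -
    obtain j where j: "j < length p" "head G (p ! j) \<noteq> tail G (p ! (Suc j mod length p))"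
      using p by (auto simp: closed_w_iff in_lists_conv_set)
    have "Suc j mod length p < length p" using j by (intro mod_less_divisor) linarith
    then have "p ! j \<in> arcs G" "p ! (Suc j mod length p) \<in> arcs G" using p(1) j(1) by (auto simp: in_lists_conv_set)
    then have "t (p ! j) (p ! (Suc j mod length p)) = 0" using supp j by blast
    then show ?thesis unfolding cyclic_prod_def using j(1) by (metis finite_lessThan lessThan_iff prod_zero)
  qed
  have "(?f has_sum S) {p. closed_w p}"
  proof (rule has_sum_cong_neutral[THEN iffD1, OF _ _ _ S])
    show "?f p = 0" if "p \<in> lists (arcs G) - {p. closed_w p}" for p
      using that zero[of p] by (cases "p = []") auto
    show "?f p = 0" if "p \<in> {p. closed_w p} - lists (arcs G)" for p
      using that by (auto simp: closed_w_iff)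
  qed simp
  then have "((\<lambda>x. ?f (case x of (q, k) \<Rightarrow> word_pow q k)) has_sum S) (primitive_closed \<times> {1..})"
    using has_sum_reindex_bij_betw[OF bij_betw_powers, where f = ?f and S = S] by simp
  then have "((\<lambda>q. - Ln (1 - cyclic_prod t q) / of_nat (length q)) has_sum S) primitive_closed"
  proof (rule has_sum_SigmaD)
    fix q assume q: "q \<in> primitive_closed"
    then have "shift_class q \<in> prime_cycles G" by (auto simp: prime_cycles_eq)
    then have "norm (cyclic_prod t q) < 1" using small z shift_class_self by metis
    moreover have "length q > 0" using q by (auto simp: primitive_closed_def primitive_def)
    ultimately show "((\<lambda>k. ?f (case (q, k) of (q, k) \<Rightarrow> word_pow q k)) has_sum - Ln (1 - cyclic_prod t q) / of_nat (length q)) {1..}"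
      using has_sum_log_primitive[of "cyclic_prod t q" "length q"] by (simp only: case_prod_conv cyclic_prod_word_pow length_word_pow)
  qed
  then have "((\<lambda>x. - Ln (1 - cyclic_prod t (snd x)) / of_nat (length (snd x))) has_sum S) (SIGMA c:prime_cycles G. c)"
    using has_sum_reindex_bij_betw[OF bij_betw_prime_cycles,
        where f = "\<lambda>q. - Ln (1 - cyclic_prod t q) / of_nat (length q)" and S = S] by simp
  then have sum: "((\<lambda>c. - Ln (1 - z c)) has_sum S) (prime_cycles G)"
  proof (rule has_sum_SigmaD)
    fix c assume c: "c \<in> prime_cycles G"
    then obtain q where q: "c = shift_class q" "primitive q" by (auto simp: prime_cycles_eq primitive_closed_def)
    have len: "length p = length q" if "p \<in> c" for p using that q(1) by (auto simp: shift_class_def)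
    have "(\<Sum>p\<in>c. - Ln (1 - cyclic_prod t p) / of_nat (length p)) = (\<Sum>p\<in>c. - Ln (1 - z c) / of_nat (length q))"
      using z[OF c] len by (intro sum.cong) auto
    also have "\<dots> = - Ln (1 - z c)"
      using card_shift_class[OF q(2)] q by (auto simp: primitive_def)
    finally show "((\<lambda>p. - Ln (1 - cyclic_prod t (snd (c, p))) / of_nat (length (snd (c, p)))) has_sum - Ln (1 - z c)) c"
      using card_shift_class(2)[OF q(2)] q(1) by (intro has_sum_finiteI) auto
  qed
  have ne: "1 - z c \<noteq> 0" if "c \<in> prime_cycles G" for c using small[OF that] by auto
  have "((\<lambda>C. exp (\<Sum>c\<in>C. - Ln (1 - z c))) \<longlongrightarrow> exp S) (finite_subsets_at_top (prime_cycles G))"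
    by (rule tendsto_exp) (rule sum[unfolded has_sum_def])
  moreover have "exp (\<Sum>c\<in>C. - Ln (1 - z c)) = (\<Prod>c\<in>C. inverse (1 - z c))"
    if "finite C" "C \<subseteq> prime_cycles G" for C
    unfolding exp_sum[OF that(1)] using ne that(2) by (intro prod.cong) (auto simp: exp_minus)
  ultimately have "(prod (\<lambda>c. inverse (1 - z c)) \<longlongrightarrow> exp S) (finite_subsets_at_top (prime_cycles G))"
    by (subst (asm) tendsto_cong[OF eventually_finite_subsets_at_top_weakI]) auto
  then show ?thesis using ne by (simp add: has_prod_on_def)
qed

end

section \<open>Rays and ends of a tree\<close>

lemma reduced_Nil [simp]: "reduced a []" by (simp add: reduced_def)

lemma reduced_Cons: "reduced a (e # p) \<longleftrightarrow> reduced a p \<and> (p \<noteq> [] \<longrightarrow> hd p \<noteq> a e)"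
proof (cases p)
  case (Cons e' p')
  show ?thesis
    unfolding reduced_def Cons using less_Suc_eq_0_disj by (auto simp: nth_Cons split: nat.splits)
qed (simp add: reduced_def)

lemma reduced_append:
  "reduced a (p @ q) \<longleftrightarrow> reduced a p \<and> reduced a q \<and> (p \<noteq> [] \<longrightarrow> q \<noteq> [] \<longrightarrow> hd q \<noteq> a (last p))"
  by (induction p) (auto simp: reduced_Cons)

context graph_tree
begin

abbreviation "Rays \<equiv> rays Y arev"

abbreviation "Ends \<equiv> boundary Y arev"

lemma reduced_rev: "reduced arev p \<Longrightarrow> reduced arev (rev (map arev p))"
proof (induction p)
  case (Cons e p)
  then show ?case by (cases p) (auto simp: reduced_Cons reduced_append)
qed simp

lemma awalk_rev: "awalk u p v \<Longrightarrow> awalk v (rev (map arev p)) u"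
proof (induction p arbitrary: u)
  case (Cons e p)
  then have e: "e \<in> arcs Y" "u = tail Y e" "awalk (head Y e) p v" by (auto simp: awalk_Cons_iff)
  have "awalk v (rev (map arev p)) (head Y e)" using Cons.IH e by blast
  moreover have "awalk (head Y e) [arev e] u" using e by (simp add: awalk_Cons_iff awalk_Nil_iff)
  ultimately show ?case by (auto intro: awalk_appendI)
qed (simp add: awalk_Nil_iff)

text \<open>Where two reduced walks part, running back along one and then along the other is reduced; if they end at the
same vertex, this would be a closed reduced walk.\<close>

lemma reduced_awalk_unique:
  "awalk u p v \<Longrightarrow> awalk u q v \<Longrightarrow> reduced arev p \<Longrightarrow> reduced arev q \<Longrightarrow> p = q"
proof (induction p arbitrary: u q)
  case Nil
  then have "u = v" by (simp add: awalk_Nil_iff)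
  then show ?case using Nil no_closed_reduced[of u q] by simp
next
  case (Cons e p)
  show ?case
  proof (cases q)
    case Nil
    then have "u = v" using Cons.prems by (simp add: awalk_Nil_iff)
    then show ?thesis using Cons.prems no_closed_reduced[of u "e # p"] by simp
  next
    case q: (Cons e' q')
    show ?thesis
    proof (cases "e = e'")
      case True
      then show ?thesis using Cons q by (auto simp: awalk_Cons_iff reduced_Cons)
    next
      case False
      have "awalk v (rev (map arev (e # p)) @ q) v"
        using Cons.prems awalk_rev awalk_appendI by blast
      moreover have "reduced arev (rev (map arev (e # p)) @ q)"
        using reduced_rev[OF Cons.prems(3)] Cons.prems(4) False q by (simp add: reduced_append reduced_Cons)
      ultimately show ?thesis using no_closed_reduced q by blast
    qed
  qed
qed

lemma raysD:
  assumes "r \<in> Rays"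
  shows "r j \<in> arcs Y" "head Y (r j) = tail Y (r (Suc j))" "r (Suc j) \<noteq> arev (r j)" "tail Y (r j) \<in> verts Y"
  using assms by (auto simp: rays_def)

lemma raysI:
  "(\<And>j. r j \<in> arcs Y) \<Longrightarrow> (\<And>j. head Y (r j) = tail Y (r (Suc j))) \<Longrightarrow> (\<And>j. r (Suc j) \<noteq> arev (r j)) \<Longrightarrow> r \<in> Rays"
  by (simp add: rays_def)

lemma ray_shift: "r \<in> Rays \<Longrightarrow> (\<lambda>j. r (n + j)) \<in> Rays"
  by (simp add: rays_def)

lemma ray_segment:
  assumes "r \<in> Rays"
  shows "awalk (tail Y (r m)) (map r [m..<m + n]) (tail Y (r (m + n)))" "reduced arev (map r [m..<m + n])"
proof -
  show "awalk (tail Y (r m)) (map r [m..<m + n]) (tail Y (r (m + n)))"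
  proof (induction n arbitrary: m)
    case (Suc n)
    show ?case
      using Suc[of "Suc m"] raysD[OF assms, of m]
      by (simp only: upt_conv_Cons add_Suc_right less_add_Suc1 list.map awalk_Cons_iff) simp
  qed (use raysD[OF assms] in \<open>simp add: awalk_Nil_iff\<close>)
  show "reduced arev (map r [m..<m + n])"
    unfolding reduced_def using raysD(3)[OF assms] by simp
qed

lemma ray_vertices_inj:
  assumes "r \<in> Rays" "tail Y (r m) = tail Y (r n)"
  shows "m = n"
proof -
  have *: "m = n" if "m \<le> n" "tail Y (r m) = tail Y (r n)" for m n
  proof -
    have "map r [m..<m + (n - m)] = []"
      using that ray_segment(1)[OF assms(1), of m "n - m"]
      by (intro no_closed_reduced[OF _ ray_segment(2)[OF assms(1)], of "tail Y (r n)"]) simp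
    then have "length (map r [m..<m + (n - m)]) = 0" by (simp only: list.size)
    then show ?thesis using that by simp
  qed
  show ?thesis using *[of m n] *[of n m] assms(2) by (cases "m \<le> n") auto
qed

text \<open>The integer shift is replaced by a pair of starting indices, which are easier to compose.\<close>

lemma ray_rel_iff:
  "(r, s) \<in> ray_rel Y arev \<longleftrightarrow> r \<in> Rays \<and> s \<in> Rays \<and> (\<exists>m n. \<forall>j. r (m + j) = s (n + j))"
proof -
  have "(\<exists>(N::nat) (k::int). \<forall>j\<ge>N. 0 \<le> int j + k \<and> r (nat (int j + k)) = s j) \<longleftrightarrow> (\<exists>m n. \<forall>j. r (m + j) = s (n + j))"
    (is "?L \<longleftrightarrow> ?R")
  proof
    assume ?L
    then obtain N :: nat and k :: int where *: "\<And>j. j \<ge> N \<Longrightarrow> 0 \<le> int j + k \<and> r (nat (int j + k)) = s j" by blast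
    have "r (nat (int N + k) + j) = s (N + j)" for j
    proof -
      have "nat (int (N + j) + k) = nat (int N + k) + j" using *[of N] by linarith
      then show ?thesis using *[of "N + j"] by simp
    qed
    then show ?R by blast
  next
    assume ?R
    then obtain m n where *: "\<And>j. r (m + j) = s (n + j)" by blast
    have "0 \<le> int j + (int m - int n) \<and> r (nat (int j + (int m - int n))) = s j" if "j \<ge> n" for j
    proof -
      have "nat (int j + (int m - int n)) = m + (j - n)" using that by simp
      then show ?thesis using *[of "j - n"] that by simp
    qed
    then show ?L by blast
  qed
  then show ?thesis by (simp add: ray_rel_def)
qed

lemma equiv_ray_rel: "equiv Rays (ray_rel Y arev)"
proof (rule equivI)
  show "ray_rel Y arev \<subseteq> Rays \<times> Rays" by (auto simp: ray_rel_def)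
  show "refl_on Rays (ray_rel Y arev)" by (rule refl_onI) (auto simp: ray_rel_iff)
  show "sym (ray_rel Y arev)" by (rule symI) (auto simp: ray_rel_iff, metis)
  show "trans (ray_rel Y arev)"
  proof (rule transI)
    fix r s t assume rs: "(r, s) \<in> ray_rel Y arev" and st: "(s, t) \<in> ray_rel Y arev"
    obtain a b where ab: "\<And>j. r (a + j) = s (b + j)" using rs by (auto simp: ray_rel_iff)
    obtain c d where cd: "\<And>j. s (c + j) = t (d + j)" using st by (auto simp: ray_rel_iff)
    have "r ((a + c) + j) = t ((d + b) + j)" for j
      using ab[of "c + j"] cd[of "b + j"] by (simp add: add_ac)
    then show "(r, t) \<in> ray_rel Y arev" using rs st unfolding ray_rel_iff by blast
  qed
qed

lemma end_ray:
  assumes "c \<in> Ends" "r \<in> c"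
  shows "r \<in> Rays"
  using assms in_quotient_imp_subset[OF equiv_ray_rel] by (auto simp: boundary_def)

lemma end_cofinal:
  assumes "c \<in> Ends" "r \<in> c" "s \<in> c"
  obtains m n where "\<And>j. r (m + j) = s (n + j)"
  using assms in_quotient_imp_in_rel[OF equiv_ray_rel, of c r s] by (auto simp: boundary_def ray_rel_iff)

lemma end_closed:
  assumes "c \<in> Ends" "r \<in> c" "s \<in> Rays" "\<And>j. r (m + j) = s (n + j)"
  shows "s \<in> c"
proof -
  have "(r, s) \<in> ray_rel Y arev" using assms end_ray by (auto simp: ray_rel_iff)
  then show ?thesis
    using assms(1,2) in_quotient_imp_closed[OF equiv_ray_rel] unfolding boundary_def by blast
qed

lemma end_shift:
  assumes "c \<in> Ends" "r \<in> c"
  shows "(\<lambda>j. r (n + j)) \<in> c"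
  by (rule end_closed[OF assms ray_shift[OF end_ray[OF assms], of n], where m = n and n = 0]) simp

text \<open>The two rays merge, and up to that point they follow the unique reduced walk between the same two vertices.\<close>

lemma end_ray_unique:
  assumes c: "c \<in> Ends" "r \<in> c" "s \<in> c" and t: "tail Y (r 0) = tail Y (s 0)"
  shows "r = s"
proof -
  obtain m n where mn: "\<And>j. r (m + j) = s (n + j)" using end_cofinal[OF c] by blast
  have rs: "r \<in> Rays" "s \<in> Rays" using c end_ray by auto
  have "tail Y (r m) = tail Y (s n)" using mn[of 0] by simp
  then have *: "map r [0..<m] = map s [0..<n]"
    using ray_segment[OF rs(1), of 0 m] ray_segment[OF rs(2), of 0 n] t
    by (intro reduced_awalk_unique[of "tail Y (s 0)" _ "tail Y (s n)"]) simp_all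
  then have "m = n" using map_eq_imp_length_eq by fastforce
  show "r = s"
  proof
    fix j
    show "r j = s j"
    proof (cases "j < m")
      case True
      then show ?thesis using arg_cong[OF *, of "\<lambda>l. l ! j"] \<open>m = n\<close> by simp
    next
      case False
      then show ?thesis using mn[of "j - m"] \<open>m = n\<close> by simp
    qed
  qed
qed

lemma end_rays_sync:
  assumes c: "c \<in> Ends" "r \<in> c" "s \<in> c" and "tail Y (r m) = tail Y (s n)"
  shows "r (m + j) = s (n + j)"
  using end_ray_unique[OF c(1) end_shift[OF c(1,2)] end_shift[OF c(1,3)], of m n] assms(4)
  by (auto simp: fun_eq_iff)

text \<open>Along a walk from \<open>v\<close> to the origin of some ray, each edge in turn either prolongs the ray or shortens it by one edge.\<close>

lemma end_ray_exists:
  assumes c: "c \<in> Ends" and v: "v \<in> verts Y"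
  shows "\<exists>s\<in>c. tail Y (s 0) = v"
proof -
  obtain r where r: "r \<in> c" using c in_quotient_imp_non_empty[OF equiv_ray_rel] unfolding boundary_def by blast
  have rR: "r \<in> Rays" using end_ray[OF c r] .
  have "strongly_connected Y" using symmetric_connected_imp_strongly_connected sym_arcs connected by blast
  then have "v \<rightarrow>\<^sup>*\<^bsub>Y\<^esub> tail Y (r 0)" using v raysD(4)[OF rR] by (auto simp: strongly_connected_def)
  then obtain p where "awalk v p (tail Y (r 0))" by (auto simp: reachable_awalk)
  then show ?thesis
  proof (induction p arbitrary: v)
    case Nil
    then show ?case using r by (auto simp: awalk_Nil_iff)
  next
    case (Cons e p)
    then have e: "e \<in> arcs Y" "v = tail Y e" "awalk (head Y e) p (tail Y (r 0))" by (auto simp: awalk_Cons_iff)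
    obtain s where s: "s \<in> c" "tail Y (s 0) = head Y e" using Cons.IH[OF e(3)] by blast
    have sR: "s \<in> Rays" using end_ray[OF c s(1)] .
    show ?case
    proof (cases "s 0 = arev e")
      case True
      have "tail Y (s (1 + 0)) = v" using raysD(2)[OF sR, of 0] e True by simp
      then show ?thesis using end_shift[OF c s(1), of 1] by (intro bexI[of _ "\<lambda>j. s (1 + j)"])
    next
      case False
      define s' where "s' = case_nat e s"
      have "s' \<in> Rays"
        by (rule raysI) (use raysD[OF sR] e s False in \<open>auto simp: s'_def split: nat.splits\<close>)
      moreover have "s (0 + j) = s' (1 + j)" for j by (simp add: s'_def)
      ultimately have "s' \<in> c" by (rule end_closed[OF c s(1)])
      moreover have "tail Y (s' 0) = v" using e by (simp add: s'_def)
      ultimately show ?thesis by blast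
    qed
  qed
qed

end

section \<open>Cusps of a tree lattice\<close>

context tree_lattice
begin

abbreviation "Cusps \<equiv> cusps \<Gamma> Y arev \<phi> \<psi>"

abbreviation "orb \<equiv> Group_Action.orbit \<Gamma> \<psi>"

lemma group_Gamma: "group \<Gamma>"
  using edge.group_hom by (simp add: group_hom_def)

lemma act_arc:
  assumes "g \<in> carrier \<Gamma>" "e \<in> arcs Y"
  shows "\<psi> g e \<in> arcs Y" "tail Y (\<psi> g e) = \<phi> g (tail Y e)" "\<psi> g (arev e) = arev (\<psi> g e)"
    "head Y (\<psi> g e) = \<phi> g (head Y e)"
proof -
  have aut: "tail Y (\<psi> g e) = \<phi> g (tail Y e) \<and> \<psi> g (arev e) = arev (\<psi> g e)" if "e \<in> arcs Y" for e
    using act_auts[OF assms(1)] that by (auto simp: graph_auts_def)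
  show a: "\<psi> g e \<in> arcs Y" using edge.element_image[OF assms] by simp
  show "tail Y (\<psi> g e) = \<phi> g (tail Y e)" "\<psi> g (arev e) = arev (\<psi> g e)" using aut[OF assms(2)] by auto
  show "head Y (\<psi> g e) = \<phi> g (head Y e)"
    using aut[of "arev e"] aut[OF assms(2)] a assms(2) by (metis arev_in_arcs tail_arev)
qed

lemma act_inj: "g \<in> carrier \<Gamma> \<Longrightarrow> e \<in> arcs Y \<Longrightarrow> e' \<in> arcs Y \<Longrightarrow> \<psi> g e = \<psi> g e' \<Longrightarrow> e = e'"
  using edge.inj_prop by (meson inj_onD)

lemma act_ray:
  assumes "g \<in> carrier \<Gamma>" "r \<in> Rays"
  shows "(\<lambda>j. \<psi> g (r j)) \<in> Rays"
proof (rule raysI)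
  fix j
  note rj = raysD[OF assms(2)]
  show "\<psi> g (r j) \<in> arcs Y" using act_arc assms(1) rj by blast
  show "head Y (\<psi> g (r j)) = tail Y (\<psi> g (r (Suc j)))" using act_arc[OF assms(1)] rj by simp
  show "\<psi> g (r (Suc j)) \<noteq> arev (\<psi> g (r j))"
    using act_inj[OF assms(1), of "r (Suc j)" "arev (r j)"] act_arc(3)[OF assms(1)] rj[of j] rj(1)[of "Suc j"] by auto
qed

lemma act_inv:
  assumes "g \<in> carrier \<Gamma>" "e \<in> arcs Y"
  shows "\<psi> (inv\<^bsub>\<Gamma>\<^esub> g) (\<psi> g e) = e" "\<psi> g (\<psi> (inv\<^bsub>\<Gamma>\<^esub> g) e) = e" "inv\<^bsub>\<Gamma>\<^esub> g \<in> carrier \<Gamma>"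
proof -
  interpret group \<Gamma> by (rule group_Gamma)
  show i: "inv\<^bsub>\<Gamma>\<^esub> g \<in> carrier \<Gamma>" using assms by simp
  show "\<psi> (inv\<^bsub>\<Gamma>\<^esub> g) (\<psi> g e) = e" by (rule edge.orbit_sym_aux[OF assms refl])
  have "\<psi> (inv\<^bsub>\<Gamma>\<^esub> (inv\<^bsub>\<Gamma>\<^esub> g)) (\<psi> (inv\<^bsub>\<Gamma>\<^esub> g) e) = e" by (rule edge.orbit_sym_aux[OF i assms(2) refl])
  then show "\<psi> g (\<psi> (inv\<^bsub>\<Gamma>\<^esub> g) e) = e" using assms by simp
qed

text \<open>Arcs of the quotient are orbits; equality of orbits is the form in which the action enters most arguments.\<close>

lemma orb_eq_iff:
  assumes "e \<in> arcs Y" "e' \<in> arcs Y"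
  shows "orb e = orb e' \<longleftrightarrow> (\<exists>g\<in>carrier \<Gamma>. \<psi> g e = e')"
proof
  assume "orb e = orb e'"
  then have "e' \<in> orb e" using edge.orbit_refl[OF assms(2)] by simp
  then show "\<exists>g\<in>carrier \<Gamma>. \<psi> g e = e'" by (auto simp: Group_Action.orbit_def)
next
  assume "\<exists>g\<in>carrier \<Gamma>. \<psi> g e = e'"
  then obtain g where g: "g \<in> carrier \<Gamma>" "\<psi> g e = e'" by blast
  interpret group \<Gamma> by (rule group_Gamma)
  have "\<psi> h e \<in> orb e'" if "h \<in> carrier \<Gamma>" for h
  proof -
    have "\<psi> h e = \<psi> (h \<otimes>\<^bsub>\<Gamma>\<^esub> inv\<^bsub>\<Gamma>\<^esub> g) e'"
      using g that assms act_inv[OF g(1) assms(1)] by (simp add: edge.composition_rule)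
    then show ?thesis using that g by (auto simp: Group_Action.orbit_def)
  qed
  moreover have "\<psi> h e' \<in> orb e" if "h \<in> carrier \<Gamma>" for h
  proof -
    have "\<psi> h e' = \<psi> (h \<otimes>\<^bsub>\<Gamma>\<^esub> g) e"
      using g that assms by (simp add: edge.composition_rule)
    then show ?thesis using that g by (auto simp: Group_Action.orbit_def)
  qed
  ultimately show "orb e = orb e'" by (auto simp: Group_Action.orbit_def[of _ _ e] Group_Action.orbit_def[of _ _ e'])
qed

lemma orb_act: "g \<in> carrier \<Gamma> \<Longrightarrow> e \<in> arcs Y \<Longrightarrow> orb (\<psi> g e) = orb e"
  using orb_eq_iff[of e "\<psi> g e"] act_arc(1) by auto

lemma orb_arev_cong:
  assumes "e \<in> arcs Y" "e' \<in> arcs Y" "orb e = orb e'"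
  shows "orb (arev e) = orb (arev e')"
  using assms act_arc(3) orb_eq_iff[of "arev e" "arev e'"] orb_eq_iff[of e e'] by auto

lemma orb_arev_iff: "e \<in> arcs Y \<Longrightarrow> e' \<in> arcs Y \<Longrightarrow> orb (arev e) = orb e' \<longleftrightarrow> orb e = orb (arev e')"
  using orb_arev_cong[of "arev e" e'] orb_arev_cong[of e "arev e'"] by auto

lemma cusp_boundary: "c \<in> Cusps \<Longrightarrow> c \<in> Ends"
  by (simp add: cusps_def)

lemma end_stabilizer_act:
  assumes "g \<in> acting_in \<Gamma> \<phi> \<psi> (end_stabilizer Y arev c)" "r \<in> c"
  shows "(\<lambda>j. \<psi> g (r j)) \<in> c"
proof -
  have "(\<lambda>r. \<psi> g \<circ> r) ` c = c" using assms(1) by (simp add: acting_in_def end_stabilizer_def)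
  then have "\<psi> g \<circ> r \<in> c" using assms(2) by blast
  then show ?thesis by (simp add: o_def)
qed

lemma act_ray_cofinal:
  assumes "c \<in> Ends" "g \<in> carrier \<Gamma>" "r \<in> c" "(\<lambda>j. \<psi> g (r j)) \<in> c" "s \<in> c"
  shows "(\<lambda>j. \<psi> g (s j)) \<in> c"
proof -
  obtain m n where mn: "\<And>j. r (m + j) = s (n + j)" using end_cofinal[OF assms(1,3,5)] by blast
  show ?thesis
    by (rule end_closed[OF assms(1,4) act_ray[OF assms(2) end_ray[OF assms(1,5)]], of m n]) (simp add: mn)
qed

text \<open>All rays of an end are cofinal, so it suffices to know that one of them stays in the end.\<close>

lemma in_end_stabilizer:
  assumes c: "c \<in> Ends" and g: "g \<in> carrier \<Gamma>" and r: "r \<in> c" "(\<lambda>j. \<psi> g (r j)) \<in> c"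
  shows "g \<in> acting_in \<Gamma> \<phi> \<psi> (end_stabilizer Y arev c)"
proof -
  have R: "s j \<in> arcs Y" if "s \<in> c" for s j using end_ray[OF c that] raysD(1) by blast
  have "(\<lambda>s. \<psi> g \<circ> s) ` c = c"
  proof (intro equalityI subsetI)
    fix s assume s: "s \<in> c"
    have ig: "inv\<^bsub>\<Gamma>\<^esub> g \<in> carrier \<Gamma>" using act_inv(3)[OF g R[OF r(1)]] by blast
    have "(\<lambda>j. \<psi> (inv\<^bsub>\<Gamma>\<^esub> g) (\<psi> g (r j))) = r" by (rule ext) (simp add: act_inv(1)[OF g R[OF r(1)]])
    then have "(\<lambda>j. \<psi> (inv\<^bsub>\<Gamma>\<^esub> g) (s j)) \<in> c"
      using act_ray_cofinal[OF c ig r(2) _ s] r(1) by simp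
    moreover have "\<psi> g \<circ> (\<lambda>j. \<psi> (inv\<^bsub>\<Gamma>\<^esub> g) (s j)) = s" by (rule ext) (simp add: act_inv(2)[OF g R[OF s]])
    ultimately show "s \<in> (\<lambda>s. \<psi> g \<circ> s) ` c" by (metis image_eqI)
  qed (use act_ray_cofinal[OF c g r] in \<open>auto simp: o_def\<close>)
  then show ?thesis using g act_auts by (auto simp: acting_in_def end_stabilizer_def)
qed

text \<open>A ray \<open>t\<close> from the \<open>n\<close>-th vertex of \<open>r\<close> that does not start with \<open>r n\<close> must descend. It reaches the level of
the horocycle on which the stabilizer is transitive, at a vertex \<open>z\<close>. The ray of the end that begins in \<open>z\<close> climbs back along \<open>t\<close> and
then follows \<open>r\<close>. An element carrying the origin of a cofinal ray \<open>s\<close> to \<open>z\<close> maps \<open>s\<close> onto this ray by uniqueness.\<close>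

lemma cusp_branching:
  assumes c: "c \<in> Cusps" and r: "r \<in> c"
  shows "\<exists>N. \<forall>n>N. \<forall>t\<in>Rays. tail Y (t 0) = tail Y (r n) \<longrightarrow> t 0 \<noteq> r n \<longrightarrow>
    (\<exists>g\<in>carrier \<Gamma>. (\<forall>j\<ge>n. \<psi> g (r j) = r j) \<and> \<psi> g (r (n - 1)) = arev (t 0))"
proof -
  have b: "c \<in> Ends" using cusp_boundary[OF c] .
  obtain H where H: "H \<in> horocycles Y c" and trans: "\<And>x y. x \<in> H \<Longrightarrow> y \<in> H \<Longrightarrow>
      \<exists>g\<in>acting_in \<Gamma> \<phi> \<psi> (horocycle_stabilizer Y arev c). \<phi> g x = y"
    using c by (auto simp: cusps_def)
  obtain v where v: "v \<in> verts Y" "H = horocycle_rel Y c `` {v}"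
    using H by (auto simp: horocycles_def elim!: quotientE)
  obtain s where s: "s \<in> c" "tail Y (s 0) = v" using end_ray_exists[OF b v(1)] by blast
  have sR: "s \<in> Rays" using end_ray[OF b s(1)] .
  obtain m m' where mm: "\<And>j. r (m + j) = s (m' + j)" using end_cofinal[OF b r s(1)] by blast
  have vH: "v \<in> H" using v s by (auto simp: horocycle_rel_def)
  show ?thesis
  proof (intro exI[of _ m] allI impI ballI)
    fix n t assume n: "m < n" and t: "t \<in> Rays" "tail Y (t 0) = tail Y (r n)" "t 0 \<noteq> r n"
    define k where "k = m' + (n - m)"
    have k: "k > 0" using n by (simp add: k_def)
    have rs: "r (n + j) = s (k + j)" for j using mm[of "n - m + j"] n by (simp add: k_def add.assoc[symmetric])
    have rs': "r (n - 1) = s (k - 1)" using mm[of "n - m - 1"] n by (simp add: k_def)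
    \<comment> \<open>back up along \<open>t\<close>, then outward along \<open>s\<close>, which agrees with \<open>r\<close> there\<close>
    define s' where "s' i = (if i < k then arev (t (k - 1 - i)) else s i)" for i
    note tD = raysD[OF t(1)] and sD = raysD[OF sR]
    have s'R: "s' \<in> Rays"
    proof (rule raysI)
      fix j
      show "s' j \<in> arcs Y" using tD sD by (simp add: s'_def)
      consider "Suc j < k" | "Suc j = k" | "k \<le> j" by linarith
      then show "head Y (s' j) = tail Y (s' (Suc j))"
      proof cases
        case 1
        then have "k - 1 - j = Suc (k - 1 - Suc j)" by simp
        then show ?thesis using 1 tD(1) tD(2)[of "k - 1 - Suc j"] by (simp add: s'_def)
      next
        case 2
        then show ?thesis using tD(1) t(2) rs[of 0] by (auto simp: s'_def)
      qed (use sD in \<open>simp add: s'_def\<close>)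
      consider "Suc j < k" | "Suc j = k" | "k \<le> j" by linarith
      then show "s' (Suc j) \<noteq> arev (s' j)"
      proof cases
        case 1
        then have "k - 1 - j = Suc (k - 1 - Suc j)" by simp
        then show ?thesis using 1 tD(3)[of "k - 1 - Suc j"] by (auto simp: s'_def)
      next
        case 2
        then show ?thesis using t(3) rs[of 0] by (auto simp: s'_def)
      qed (use sD in \<open>simp add: s'_def\<close>)
    qed
    have s'c: "s' \<in> c"
      by (rule end_closed[OF b s(1) s'R, of k k]) (simp add: s'_def)
    have "(v, tail Y (s' 0)) \<in> horocycle_rel Y c"
    proof -
      have "tail Y (s k) = tail Y (s' k)" by (simp add: s'_def)
      then have "\<exists>r\<in>c. \<exists>q\<in>c. tail Y (r 0) = v \<and> tail Y (q 0) = tail Y (s' 0) \<and> (\<exists>n. tail Y (r n) = tail Y (q n))"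
        using s s'c by blast
      then show ?thesis using v(1) raysD(4)[OF s'R, of 0] by (simp add: horocycle_rel_def)
    qed
    then have "tail Y (s' 0) \<in> H" using v by blast
    then obtain g where g: "g \<in> acting_in \<Gamma> \<phi> \<psi> (horocycle_stabilizer Y arev c)" "\<phi> g v = tail Y (s' 0)"
      using trans vH by blast
    have gG: "g \<in> carrier \<Gamma>" using g by (simp add: acting_in_def)
    have ge: "g \<in> acting_in \<Gamma> \<phi> \<psi> (end_stabilizer Y arev c)"
      using g(1) by (auto simp: acting_in_def horocycle_stabilizer_def)
    have "(\<lambda>j. \<psi> g (s j)) = s'"
      by (rule end_ray_unique[OF b end_stabilizer_act[OF ge s(1)] s'c]) (use g(2) s act_arc(2)[OF gG sD(1)] in simp)
    then have gs: "\<psi> g (s j) = s' j" for j by (metis)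
    show "\<exists>g\<in>carrier \<Gamma>. (\<forall>j\<ge>n. \<psi> g (r j) = r j) \<and> \<psi> g (r (n - 1)) = arev (t 0)"
    proof (intro bexI[OF _ gG] conjI allI impI)
      fix j assume "n \<le> j"
      then have "r j = s (k + (j - n))" using rs[of "j - n"] by simp
      moreover have "s' (k + (j - n)) = s (k + (j - n))" by (simp add: s'_def)
      ultimately show "\<psi> g (r j) = r j" using gs by simp
    next
      show "\<psi> g (r (n - 1)) = arev (t 0)" using k gs[of "k - 1"] unfolding rs' by (simp add: s'_def)
    qed
  qed
qed

text \<open>Such an element stabilizes the end, hence a horocycle by the definition of a cusp. It then maps some ray
of the end to a ray that meets it at equal distance from the origin, and therefore fixes every ray of the
end from some point on.\<close>

lemma cusp_no_translation:
  assumes c: "c \<in> Cusps" and r: "r \<in> c" and g: "g \<in> carrier \<Gamma>"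
    and t: "\<And>j. \<psi> g (r (m + j)) = r (n + j)"
  shows "m = n"
proof -
  have b: "c \<in> Ends" using cusp_boundary[OF c] .
  have "(\<lambda>j. \<psi> g (r (m + j))) \<in> c" using end_shift[OF b r, of n] by (simp add: t)
  then have "g \<in> acting_in \<Gamma> \<phi> \<psi> (end_stabilizer Y arev c)"
    by (rule in_end_stabilizer[OF b g end_shift[OF b r]])
  then have ge: "g \<in> acting_in \<Gamma> \<phi> \<psi> (end_stabilizer Y arev c)"
    and "g \<in> acting_in \<Gamma> \<phi> \<psi> (horocycle_stabilizer Y arev c)" using c by (auto simp: cusps_def)
  then obtain H where H: "H \<in> horocycles Y c" "\<phi> g ` H = H" by (auto simp: acting_in_def horocycle_stabilizer_def)
  obtain v where v: "v \<in> verts Y" "H = horocycle_rel Y c `` {v}"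
    using H(1) by (auto simp: horocycles_def elim!: quotientE)
  obtain s0 where "s0 \<in> c" "tail Y (s0 0) = v" using end_ray_exists[OF b v(1)] by blast
  then have "v \<in> H" using v by (auto simp: horocycle_rel_def)
  then have "\<phi> g v \<in> H" using H(2) by blast
  then have "(v, \<phi> g v) \<in> horocycle_rel Y c" using v(2) by blast
  then obtain s s' i where s: "s \<in> c" "s' \<in> c" "tail Y (s 0) = v" "tail Y (s' 0) = \<phi> g v" "tail Y (s i) = tail Y (s' i)"
    unfolding horocycle_rel_def by blast
  have sD: "s j \<in> arcs Y" for j using end_ray[OF b s(1)] raysD(1) by blast
  have gs: "(\<lambda>j. \<psi> g (s j)) \<in> c" by (rule end_stabilizer_act[OF ge s(1)])
  have "(\<lambda>j. \<psi> g (s j)) = s'"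
    by (rule end_ray_unique[OF b gs s(2)]) (use s act_arc(2)[OF g sD] in simp)
  then have "tail Y (\<psi> g (s i)) = tail Y (s i)" using s(5) by (metis)
  then have fix_s: "\<psi> g (s (i + j)) = s (i + j)" for j by (rule end_rays_sync[OF b gs s(1)])
  obtain a a' where ra: "\<And>j. r (a + j) = s (a' + j)" using end_cofinal[OF b r s(1)] by blast
  have fix_r: "\<psi> g (r (a + i + j)) = r (a + i + j)" for j
    using ra[of "i + j"] fix_s[of "a' + j"] by (simp add: add_ac)
  have "r (m + (a + i)) = r (n + (a + i))"
    using fix_r[of m] t[of "a + i"] by (simp add: add_ac)
  then have "m + (a + i) = n + (a + i)"
    by (intro ray_vertices_inj[OF end_ray[OF b r]]) simp
  then show ?thesis by simp
qed

end

section \<open>The image of a cusp ray in the quotient\<close>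

context tree_lattice
begin

text \<open>The consequence of \<open>cusp_branching\<close> for the quotient: beyond \<open>N\<close>, a ray through a vertex of \<open>r\<close> continues, up to
the action of the lattice, either outward or inward along \<open>r\<close>.\<close>

definition branching_beyond :: "(nat \<Rightarrow> 'e) \<Rightarrow> nat \<Rightarrow> bool" where
  "branching_beyond r N \<longleftrightarrow> r \<in> Rays \<and> (\<forall>n>N. \<forall>t\<in>Rays. tail Y (t 0) = tail Y (r n) \<longrightarrow>
     t 0 = r n \<or> orb (t 0) = orb (arev (r (n - 1))))"

text \<open>Equality of the two orbits means that the image of \<open>r\<close> in the quotient turns back at the origin of \<open>r n\<close>.\<close>

definition unfolded_beyond :: "(nat \<Rightarrow> 'e) \<Rightarrow> nat \<Rightarrow> bool" where
  "unfolded_beyond r N \<longleftrightarrow> (\<forall>n>N. orb (r n) \<noteq> orb (arev (r (n - 1))))"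

lemma branching_beyondD:
  "branching_beyond r N \<Longrightarrow> n > N \<Longrightarrow> t \<in> Rays \<Longrightarrow> tail Y (t 0) = tail Y (r n) \<Longrightarrow>
    t 0 = r n \<or> orb (t 0) = orb (arev (r (n - 1)))"
  by (simp add: branching_beyond_def)

lemma branching_step:
  assumes r: "branching_beyond r N" and n: "n > N" and t: "t \<in> Rays" and g: "g \<in> carrier \<Gamma>"
    and tail: "\<phi> g (tail Y (t k)) = tail Y (r n)"
  shows "\<psi> g (t k) = r n \<or> orb (t k) = orb (arev (r (n - 1)))"
proof -
  have tk: "t k \<in> arcs Y" using raysD(1)[OF t] .
  have ray: "(\<lambda>j. \<psi> g (t (k + j))) \<in> Rays" by (rule act_ray[OF g ray_shift[OF t]])
  have "tail Y (\<psi> g (t (k + 0))) = tail Y (r n)" using act_arc(2)[OF g tk] tail by simp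
  then have "\<psi> g (t (k + 0)) = r n \<or> orb (\<psi> g (t (k + 0))) = orb (arev (r (n - 1)))"
    by (rule branching_beyondD[OF r n ray])
  then show ?thesis using orb_act[OF g tk] by simp
qed

lemma forward_step:
  assumes r: "branching_beyond r N" and n: "n \<ge> N" and t: "t \<in> Rays" and g: "g \<in> carrier \<Gamma>"
    and e: "\<psi> g (t k) = r n"
  shows "\<psi> g (t (Suc k)) = r (Suc n) \<or> orb (t (Suc k)) = orb (arev (r n))"
proof -
  have rR: "r \<in> Rays" using r by (simp add: branching_beyond_def)
  have "\<phi> g (tail Y (t (Suc k))) = head Y (\<psi> g (t k))"
    using raysD[OF t, of k] act_arc(4)[OF g] by simp
  also have "\<dots> = tail Y (r (Suc n))" using raysD[OF rR] e by simp
  finally show ?thesis using branching_step[OF r _ t g, of "Suc n" "Suc k"] n by simp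
qed

text \<open>A ray that runs inward along \<open>r\<close> keeps doing so: continuing outward would mean turning back.\<close>

lemma backward_step:
  assumes r: "branching_beyond r N" and n: "n > N" and t: "t \<in> Rays" and e: "orb (t k) = orb (arev (r n))"
  shows "orb (t (Suc k)) = orb (arev (r (n - 1)))"
proof -
  have rR: "r \<in> Rays" using r by (simp add: branching_beyond_def)
  note rD = raysD[OF rR] and tD = raysD[OF t]
  obtain g where g: "g \<in> carrier \<Gamma>" "\<psi> g (t k) = arev (r n)"
    using e orb_eq_iff[of "t k" "arev (r n)"] rD tD by auto
  have "\<phi> g (tail Y (t (Suc k))) = head Y (\<psi> g (t k))" using tD act_arc(4)[OF g(1)] by simp
  also have "\<dots> = tail Y (r n)" using rD g(2) by simp
  finally have "\<psi> g (t (Suc k)) = r n \<or> orb (t (Suc k)) = orb (arev (r (n - 1)))"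
    by (rule branching_step[OF r n t g(1)])
  moreover have "\<psi> g (t (Suc k)) \<noteq> r n"
    using raysD(3)[OF act_ray[OF g(1) t], of k] g(2) by simp
  ultimately show ?thesis by blast
qed

text \<open>Conjugation by \<open>g\<close> embeds one stabilizer into the other.\<close>

lemma stabilizer_card_le:
  assumes g: "g \<in> carrier \<Gamma>" and e: "e \<in> arcs Y"
  shows "card (stabilizer \<Gamma> \<psi> (\<psi> g e)) \<le> card (stabilizer \<Gamma> \<psi> e)"
proof -
  interpret group \<Gamma> by (rule group_Gamma)
  let ?c = "\<lambda>h. inv\<^bsub>\<Gamma>\<^esub> g \<otimes>\<^bsub>\<Gamma>\<^esub> h \<otimes>\<^bsub>\<Gamma>\<^esub> g"
  have "inj_on ?c (stabilizer \<Gamma> \<psi> (\<psi> g e))"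
    using g by (intro inj_onI) (auto simp: stabilizer_def)
  moreover have "?c ` stabilizer \<Gamma> \<psi> (\<psi> g e) \<subseteq> stabilizer \<Gamma> \<psi> e"
  proof (intro subsetI, elim imageE)
    fix x h assume h: "h \<in> stabilizer \<Gamma> \<psi> (\<psi> g e)" and x: "x = ?c h"
    have hG: "h \<in> carrier \<Gamma>" "\<psi> h (\<psi> g e) = \<psi> g e" using h by (auto simp: stabilizer_def)
    have "\<psi> x e = \<psi> (inv\<^bsub>\<Gamma>\<^esub> g) (\<psi> h (\<psi> g e))"
      unfolding x using g hG e act_arc(1) by (simp add: edge.composition_rule)
    then show "x \<in> stabilizer \<Gamma> \<psi> e" using x g hG act_inv(1)[OF g e] by (simp add: stabilizer_def)
  qed
  ultimately show ?thesis using finite_stabilizers[OF e] card_inj_on_le by blast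
qed

lemma stabilizer_card_orb:
  assumes "e \<in> arcs Y" "e' \<in> arcs Y" "orb e = orb e'"
  shows "card (stabilizer \<Gamma> \<psi> e') = card (stabilizer \<Gamma> \<psi> e)"
  using assms orb_eq_iff[of e e'] orb_eq_iff[of e' e] stabilizer_card_le by (metis le_antisym)

text \<open>Suppose the ray meets finitely many orbits. The groups fixing \<open>r\<close> from \<open>n\<close> on increase with \<open>n\<close> and have bounded
order, so they are constant from some point on. There \<open>cusp_branching\<close> leaves a single way down, so an
element identifying two edges of \<open>r\<close> must map the rest of \<open>r\<close> into \<open>r\<close>, which \<open>cusp_no_translation\<close> forbids.\<close>

lemma cusp_infinite_orbits:
  assumes c: "c \<in> Cusps" and r: "r \<in> c"
  shows "infinite (range (\<lambda>n. orb (r n)))"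
proof
  assume fin: "finite (range (\<lambda>n. orb (r n)))"
  have rR: "r \<in> Rays" using end_ray[OF cusp_boundary[OF c] r] .
  note rD = raysD[OF rR]
  obtain N0 where "\<forall>n>N0. \<forall>t\<in>Rays. tail Y (t 0) = tail Y (r n) \<longrightarrow> t 0 \<noteq> r n \<longrightarrow>
      (\<exists>g\<in>carrier \<Gamma>. (\<forall>j\<ge>n. \<psi> g (r j) = r j) \<and> \<psi> g (r (n - 1)) = arev (t 0))"
    using cusp_branching[OF c r] by (elim exE)
  note N0 = this[rule_format]
  \<comment> \<open>the elements fixing \<open>r\<close> from \<open>n\<close> on: an increasing sequence of subgroups\<close>
  define St where "St n = {g \<in> carrier \<Gamma>. \<forall>j\<ge>n. \<psi> g (r j) = r j}" for n
  have St_fin: "finite (St n)" "card (St n) \<le> card (stabilizer \<Gamma> \<psi> (r n))" for n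
  proof -
    have "St n \<subseteq> stabilizer \<Gamma> \<psi> (r n)" by (auto simp: St_def stabilizer_def)
    then show "finite (St n)" "card (St n) \<le> card (stabilizer \<Gamma> \<psi> (r n))"
      using finite_stabilizers[OF rD(1)] by (auto intro: finite_subset card_mono)
  qed
  have St_mono: "St m \<subseteq> St n" if "m \<le> n" for m n using that by (auto simp: St_def)
  obtain M where M: "finite M" "range (\<lambda>n. orb (r n)) = (\<lambda>n. orb (r n)) ` M"
    using finite_subset_image[OF fin order_refl] by blast
  define B where "B = (\<Sum>m\<in>M. card (stabilizer \<Gamma> \<psi> (r m)))"
  have B: "card (St n) \<le> B" for n
  proof -
    have "orb (r n) \<in> (\<lambda>n. orb (r n)) ` M" unfolding M(2)[symmetric] by (rule rangeI)
    then obtain m where m: "m \<in> M" "orb (r m) = orb (r n)" by (elim imageE) simp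
    have "card (stabilizer \<Gamma> \<psi> (r n)) = card (stabilizer \<Gamma> \<psi> (r m))"
      using stabilizer_card_orb[OF rD(1) rD(1) m(2)] .
    also have "\<dots> \<le> B" unfolding B_def using M(1) m(1) by (intro member_le_sum) auto
    finally show ?thesis using St_fin(2) order_trans by blast
  qed
  have "\<exists>N. \<forall>n. card (St n) \<le> card (St N)"
    using ex_has_greatest_nat[of "\<lambda>_. True" 0 "\<lambda>n. card (St n)" "Suc B"] B by (auto simp: less_Suc_eq_le)
  then obtain N1 where N1: "\<And>n. card (St n) \<le> card (St N1)" by blast
  have St_const: "St n = St N1" if "n \<ge> N1" for n
    using card_seteq[OF St_fin(1) St_mono[OF that]] N1[of n] by simp
  define N where "N = Suc (max N0 N1)"
  have single: "t 0 = r n \<or> t 0 = arev (r (n - 1))"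
    if n: "n \<ge> N" and t: "t \<in> Rays" "tail Y (t 0) = tail Y (r n)" for n t
  proof (cases "t 0 = r n")
    case False
    have "n > N0" using n by (simp add: N_def)
    from N0[OF this t False]
    obtain g where g: "g \<in> carrier \<Gamma>" "\<forall>j\<ge>n. \<psi> g (r j) = r j" "\<psi> g (r (n - 1)) = arev (t 0)"
      by blast
    have "g \<in> St n" using g by (simp add: St_def)
    also have "St n = St (n - 1)" using St_const[of n] St_const[of "n - 1"] n by (simp add: N_def)
    finally have "\<psi> g (r (n - 1)) = r (n - 1)" by (simp add: St_def)
    then show ?thesis using g(3) by simp
  qed simp
  have "\<not> inj_on (\<lambda>n. orb (r n)) {N..}"
  proof
    assume "inj_on (\<lambda>n. orb (r n)) {N..}"
    moreover have "finite ((\<lambda>n. orb (r n)) ` {N..})" by (rule finite_subset[OF _ fin]) auto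
    ultimately show False using finite_imageD infinite_Ici by blast
  qed
  then obtain m n where mn: "m \<ge> N" "n \<ge> N" "m \<noteq> n" "orb (r m) = orb (r n)" by (auto simp: inj_on_def)
  then obtain g where g: "g \<in> carrier \<Gamma>" "\<psi> g (r m) = r n" using orb_eq_iff[OF rD(1) rD(1)] by blast
  have "\<psi> g (r (m + j)) = r (n + j)" for j
  proof (induction j)
    case (Suc j)
    have "(\<lambda>i. \<psi> g (r (m + Suc j + i))) \<in> Rays" by (rule act_ray[OF g(1) ray_shift[OF rR]])
    moreover have "tail Y (\<psi> g (r (m + Suc j + 0))) = tail Y (r (n + Suc j))"
      using raysD(2)[OF act_ray[OF g(1) rR], of "m + j"] rD(2)[of "n + j"] Suc by simp
    ultimately have "\<psi> g (r (m + Suc j + 0)) = r (n + Suc j) \<or> \<psi> g (r (m + Suc j + 0)) = arev (r (n + Suc j - 1))"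
      by (intro single) (use mn in auto)
    moreover have "\<psi> g (r (m + Suc j)) \<noteq> arev (r (n + j))"
      using raysD(3)[OF act_ray[OF g(1) rR], of "m + j"] Suc by simp
    ultimately show ?case by simp
  qed (use g in simp)
  then have "m = n" by (rule cusp_no_translation[OF c r g(1)])
  then show False using mn by simp
qed

lemma cusp_branching_beyond:
  assumes c: "c \<in> Cusps" and r: "r \<in> c"
  shows "\<exists>N. branching_beyond r N"
proof -
  have rR: "r \<in> Rays" using end_ray[OF cusp_boundary[OF c] r] .
  obtain N where "\<forall>n>N. \<forall>t\<in>Rays. tail Y (t 0) = tail Y (r n) \<longrightarrow> t 0 \<noteq> r n \<longrightarrow>
      (\<exists>g\<in>carrier \<Gamma>. (\<forall>j\<ge>n. \<psi> g (r j) = r j) \<and> \<psi> g (r (n - 1)) = arev (t 0))"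
    using cusp_branching[OF c r] by (elim exE)
  note N = this[rule_format]
  have "t 0 = r n \<or> orb (t 0) = orb (arev (r (n - 1)))"
    if t: "n > N" "t \<in> Rays" "tail Y (t 0) = tail Y (r n)" for n t
  proof (cases "t 0 = r n")
    case False
    then obtain g where g: "g \<in> carrier \<Gamma>" "\<psi> g (r (n - 1)) = arev (t 0)" using N[OF t] by blast
    have t0: "t 0 \<in> arcs Y" using raysD(1)[OF t(2)] .
    have "orb (r (n - 1)) = orb (arev (t 0))" using orb_act[OF g(1) raysD(1)[OF rR]] g(2) by metis
    then show ?thesis using orb_arev_iff[OF t0 raysD(1)[OF rR], of "n - 1"] by simp
  qed simp
  then show ?thesis using rR unfolding branching_beyond_def by blast
qed

text \<open>Between two folds at \<open>k1 < k2\<close> the image of the ray would run to and fro on the segment from \<open>k1\<close> to \<open>k2\<close>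
forever, and hence meet only finitely many orbits.\<close>

lemma cusp_unfolded_beyond:
  assumes c: "c \<in> Cusps" and r: "r \<in> c"
  shows "\<exists>N. unfolded_beyond r N"
proof (rule ccontr)
  assume nex: "\<nexists>N. unfolded_beyond r N"
  then have folds: "\<exists>n>N. orb (r n) = orb (arev (r (n - 1)))" for N by (auto simp: unfolded_beyond_def)
  have rR: "r \<in> Rays" using end_ray[OF cusp_boundary[OF c] r] .
  note rD = raysD[OF rR]
  obtain N where N: "branching_beyond r N" using cusp_branching_beyond[OF c r] by blast
  obtain k1 where k1: "k1 > N" "orb (r k1) = orb (arev (r (k1 - 1)))" using folds by blast
  obtain k2 where k2: "k2 > k1" "orb (r k2) = orb (arev (r (k2 - 1)))" using folds by blast
  \<comment> \<open>the orbits of the edges between the two folds, in both orientations\<close>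
  define Z where "Z = (\<lambda>j. orb (r j)) ` {k1..<k2} \<union> (\<lambda>j. orb (arev (r j))) ` {k1..<k2}"
  have in_Z: "orb (r (k1 + i)) \<in> Z" for i
  proof (induction i)
    case 0
    then show ?case using k2 by (auto simp: Z_def)
  next
    case (Suc i)
    then consider j where "k1 \<le> j" "j < k2" "orb (r (k1 + i)) = orb (r j)"
      | j where "k1 \<le> j" "j < k2" "orb (r (k1 + i)) = orb (arev (r j))" by (auto simp: Z_def)
    then show ?case
    proof cases
      case 1
      then obtain g where g: "g \<in> carrier \<Gamma>" "\<psi> g (r (k1 + i)) = r j" using orb_eq_iff[OF rD(1) rD(1)] by blast
      have "\<psi> g (r (Suc (k1 + i))) = r (Suc j) \<or> orb (r (Suc (k1 + i))) = orb (arev (r j))"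
        by (rule forward_step[OF N _ rR g]) (use 1 k1 in simp)
      then show ?thesis
      proof
        assume "\<psi> g (r (Suc (k1 + i))) = r (Suc j)"
        then have *: "orb (r (Suc (k1 + i))) = orb (r (Suc j))" using orb_act[OF g(1) rD(1)] by metis
        show ?thesis
        proof (cases "Suc j = k2")
          case True
          then have "orb (r (Suc (k1 + i))) = orb (arev (r j))" using * k2 by auto
          then show ?thesis using 1 by (simp add: Z_def)
        next
          case False
          then show ?thesis using 1 * by (simp add: Z_def)
        qed
      next
        assume "orb (r (Suc (k1 + i))) = orb (arev (r j))"
        then show ?thesis using 1 by (simp add: Z_def)
      qed
    next
      case 2
      have *: "orb (r (Suc (k1 + i))) = orb (arev (r (j - 1)))"
        by (rule backward_step[OF N _ rR 2(3)]) (use 2 k1 in simp)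
      show ?thesis
      proof (cases "j = k1")
        case True
        then have "orb (r (Suc (k1 + i))) = orb (r k1)" using * k1 by simp
        then show ?thesis using k2 by (simp add: Z_def)
      next
        case False
        then have "j - 1 \<in> {k1..<k2}" using 2 by auto
        then show ?thesis using * by (simp add: Z_def)
      qed
    qed
  qed
  have "range (\<lambda>n. orb (r n)) \<subseteq> (\<lambda>n. orb (r n)) ` {..<k1} \<union> Z"
  proof (rule image_subsetI)
    fix n
    show "orb (r n) \<in> (\<lambda>n. orb (r n)) ` {..<k1} \<union> Z"
      using in_Z[of "n - k1"] by (cases "n < k1") auto
  qed
  moreover have "finite Z" by (simp add: Z_def)
  ultimately have "finite (range (\<lambda>n. orb (r n)))" by (meson finite_UnI finite_imageI finite_lessThan finite_subset)
  then show False using cusp_infinite_orbits[OF c r] by blast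
qed

text \<open>If one step of \<open>t\<close> were carried inward along \<open>r\<close> after an outward one, \<open>t\<close> would fold there.\<close>

lemma forward_sync:
  assumes r: "branching_beyond r N" "n \<ge> N" and t: "t \<in> Rays" "unfolded_beyond t N'" "k \<ge> N'"
    and g: "g \<in> carrier \<Gamma>" "\<psi> g (t k) = r n"
  shows "\<psi> g (t (k + j)) = r (n + j)"
proof (induction j)
  case (Suc j)
  have tk: "t (k + j) \<in> arcs Y" "r (n + j) \<in> arcs Y" using t(1) r(1) raysD(1) by (auto simp: branching_beyond_def)
  have "\<psi> g (t (Suc (k + j))) = r (Suc (n + j)) \<or> orb (t (Suc (k + j))) = orb (arev (r (n + j)))"
    by (rule forward_step[OF r(1) _ t(1) g(1) Suc]) (use r(2) in simp)
  moreover have "orb (t (Suc (k + j))) \<noteq> orb (arev (r (n + j)))"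
  proof -
    have "orb (t (k + j)) = orb (r (n + j))" using orb_act[OF g(1) tk(1)] Suc by simp
    then have "orb (arev (t (k + j))) = orb (arev (r (n + j)))" by (rule orb_arev_cong[OF tk])
    moreover have "orb (t (Suc (k + j))) \<noteq> orb (arev (t (Suc (k + j) - 1)))"
      using t(2,3) unfolding unfolded_beyond_def by (metis add.commute le_add1 le_imp_less_Suc le_trans)
    ultimately show ?thesis by simp
  qed
  ultimately show ?case by simp
qed (use g in simp)

text \<open>Beyond \<open>N\<close> the image of \<open>r\<close> in the quotient is a half-line, and a ray from one of its vertices can only follow it,
outward or inward.\<close>

definition settled :: "(nat \<Rightarrow> 'e) \<Rightarrow> nat \<Rightarrow> bool" where
  "settled r N \<longleftrightarrow> branching_beyond r N \<and> unfolded_beyond r N \<and> inj_on (\<lambda>n. orb (r n)) {N..}"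

lemma cusp_settled:
  assumes c: "c \<in> Cusps" and r: "r \<in> c"
  shows "\<exists>N. settled r N"
proof -
  have rR: "r \<in> Rays" using end_ray[OF cusp_boundary[OF c] r] .
  obtain A where A: "branching_beyond r A" using cusp_branching_beyond[OF c r] by blast
  obtain B where B: "unfolded_beyond r B" using cusp_unfolded_beyond[OF c r] by blast
  define N where "N = max A B"
  have br: "branching_beyond r N" "unfolded_beyond r N" using A B by (auto simp: N_def branching_beyond_def unfolded_beyond_def)
  have "m = n" if mn: "m \<ge> N" "n \<ge> N" "orb (r m) = orb (r n)" for m n
  proof -
    obtain g where g: "g \<in> carrier \<Gamma>" "\<psi> g (r m) = r n"
      using mn(3) orb_eq_iff[OF raysD(1)[OF rR] raysD(1)[OF rR]] by blast
    show ?thesis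
      by (rule cusp_no_translation[OF c r g(1)]) (rule forward_sync[OF br(1) mn(2) rR br(2) mn(1) g])
  qed
  then show ?thesis using br by (auto simp: settled_def inj_on_def)
qed

end

section \<open>Mutual position of cusp rays\<close>

text \<open>The part of the definition of a cuspidal lattice that concerns oriented edges, with \<open>FA\<close> the edges of the finite graph.\<close>

locale cusp_cover = tree_lattice \<Gamma> Y arev \<phi> \<psi>
  for \<Gamma> :: "('g, 'm) monoid_scheme" and Y :: "('v, 'e) pre_digraph" and arev :: "'e \<Rightarrow> 'e"
    and \<phi> :: "'g \<Rightarrow> 'v \<Rightarrow> 'v" and \<psi> :: "'g \<Rightarrow> 'e \<Rightarrow> 'e" +
  fixes FA :: "'e set set" and R :: "(nat \<Rightarrow> 'e) set"
  assumes finite_FA: "finite FA" and finite_R: "finite R"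
    and cusp_R: "\<And>r. r \<in> R \<Longrightarrow> \<exists>c\<in>Cusps. periodic_end Y c \<and> r \<in> c"
    and cover: "\<And>e. e \<in> arcs Y \<Longrightarrow> orb e \<in> FA \<or>
      (\<exists>r\<in>R. \<exists>n. orb e = orb (r n) \<or> orb e = orb (arev (r n)))"
begin

lemma R_rays: "r \<in> R \<Longrightarrow> r \<in> Rays"
  using cusp_R end_ray cusp_boundary by blast

lemma R_arcs: "r \<in> R \<Longrightarrow> r n \<in> arcs Y"
  using R_rays raysD(1) by blast

lemma settled_mono: "settled r M \<Longrightarrow> M \<le> M' \<Longrightarrow> settled r M'"
  by (auto simp: settled_def branching_beyond_def unfolded_beyond_def inj_on_def)

text \<open>An index beyond which all the finitely many rays are settled.\<close>

definition depth :: nat where "depth = (SOME M. \<forall>r\<in>R. settled r M)"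

lemma settled_depth: assumes "r \<in> R" shows "settled r depth"
proof -
  have "\<forall>r\<in>R. \<exists>M. settled r M" using cusp_R cusp_settled by blast
  then obtain M where M: "\<forall>r\<in>R. settled r (M r)" by metis
  have "\<forall>r\<in>R. settled r (\<Sum>s\<in>R. M s)"
    using M settled_mono member_le_sum[of _ R M] finite_R by blast
  then have "\<exists>M. \<forall>r\<in>R. settled r M" by blast
  from someI_ex[OF this] show ?thesis using assms by (simp add: depth_def)
qed

lemma depthD:
  assumes "r \<in> R"
  shows "branching_beyond r depth" "unfolded_beyond r depth" "inj_on (\<lambda>n. orb (r n)) {depth..}"
  using settled_depth[OF assms] by (auto simp: settled_def)

lemma finite_hits:
  assumes "r \<in> R" "finite Z"
  shows "finite {n. orb (r n) \<in> Z}"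
proof -
  have "finite ((\<lambda>n. orb (r n)) -` Z \<inter> {depth..})"
    by (rule finite_vimage_IntI[OF assms(2) depthD(3)[OF assms(1)]])
  moreover have "{n. orb (r n) \<in> Z} \<subseteq> ((\<lambda>n. orb (r n)) -` Z \<inter> {depth..}) \<union> {..<depth}" by auto
  ultimately show ?thesis by (meson finite_UnI finite_lessThan finite_subset)
qed

lemma finite_repeats:
  assumes "r \<in> R"
  shows "finite {n. \<exists>m. orb (r m) = orb (r n) \<and> m \<noteq> n}"
proof (rule finite_subset)
  show "{n. \<exists>m. orb (r m) = orb (r n) \<and> m \<noteq> n} \<subseteq> {n. orb (r n) \<in> (\<lambda>m. orb (r m)) ` {..<depth}} \<union> {..<depth}"
  proof (intro subsetI, elim CollectE exE conjE)
    fix n m assume mn: "orb (r m) = orb (r n)" "m \<noteq> n"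
    show "n \<in> {n. orb (r n) \<in> (\<lambda>m. orb (r m)) ` {..<depth}} \<union> {..<depth}"
    proof (cases "m < depth \<or> n < depth")
      case True
      then show ?thesis using mn(1) by (metis (mono_tags, lifting) UnCI imageI lessThan_iff mem_Collect_eq)
    next
      case False
      then show ?thesis using mn depthD(3)[OF assms] by (auto simp: inj_on_def)
    qed
  qed
qed (simp add: finite_hits[OF assms])

definition tail_equiv :: "(nat \<Rightarrow> 'e) \<Rightarrow> (nat \<Rightarrow> 'e) \<Rightarrow> bool" where
  "tail_equiv r s \<longleftrightarrow> (\<exists>m n. \<forall>j. orb (r (m + j)) = orb (s (n + j)))"

lemma tail_equiv_refl: "tail_equiv r r" by (auto simp: tail_equiv_def)

lemma tail_equiv_sym: "tail_equiv r s \<Longrightarrow> tail_equiv s r" unfolding tail_equiv_def by metis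

lemma tail_equiv_trans:
  assumes "tail_equiv r s" "tail_equiv s t"
  shows "tail_equiv r t"
proof -
  obtain a b where ab: "\<And>j. orb (r (a + j)) = orb (s (b + j))" using assms(1) by (auto simp: tail_equiv_def)
  obtain c d where cd: "\<And>j. orb (s (c + j)) = orb (t (d + j))" using assms(2) by (auto simp: tail_equiv_def)
  have "orb (r ((a + c) + j)) = orb (t ((d + b) + j))" for j
    using ab[of "c + j"] cd[of "b + j"] by (simp add: add_ac)
  then show ?thesis unfolding tail_equiv_def by blast
qed

text \<open>Two rays that meet beyond \<open>depth\<close> stay together from there on by \<open>forward_sync\<close>.\<close>

lemma finite_meetings:
  assumes r: "r \<in> R" and s: "s \<in> R" and ne: "\<not> tail_equiv r s"
  shows "finite {n. \<exists>m. orb (s m) = orb (r n)}"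
proof (rule finite_subset)
  show "{n. \<exists>m. orb (s m) = orb (r n)} \<subseteq> {n. orb (r n) \<in> (\<lambda>m. orb (s m)) ` {..<depth}} \<union> {..<depth}"
  proof (intro subsetI, elim CollectE exE)
    fix n m assume mn: "orb (s m) = orb (r n)"
    have "m < depth \<or> n < depth"
    proof (rule ccontr)
      assume "\<not> (m < depth \<or> n < depth)"
      then have d: "depth \<le> n" "depth \<le> m" by auto
      obtain g where g: "g \<in> carrier \<Gamma>" "\<psi> g (s m) = r n"
        using mn orb_eq_iff[OF R_arcs[OF s] R_arcs[OF r]] by blast
      have "\<psi> g (s (m + j)) = r (n + j)" for j
        by (rule forward_sync[OF depthD(1)[OF r] d(1) R_rays[OF s] depthD(2)[OF s] d(2) g])
      then have "orb (r (n + j)) = orb (s (m + j))" for j using orb_act[OF g(1) R_arcs[OF s]] by metis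
      then show False using ne unfolding tail_equiv_def by blast
    qed
    then show "n \<in> {n. orb (r n) \<in> (\<lambda>m. orb (s m)) ` {..<depth}} \<union> {..<depth}"
      using mn by (metis (mono_tags, lifting) UnCI imageI lessThan_iff mem_Collect_eq)
  qed
qed (simp add: finite_hits[OF r])

text \<open>If \<open>s m\<close> is carried to the reverse of \<open>r n\<close>, then \<open>s\<close> runs inward along \<open>r\<close> and reaches the reverse of
\<open>r depth\<close> after \<open>n - depth\<close> more steps. Beyond \<open>depth\<close> the edges of \<open>s\<close> have distinct orbits, so \<open>m + n\<close> is the same for all large
\<open>n\<close>, which bounds \<open>n\<close>.\<close>

lemma finite_reversals:
  assumes r: "r \<in> R" and s: "s \<in> R"
  shows "finite {n. \<exists>m. orb (s m) = orb (arev (r n))}"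
proof -
  have retreat: "orb (s (m + i)) = orb (arev (r (depth + d - i)))"
    if "orb (s m) = orb (arev (r (depth + d)))" "i \<le> d" for m d i
    using that(2)
  proof (induction i)
    case (Suc i)
    have "orb (s (Suc (m + i))) = orb (arev (r (depth + d - i - 1)))"
      by (rule backward_step[OF depthD(1)[OF r] _ R_rays[OF s]]) (use Suc in auto)
    then show ?case by simp
  qed (use that in simp)
  define B where "B = {n. \<exists>m. orb (s m) = orb (arev (r n))}"
  have sum_const: "m + n = m' + n'"
    if "orb (s m) = orb (arev (r n))" "orb (s m') = orb (arev (r n'))" "n > 2 * depth" "n' > 2 * depth" for m n m' n'
  proof -
    have *: "orb (s (m + (n - depth))) = orb (arev (r depth))" if "orb (s m) = orb (arev (r n))" "n > 2 * depth" for m n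
      using retreat[of m "n - depth" "n - depth"] that by simp
    have "m + (n - depth) = m' + (n' - depth)"
      using *[OF that(1,3)] *[OF that(2,4)] depthD(3)[OF s] that(3,4) by (auto simp: inj_on_def)
    then show ?thesis using that(3,4) by simp
  qed
  show ?thesis
  proof (cases "\<exists>n\<in>B. n > 2 * depth")
    case True
    then obtain n m where n: "n > 2 * depth" "orb (s m) = orb (arev (r n))" by (auto simp: B_def)
    have "B \<subseteq> {..m + n + 2 * depth}"
    proof
      fix n' assume "n' \<in> B"
      then obtain m' where m': "orb (s m') = orb (arev (r n'))" by (auto simp: B_def)
      show "n' \<in> {..m + n + 2 * depth}"
        using sum_const[OF n(2) m' n(1)] by (cases "n' > 2 * depth") auto
    qed
    then show ?thesis unfolding B_def[symmetric] by (rule finite_subset) simp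
  next
    case False
    then have "B \<subseteq> {..2 * depth}" by (auto simp: not_less)
    then show ?thesis unfolding B_def[symmetric] by (rule finite_subset) simp
  qed
qed

lemma eventually_not_finite: "finite {n. P n} \<Longrightarrow> eventually (\<lambda>n. \<not> P n) sequentially"
  by (simp add: eventually_cofinite flip: cofinite_eq_sequentially)

lemma eventually_distinct:
  "r \<in> R \<Longrightarrow> eventually (\<lambda>n. \<forall>m. orb (r m) = orb (r n) \<longrightarrow> m = n) sequentially"
  using eventually_not_finite[OF finite_repeats[of r]] by (auto elim: eventually_mono)

lemma eventually_no_meeting:
  "r \<in> R \<Longrightarrow> s \<in> R \<Longrightarrow> \<not> tail_equiv r s \<Longrightarrow> eventually (\<lambda>n. \<forall>m. orb (s m) \<noteq> orb (r n)) sequentially"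
  using eventually_not_finite[OF finite_meetings[of r s]] by (auto elim: eventually_mono)

lemma eventually_no_reversal:
  assumes "r \<in> R"
  shows "eventually (\<lambda>n. \<forall>s\<in>R. \<forall>m. orb (s m) \<noteq> orb (arev (r n))) sequentially"
  using eventually_not_finite[OF finite_reversals[OF assms]]
  by (intro eventually_ball_finite[OF finite_R]) (auto elim: eventually_mono)

lemma eventually_shift: "eventually P sequentially \<Longrightarrow> eventually (\<lambda>n. P (b + n - a)) sequentially"
proof -
  assume "eventually P sequentially"
  then obtain N where "\<forall>n\<ge>N. P n" by (auto simp: eventually_sequentially)
  then have "\<forall>n\<ge>N + a. P (b + n - a)" by simp
  then show ?thesis unfolding eventually_sequentially by blast
qed

lemma eventually_pred: "eventually P sequentially \<Longrightarrow> eventually (\<lambda>n. P (n - 1)) sequentially"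
  using eventually_shift[of P 0 1] by simp

text \<open>Let \<open>f\<close> start at the origin of \<open>r n\<close>. If it lies in the orbit of \<open>s m\<close>, it begins a ray and
\<open>branching_step\<close> applies. If it lies in the orbit of the reverse of \<open>s m\<close>, the same applies to the next edge of \<open>s\<close>; as inward
edges of \<open>r\<close> are excluded, that edge lies in the orbit of \<open>r n\<close>, and then \<open>s m\<close> lies in the orbit of \<open>r (n - 1)\<close>.\<close>

lemma eventually_ray_neighbours:
  assumes r: "r \<in> R" and s: "s \<in> R"
  shows "eventually (\<lambda>n. \<forall>f\<in>arcs Y. \<forall>m. tail Y f = tail Y (r n) \<longrightarrow> orb f = orb (s m) \<or> orb f = orb (arev (s m)) \<longrightarrow>
    f = r n \<or> orb f = orb (arev (r (n - 1)))) sequentially"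
proof -
  have ev: "eventually (\<lambda>n. n > depth \<and> (\<forall>m. orb (s m) \<noteq> orb (arev (r (n - 1)))) \<and>
      (\<forall>m. orb (s (Suc m)) = orb (r n) \<longrightarrow> orb (s m) = orb (r (n - 1)))) sequentially"
  proof (intro eventually_conj)
    show "eventually (\<lambda>n. n > depth) sequentially" by (rule eventually_gt_at_top)
    show "eventually (\<lambda>n. \<forall>m. orb (s m) \<noteq> orb (arev (r (n - 1)))) sequentially"
      using eventually_pred[OF eventually_no_reversal[OF r]] s by (auto elim: eventually_mono)
    show "eventually (\<lambda>n. \<forall>m. orb (s (Suc m)) = orb (r n) \<longrightarrow> orb (s m) = orb (r (n - 1))) sequentially"
    proof (cases "tail_equiv r s")
      case False
      then show ?thesis using eventually_no_meeting[OF r s] by (auto elim: eventually_mono)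
    next
      case True
      then obtain a b where ab: "\<And>j. orb (r (a + j)) = orb (s (b + j))" by (auto simp: tail_equiv_def)
      show ?thesis
        using eventually_conj[OF eventually_gt_at_top[of a] eventually_shift[OF eventually_distinct[OF s], of b a]]
      proof (rule eventually_mono)
        fix n assume n: "a < n \<and> (\<forall>m. orb (s m) = orb (s (b + n - a)) \<longrightarrow> m = b + n - a)"
        have "orb (r n) = orb (s (b + n - a))" using ab[of "n - a"] n by simp
        moreover have "orb (r (n - 1)) = orb (s (b + (n - 1 - a)))" using ab[of "n - 1 - a"] n by simp
        moreover have "b + (n - 1 - a) = m" if "Suc m = b + n - a" for m using that n by simp
        ultimately show "\<forall>m. orb (s (Suc m)) = orb (r n) \<longrightarrow> orb (s m) = orb (r (n - 1))" using n by metis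
      qed
    qed
  qed
  then show ?thesis
  proof (rule eventually_mono, intro ballI allI impI)
    fix n f m
    assume n: "n > depth \<and> (\<forall>m. orb (s m) \<noteq> orb (arev (r (n - 1)))) \<and>
        (\<forall>m. orb (s (Suc m)) = orb (r n) \<longrightarrow> orb (s m) = orb (r (n - 1)))"
      and f: "f \<in> arcs Y" "tail Y f = tail Y (r n)" and "orb f = orb (s m) \<or> orb f = orb (arev (s m))"
    then consider "orb (s m) = orb f" | "orb (arev (s m)) = orb f" by metis
    then show "f = r n \<or> orb f = orb (arev (r (n - 1)))"
    proof cases
      case 1
      then obtain g where g: "g \<in> carrier \<Gamma>" "\<psi> g (s m) = f" using orb_eq_iff[OF R_arcs[OF s] f(1)] by blast
      then have "\<phi> g (tail Y (s m)) = tail Y (r n)" using act_arc(2)[OF g(1) R_arcs[OF s]] f by metis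
      then have "\<psi> g (s m) = r n \<or> orb (s m) = orb (arev (r (n - 1)))"
        using branching_step[OF depthD(1)[OF r] _ R_rays[OF s] g(1)] n by blast
      then show ?thesis using g 1 by simp
    next
      case 2
      then obtain g where g: "g \<in> carrier \<Gamma>" "\<psi> g (arev (s m)) = f"
        using orb_eq_iff[of "arev (s m)" f] R_arcs[OF s] f(1) by auto
      have "\<phi> g (tail Y (s (Suc m))) = tail Y (\<psi> g (arev (s m)))"
        using raysD(2)[OF R_rays[OF s], of m] act_arc(2)[OF g(1), of "arev (s m)"] R_arcs[OF s] by simp
      then have "\<phi> g (tail Y (s (Suc m))) = tail Y (r n)" using g f by simp
      then have "\<psi> g (s (Suc m)) = r n \<or> orb (s (Suc m)) = orb (arev (r (n - 1)))"
        using branching_step[OF depthD(1)[OF r] _ R_rays[OF s] g(1)] n by blast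
      then have "orb (s (Suc m)) = orb (r n)" using n orb_act[OF g(1) R_arcs[OF s]] by metis
      then have "orb (s m) = orb (r (n - 1))" using n by blast
      then have "orb (arev (s m)) = orb (arev (r (n - 1)))" by (rule orb_arev_cong[OF R_arcs[OF s] R_arcs[OF r]])
      then show ?thesis using 2 by simp
    qed
  qed
qed

text \<open>Edges in the same orbit starting at the origins of \<open>r n\<close> and \<open>r n'\<close> identify these two vertices, which for
large \<open>n\<close> and \<open>n'\<close> forces \<open>n = n'\<close>. So the finite set \<open>FA\<close> serves only finitely many \<open>n\<close>.\<close>

lemma finite_core_neighbours:
  assumes r: "r \<in> R"
  shows "finite {n. \<exists>f\<in>arcs Y. tail Y f = tail Y (r n) \<and> orb f \<in> FA}"
proof -
  define B where "B = {n. \<exists>f\<in>arcs Y. tail Y f = tail Y (r n) \<and> orb f \<in> FA}"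
  obtain N where "\<forall>n\<ge>N. \<forall>s\<in>R. \<forall>m. orb (s m) \<noteq> orb (arev (r n))"
    using eventually_no_reversal[OF r] unfolding eventually_sequentially by (elim exE)
  note N = this[rule_format]
  define M where "M = Suc (max N depth)"
  have "\<forall>n\<in>B. \<exists>f. f \<in> arcs Y \<and> tail Y f = tail Y (r n) \<and> orb f \<in> FA" by (auto simp: B_def)
  from bchoice[OF this] obtain f where "\<forall>n\<in>B. f n \<in> arcs Y \<and> tail Y (f n) = tail Y (r n) \<and> orb (f n) \<in> FA"
    by (elim exE)
  note f = this[rule_format]
  have "inj_on (\<lambda>n. orb (f n)) (B \<inter> {M..})"
  proof (rule inj_onI)
    fix n n' assume n: "n \<in> B \<inter> {M..}" "n' \<in> B \<inter> {M..}" and eq: "orb (f n) = orb (f n')"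
    obtain g where g: "g \<in> carrier \<Gamma>" "\<psi> g (f n) = f n'" using eq orb_eq_iff f n by blast
    have "\<phi> g (tail Y (f n)) = tail Y (f n')" using act_arc(2)[OF g(1), of "f n"] f[of n] n g(2) by simp
    then have "\<phi> g (tail Y (r n)) = tail Y (r n')" using f[of n] f[of n'] n by simp
    moreover have "n' > depth" using n by (auto simp: M_def)
    ultimately have "\<psi> g (r n) = r n' \<or> orb (r n) = orb (arev (r (n' - 1)))"
      using branching_step[OF depthD(1)[OF r] _ R_rays[OF r] g(1)] by blast
    moreover have "orb (r n) \<noteq> orb (arev (r (n' - 1)))" using N[OF _ r] n by (auto simp: M_def)
    ultimately have "orb (r n) = orb (r n')" using orb_act[OF g(1) R_arcs[OF r]] by metis
    then show "n = n'" using depthD(3)[OF r] n by (auto simp: inj_on_def M_def)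
  qed
  moreover have "finite ((\<lambda>n. orb (f n)) ` (B \<inter> {M..}))" by (rule finite_subset[OF _ finite_FA]) (use f in auto)
  ultimately have "finite (B \<inter> {M..})" by (rule finite_imageD[rotated])
  moreover have "B \<subseteq> (B \<inter> {M..}) \<union> {..<M}" by auto
  ultimately show ?thesis unfolding B_def[symmetric] by (meson finite_UnI finite_lessThan finite_subset)
qed

lemma eventually_neighbours:
  assumes r: "r \<in> R"
  shows "eventually (\<lambda>n. \<forall>f\<in>arcs Y. tail Y f = tail Y (r n) \<longrightarrow>
    f = r n \<or> orb f = orb (arev (r (n - 1)))) sequentially"
proof -
  have "eventually (\<lambda>n. \<forall>s\<in>R. \<forall>f\<in>arcs Y. \<forall>m. tail Y f = tail Y (r n) \<longrightarrow> orb f = orb (s m) \<or> orb f = orb (arev (s m)) \<longrightarrow>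
    f = r n \<or> orb f = orb (arev (r (n - 1)))) sequentially"
    using eventually_ray_neighbours[OF r] by (intro eventually_ball_finite[OF finite_R]) blast
  from eventually_conj[OF this eventually_not_finite[OF finite_core_neighbours[OF r]]]
  show ?thesis
  proof (rule eventually_mono, intro ballI impI)
    fix n f
    assume n: "(\<forall>s\<in>R. \<forall>f\<in>arcs Y. \<forall>m. tail Y f = tail Y (r n) \<longrightarrow> orb f = orb (s m) \<or> orb f = orb (arev (s m)) \<longrightarrow>
        f = r n \<or> orb f = orb (arev (r (n - 1)))) \<and> \<not> (\<exists>f\<in>arcs Y. tail Y f = tail Y (r n) \<and> orb f \<in> FA)"
      and f: "f \<in> arcs Y" "tail Y f = tail Y (r n)"
    have "orb f \<notin> FA" using n f by blast
    then obtain s m where "s \<in> R" "orb f = orb (s m) \<or> orb f = orb (arev (s m))" using cover[OF f(1)] by blast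
    then show "f = r n \<or> orb f = orb (arev (r (n - 1)))" using n f by blast
  qed
qed

end

section \<open>Weights on the quotient\<close>

context tree_lattice
begin

abbreviation "X \<equiv> quotient_graph \<Gamma> Y \<phi> \<psi>"
abbreviation "Xrev \<equiv> quotient_arev \<Gamma> Y arev \<psi>"
abbreviation "wt \<equiv> quotient_weight \<Gamma> Y \<phi> \<psi>"

lemma arcs_X: "arcs X = orb ` arcs Y"
  by (auto simp: quotient_graph_def orbits_def)

lemma Xrev_orb: assumes "e \<in> arcs Y" shows "Xrev (orb e) = orb (arev e)"
proof -
  have "orb e \<in> orbits \<Gamma> (arcs Y) \<psi>" using assms by (auto simp: orbits_def)
  moreover have "arev ` orb e = orb (arev e)"
    using assms act_arc(3) by (force simp: Group_Action.orbit_def image_iff)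
  ultimately show ?thesis by (simp add: quotient_arev_def)
qed

lemma tail_X: assumes "e \<in> arcs Y" shows "tail X (orb e) = {\<phi> g (tail Y e) | g. g \<in> carrier \<Gamma>}"
  using assms act_arc(2) by (force simp: quotient_graph_def Group_Action.orbit_def image_iff)

lemma head_X: assumes "e \<in> arcs Y" shows "head X (orb e) = {\<phi> g (head Y e) | g. g \<in> carrier \<Gamma>}"
  using assms act_arc(4) by (force simp: quotient_graph_def Group_Action.orbit_def image_iff)

lemma orb_subset: "e \<in> arcs Y \<Longrightarrow> orb e \<subseteq> arcs Y"
  using act_arc(1) by (auto simp: Group_Action.orbit_def)

lemma orb_mem_eq:
  assumes "e \<in> arcs Y" "e' \<in> orb e"
  shows "orb e' = orb e"
proof -
  obtain g where "g \<in> carrier \<Gamma>" "e' = \<psi> g e" using assms(2) by (auto simp: Group_Action.orbit_def)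
  then show ?thesis using orb_act[OF _ assms(1)] by simp
qed

lemma orb_self: "e \<in> arcs Y \<Longrightarrow> e \<in> orb e"
  by (rule edge.orbit_refl)

text \<open>Composability in the quotient can be tested in the tree with a fixed representative of the first edge.\<close>

lemma composable_iff:
  assumes e: "e \<in> arcs Y" and E: "E \<in> arcs X"
  shows "head X (orb e) = tail X E \<longleftrightarrow> (\<exists>e'\<in>arcs Y. E = orb e' \<and> tail Y e' = head Y e)"
proof
  assume eq: "head X (orb e) = tail X E"
  obtain d where d: "d \<in> arcs Y" "E = orb d" using E by (auto simp: arcs_X)
  have "head Y e \<in> head X (orb e)" using orb_self[OF e] by (auto simp: quotient_graph_def)
  then obtain g where g: "g \<in> carrier \<Gamma>" "head Y e = \<phi> g (tail Y d)" using eq tail_X[OF d(1)] d(2) by auto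
  then show "\<exists>e'\<in>arcs Y. E = orb e' \<and> tail Y e' = head Y e"
    using act_arc[OF g(1) d(1)] orb_act[OF g(1) d(1)] d by (intro bexI[of _ "\<psi> g d"]) auto
next
  assume "\<exists>e'\<in>arcs Y. E = orb e' \<and> tail Y e' = head Y e"
  then show "head X (orb e) = tail X E" using head_X[OF e] tail_X by auto
qed

lemma composable_rev:
  assumes "E \<in> arcs X" "E' \<in> arcs X"
  shows "head X E = tail X E' \<longleftrightarrow> head X (Xrev E') = tail X (Xrev E)"
proof -
  interpret Q: bidirected_digraph X Xrev by (rule bidirected_quotient)
  show ?thesis using assms by auto
qed

lemma edge_weight_eq:
  assumes e: "e \<in> arcs Y"
  shows "edge_weight \<Gamma> Y \<phi> \<psi> e = card {e' \<in> orb e. tail Y e' = tail Y e}"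
proof -
  have "(\<lambda>g. \<psi> g e) ` stabilizer \<Gamma> \<phi> (tail Y e) = {e' \<in> orb e. tail Y e' = tail Y e}"
    using act_arc(2)[OF _ e] by (auto simp: stabilizer_def Group_Action.orbit_def image_iff)
  then show ?thesis by (simp add: edge_weight_def)
qed

text \<open>The weight counts the edges of the orbit at one vertex, and all vertices concerned are translates of each other.\<close>

lemma wt_eq:
  assumes e: "e \<in> arcs Y"
  shows "wt (orb e) = card {e' \<in> orb e. tail Y e' = tail Y e}"
proof -
  define d where "d = (SOME d. d \<in> orb e)"
  have d: "d \<in> orb e" unfolding d_def using orb_self[OF e] by (rule someI)
  have dY: "d \<in> arcs Y" using d orb_subset[OF e] by blast
  obtain g where g: "g \<in> carrier \<Gamma>" "d = \<psi> g e" using d by (auto simp: Group_Action.orbit_def)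
  have "bij_betw (\<psi> g) {e' \<in> orb e. tail Y e' = tail Y e} {e' \<in> orb e. tail Y e' = tail Y d}"
  proof (rule bij_betw_imageI)
    show "inj_on (\<psi> g) {e' \<in> orb e. tail Y e' = tail Y e}"
      using act_inj[OF g(1)] orb_subset[OF e] by (auto intro!: inj_onI)
    show "\<psi> g ` {e' \<in> orb e. tail Y e' = tail Y e} = {e' \<in> orb e. tail Y e' = tail Y d}"
    proof (intro equalityI subsetI)
      fix x assume "x \<in> \<psi> g ` {e' \<in> orb e. tail Y e' = tail Y e}"
      then obtain e' where e': "e' \<in> orb e" "tail Y e' = tail Y e" "x = \<psi> g e'" by blast
      have "e' \<in> arcs Y" using e' orb_subset[OF e] by blast
      then have "x \<in> orb e" using orb_act[OF g(1)] orb_mem_eq[OF e e'(1)] orb_self act_arc(1)[OF g(1)] e'(3) by metis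
      then show "x \<in> {e' \<in> orb e. tail Y e' = tail Y d}"
        using act_arc(2)[OF g(1) \<open>e' \<in> arcs Y\<close>] act_arc(2)[OF g(1) e] e' g by simp
    next
      fix x assume x: "x \<in> {e' \<in> orb e. tail Y e' = tail Y d}"
      then have xY: "x \<in> arcs Y" using orb_subset[OF e] by blast
      have ig: "inv\<^bsub>\<Gamma>\<^esub> g \<in> carrier \<Gamma>" "\<psi> g (\<psi> (inv\<^bsub>\<Gamma>\<^esub> g) x) = x" "\<psi> (inv\<^bsub>\<Gamma>\<^esub> g) d = e"
        using act_inv[OF g(1)] xY e g(2) by auto
      have "\<psi> (inv\<^bsub>\<Gamma>\<^esub> g) x \<in> orb e"
        using orb_act[OF ig(1) xY] orb_mem_eq[OF e, of x] x orb_self[OF act_arc(1)[OF ig(1) xY]] by simp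
      moreover have "tail Y (\<psi> (inv\<^bsub>\<Gamma>\<^esub> g) x) = tail Y e"
        using act_arc(2)[OF ig(1) xY] act_arc(2)[OF ig(1) dY] x ig(3) by simp
      ultimately show "x \<in> \<psi> g ` {e' \<in> orb e. tail Y e' = tail Y e}" using ig(2) by (metis (mono_tags, lifting) image_eqI mem_Collect_eq)
    qed
  qed
  then have "card {e' \<in> orb e. tail Y e' = tail Y e} = card {e' \<in> orb e. tail Y e' = tail Y d}"
    by (rule bij_betw_same_card)
  then show ?thesis
    unfolding quotient_weight_def d_def[symmetric] edge_weight_eq[OF dY] orb_mem_eq[OF e d] by simp
qed

lemma finite_out: "v \<in> verts Y \<Longrightarrow> finite (out_arcs Y v)"
  using locally_finite by (simp add: locally_finite_def)

lemma wt_pos: assumes e: "e \<in> arcs Y" shows "wt (orb e) \<ge> 1"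
proof -
  have "finite {e' \<in> orb e. tail Y e' = tail Y e}"
    by (rule finite_subset[OF _ finite_out[OF tail_in_verts[OF e]]]) (use orb_subset[OF e] in auto)
  moreover have "e \<in> {e' \<in> orb e. tail Y e' = tail Y e}" using orb_self[OF e] by simp
  ultimately have "card {e' \<in> orb e. tail Y e' = tail Y e} > 0" by (subst card_gt_0_iff) blast
  then show ?thesis unfolding wt_eq[OF e] by simp
qed

text \<open>The step weights, extended by \<open>0\<close> to pairs of edges that are not composable, so that words of edges that are
not closed paths have weight \<open>0\<close>.\<close>

definition transition :: "'e set \<Rightarrow> 'e set \<Rightarrow> real" where
  "transition E E' = (if head X E = tail X E' then of_int (step_weight wt Xrev E E') else 0)"

lemma transition_nonneg:
  assumes "E' \<in> arcs X"
  shows "0 \<le> transition E E'"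
proof -
  have "wt E' \<ge> 1" using assms wt_pos by (auto simp: arcs_X)
  then show ?thesis by (auto simp: transition_def step_weight_def)
qed

text \<open>The edges at the terminus of \<open>e\<close> are distributed over the orbits that can follow \<open>orb e\<close>, and \<open>wt\<close> counts the share of each.\<close>

lemma transition_row:
  assumes e: "e \<in> arcs Y" and T: "finite T" "T \<subseteq> arcs X"
  shows "(\<Sum>E\<in>T. transition (orb e) E) \<le> out_degree Y (head Y e)"
proof -
  let ?A = "\<lambda>E. {e' \<in> E. tail Y e' = head Y e}"
  have fin: "finite (out_arcs Y (head Y e))" using finite_out head_in_verts[OF e] by blast
  have orbE: "\<exists>d\<in>arcs Y. E = orb d" if "E \<in> T" for E
    using that T(2) by (auto simp: arcs_X)
  have sub: "?A E \<subseteq> out_arcs Y (head Y e)" if E: "E \<in> T" for E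
  proof -
    obtain d where "d \<in> arcs Y" "E = orb d" using orbE[OF E] by blast
    then have "E \<subseteq> arcs Y" using orb_subset by simp
    then show ?thesis by auto
  qed
  have "transition (orb e) E \<le> card (?A E)" if E: "E \<in> T" for E
  proof (cases "head X (orb e) = tail X E")
    case True
    then obtain e' where e': "e' \<in> arcs Y" "E = orb e'" "tail Y e' = head Y e"
      using composable_iff[OF e, of E] True E T(2) by blast
    then have "wt E = card (?A E)" using wt_eq[OF e'(1)] by simp
    moreover have "transition (orb e) E \<le> wt E" by (auto simp: transition_def step_weight_def)
    ultimately show ?thesis by simp
  qed (simp add: transition_def)
  then have "(\<Sum>E\<in>T. transition (orb e) E) \<le> (\<Sum>E\<in>T. real (card (?A E)))" by (rule sum_mono)
  also have "\<dots> = real (\<Sum>E\<in>T. card (?A E))" by simp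
  also have "(\<Sum>E\<in>T. card (?A E)) = card (\<Union>E\<in>T. ?A E)"
  proof (rule card_UN_disjoint[symmetric, OF T(1)])
    show "\<forall>E\<in>T. finite (?A E)" using sub fin finite_subset by blast
    show "\<forall>E\<in>T. \<forall>E'\<in>T. E \<noteq> E' \<longrightarrow> ?A E \<inter> ?A E' = {}"
    proof (intro ballI impI)
      fix E E' assume EE: "E \<in> T" "E' \<in> T" "E \<noteq> E'"
      obtain d d' where d: "d \<in> arcs Y" "E = orb d" "d' \<in> arcs Y" "E' = orb d'"
        using orbE[OF EE(1)] orbE[OF EE(2)] by blast
      have "x \<notin> E'" if "x \<in> E" for x
        using that EE(3) orb_mem_eq[OF d(1), of x] orb_mem_eq[OF d(3), of x] unfolding d by blast
      then have "E \<inter> E' = {}" by blast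
      then show "?A E \<inter> ?A E' = {}" by blast
    qed
  qed
  also have "card (\<Union>E\<in>T. ?A E) \<le> card (out_arcs Y (head Y e))"
    using sub by (intro card_mono[OF fin]) blast
  finally show ?thesis by (simp add: out_degree_def)
qed

text \<open>Uniformity leaves finitely many classes of vertices under the automorphism group, which preserves valencies.\<close>

lemma bounded_degree: "\<exists>D. \<forall>v\<in>verts Y. out_degree Y v \<le> D"
proof -
  let ?O = "\<lambda>v. (\<lambda>a. fst a v) ` graph_auts Y arev"
  have fin: "finite (?O ` verts Y)" using uniform by (simp add: uniform_graph_def)
  have one: "\<one>\<^bsub>\<Gamma>\<^esub> \<in> carrier \<Gamma>" using group_Gamma by (simp add: group.is_monoid monoid.one_closed)
  have deg: "out_degree Y (f v) = out_degree Y v" if a: "(f, h) \<in> graph_auts Y arev" and v: "v \<in> verts Y" for f h v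
  proof -
    have f: "bij_betw f (verts Y) (verts Y)" and h: "bij_betw h (arcs Y) (arcs Y)"
      and t: "\<And>e. e \<in> arcs Y \<Longrightarrow> tail Y (h e) = f (tail Y e)"
      using a by (auto simp: graph_auts_def Bij_def)
    have "h ` out_arcs Y v = out_arcs Y (f v)"
    proof (intro equalityI subsetI)
      fix x assume x: "x \<in> out_arcs Y (f v)"
      then obtain e where e: "e \<in> arcs Y" "x = h e" using h by (auto simp: bij_betw_def image_iff)
      then have "f (tail Y e) = f v" using t x by simp
      then have "tail Y e = v" using f v e(1) tail_in_verts by (auto simp: bij_betw_def inj_on_def)
      then show "x \<in> h ` out_arcs Y v" using e by auto
    qed (use h t in \<open>auto simp: bij_betw_def\<close>)
    moreover have "inj_on h (out_arcs Y v)" using h by (auto simp: bij_betw_def inj_on_def)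
    ultimately show ?thesis unfolding out_degree_def by (metis card_image)
  qed
  have same: "out_degree Y v = out_degree Y w" if vw: "v \<in> verts Y" "w \<in> verts Y" "?O v = ?O w" for v w
  proof -
    have "\<phi> \<one>\<^bsub>\<Gamma>\<^esub> v = v" using vert.id_eq_one vw(1) by (metis restrict_apply')
    then have "v \<in> ?O v" using act_auts[OF one] by (metis fst_conv image_eqI)
    then obtain a where "a \<in> graph_auts Y arev" "v = fst a w" using vw(3) by blast
    then show ?thesis using deg[of "fst a" "snd a" w] vw(2) by simp
  qed
  define rep where "rep S = (SOME v. v \<in> verts Y \<and> ?O v = S)" for S
  have rep: "rep (?O v) \<in> verts Y \<and> ?O (rep (?O v)) = ?O v" if "v \<in> verts Y" for v
    unfolding rep_def by (rule someI[of _ v]) (use that in simp)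
  have "out_degree Y v \<le> (\<Sum>S\<in>?O ` verts Y. out_degree Y (rep S))" if v: "v \<in> verts Y" for v
  proof -
    have "out_degree Y v = out_degree Y (rep (?O v))" 
      by (rule same[OF v conjunct1[OF rep[OF v]] conjunct2[OF rep[OF v], symmetric]])
    also have "\<dots> \<le> (\<Sum>S\<in>?O ` verts Y. out_degree Y (rep S))"
      using v by (intro member_le_sum[OF _ _ fin]) auto
    finally show ?thesis .
  qed
  then show ?thesis by blast
qed

lemma cusp_periodic_degree:
  assumes c: "c \<in> Ends" "periodic_end Y c" "r \<in> c"
  shows "\<exists>p>0. \<exists>N. \<forall>n\<ge>N. out_degree Y (tail Y (r (n + p))) = out_degree Y (tail Y (r n))"
proof -
  obtain s p N where s: "s \<in> c" "p > 0" "\<And>n. n \<ge> N \<Longrightarrow> out_degree Y (tail Y (s (n + p))) = out_degree Y (tail Y (s n))"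
    using c(2) by (auto simp: periodic_end_def eventually_periodic_def)
  obtain a b where ab: "\<And>j. r (a + j) = s (b + j)" using end_cofinal[OF c(1,3) s(1)] by blast
  have "out_degree Y (tail Y (r (n + p))) = out_degree Y (tail Y (r n))" if "n \<ge> a + N" for n
    using ab[of "n - a"] ab[of "n - a + p"] s(3)[of "b + (n - a)"] that by (simp add: add_ac)
  then show ?thesis using s(2) by blast
qed

end

section \<open>The quotient as a finite core with cusps\<close>

text \<open>The outcome of the study of cusp rays. \<open>R\<close> now contains one ray for each cusp of the quotient. Beyond \<open>N\<close>, the
images of the rays are disjoint half-lines without further edges at their vertices, and the core is the finite rest.\<close>

locale cusp_decomposition = tree_lattice \<Gamma> Y arev \<phi> \<psi>
  for \<Gamma> :: "('g, 'm) monoid_scheme" and Y :: "('v, 'e) pre_digraph" and arev :: "'e \<Rightarrow> 'e"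
    and \<phi> :: "'g \<Rightarrow> 'v \<Rightarrow> 'v" and \<psi> :: "'g \<Rightarrow> 'e \<Rightarrow> 'e" +
  fixes core :: "'e set set" and R :: "(nat \<Rightarrow> 'e) set" and N :: nat
  assumes core_def: "core = arcs X - {orb (r n) | r n. r \<in> R \<and> n > N} - {orb (arev (r n)) | r n. r \<in> R \<and> n > N}"
    and finite_core: "finite core" and finite_R: "finite R"
    and rays_R: "\<And>r. r \<in> R \<Longrightarrow> r \<in> Rays"
    and periodic_R: "\<And>r. r \<in> R \<Longrightarrow> \<exists>p>0. \<exists>M. \<forall>n\<ge>M. out_degree Y (tail Y (r (n + p))) = out_degree Y (tail Y (r n))"
    and distinct_R: "\<And>r s m n. r \<in> R \<Longrightarrow> s \<in> R \<Longrightarrow> n \<ge> N \<Longrightarrow> orb (s m) = orb (r n) \<Longrightarrow> s = r \<and> m = n"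
    and no_reversal: "\<And>r s m n. r \<in> R \<Longrightarrow> s \<in> R \<Longrightarrow> n \<ge> N \<Longrightarrow> orb (s m) \<noteq> orb (arev (r n))"
    and neighbours: "\<And>r n f. r \<in> R \<Longrightarrow> n > N \<Longrightarrow> f \<in> arcs Y \<Longrightarrow> tail Y f = tail Y (r n) \<Longrightarrow>
        f = r n \<or> orb f = orb (arev (r (n - 1)))"
begin

lemma arc_R: "r \<in> R \<Longrightarrow> r n \<in> arcs Y" "r \<in> R \<Longrightarrow> arev (r n) \<in> arcs Y"
  using rays_R raysD(1) by auto

lemma orb_R_arcs: "r \<in> R \<Longrightarrow> orb (r n) \<in> arcs X" "r \<in> R \<Longrightarrow> orb (arev (r n)) \<in> arcs X"
  using arc_R by (auto simp: arcs_X)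

lemma up_eq_iff: "r \<in> R \<Longrightarrow> s \<in> R \<Longrightarrow> n \<ge> N \<Longrightarrow> orb (s m) = orb (r n) \<longleftrightarrow> s = r \<and> m = n"
  using distinct_R by blast

lemma down_eq_iff:
  assumes "r \<in> R" "s \<in> R" "n \<ge> N"
  shows "orb (arev (s m)) = orb (arev (r n)) \<longleftrightarrow> s = r \<and> m = n"
proof -
  have "orb (arev (s m)) = orb (arev (r n)) \<longleftrightarrow> orb (s m) = orb (r n)"
    using orb_arev_iff[of "s m" "arev (r n)"] arc_R assms by simp
  then show ?thesis using up_eq_iff[OF assms] by simp
qed

lemma down_ne_up:
  assumes "r \<in> R" "s \<in> R" "n \<ge> N"
  shows "orb (arev (s m)) \<noteq> orb (r n)"
proof
  assume "orb (arev (s m)) = orb (r n)"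
  then have "orb (s m) = orb (arev (r n))" using orb_arev_iff[of "s m" "r n"] arc_R assms by simp
  then show False using no_reversal[OF assms] by blast
qed

lemmas ray_arc_eqs = up_eq_iff down_eq_iff down_ne_up no_reversal

text \<open>By \<open>neighbours\<close>, the only edges of the quotient at the far end of \<open>orb (r n)\<close> are the next outward edge and
the reverse of \<open>orb (r n)\<close>.\<close>

lemma up_successors:
  assumes r: "r \<in> R" and n: "n \<ge> N" and E: "E \<in> arcs X"
  shows "head X (orb (r n)) = tail X E \<longleftrightarrow> E = orb (r (Suc n)) \<or> E = orb (arev (r n))"
proof -
  have h: "head Y (r n) = tail Y (r (Suc n))" using raysD(2)[OF rays_R[OF r]] .
  have "head X (orb (r n)) = tail X E \<longleftrightarrow> (\<exists>f\<in>arcs Y. E = orb f \<and> tail Y f = tail Y (r (Suc n)))"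
    using composable_iff[OF arc_R(1)[OF r] E] h by simp
  also have "\<dots> \<longleftrightarrow> E = orb (r (Suc n)) \<or> E = orb (arev (r n))"
  proof
    assume "\<exists>f\<in>arcs Y. E = orb f \<and> tail Y f = tail Y (r (Suc n))"
    then obtain f where f: "f \<in> arcs Y" "E = orb f" "tail Y f = tail Y (r (Suc n))" by blast
    then show "E = orb (r (Suc n)) \<or> E = orb (arev (r n))"
      using neighbours[OF r, of "Suc n" f] n by auto
  next
    assume "E = orb (r (Suc n)) \<or> E = orb (arev (r n))"
    then show "\<exists>f\<in>arcs Y. E = orb f \<and> tail Y f = tail Y (r (Suc n))"
    proof
      assume "E = orb (arev (r n))"
      moreover have "tail Y (arev (r n)) = tail Y (r (Suc n))" using h arc_R(1)[OF r] by simp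
      ultimately show ?thesis using arc_R(2)[OF r] by blast
    qed (use arc_R[OF r] in blast)
  qed
  finally show ?thesis .
qed

lemma down_successors:
  assumes r: "r \<in> R" and n: "n \<ge> N" and E: "E \<in> arcs X"
  shows "head X (orb (arev (r (Suc n)))) = tail X E \<longleftrightarrow> E = orb (r (Suc n)) \<or> E = orb (arev (r n))"
proof -
  interpret Q: bidirected_digraph X Xrev by (rule bidirected_quotient)
  have "head X (orb (arev (r (Suc n)))) = tail X (orb (r (Suc n)))"
    using Q.head_arev[OF orb_R_arcs(1)[OF r]] Xrev_orb[OF arc_R(1)[OF r]] by simp
  also have "tail X (orb (r (Suc n))) = head X (orb (r n))"
    using up_successors[OF r n orb_R_arcs(1)[OF r, of "Suc n"]] by simp
  finally show ?thesis using up_successors[OF r n E] by simp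
qed

lemma Xrev_eq_iff: "E \<in> arcs X \<Longrightarrow> e \<in> arcs Y \<Longrightarrow> Xrev E = orb e \<longleftrightarrow> E = orb (arev e)"
  using Xrev_orb orb_arev_iff by (auto simp: arcs_X)

lemma up_predecessors:
  assumes r: "r \<in> R" and n: "n \<ge> N" and E: "E \<in> arcs X"
  shows "head X E = tail X (orb (r (Suc n))) \<longleftrightarrow> E = orb (r n) \<or> E = orb (arev (r (Suc n)))"
proof -
  interpret Q: bidirected_digraph X Xrev by (rule bidirected_quotient)
  have "head X E = tail X (orb (r (Suc n))) \<longleftrightarrow> head X (orb (arev (r (Suc n)))) = tail X (Xrev E)"
    using composable_rev[OF E orb_R_arcs(1)[OF r, of "Suc n"]] Xrev_orb[OF arc_R(1)[OF r]] by simp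
  also have "\<dots> \<longleftrightarrow> Xrev E = orb (r (Suc n)) \<or> Xrev E = orb (arev (r n))"
    using down_successors[OF r n Q.arev_in_arcs[OF E]] .
  finally show ?thesis using Xrev_eq_iff[OF E] arc_R[OF r] by auto
qed

lemma down_predecessors:
  assumes r: "r \<in> R" and n: "n \<ge> N" and E: "E \<in> arcs X"
  shows "head X E = tail X (orb (arev (r n))) \<longleftrightarrow> E = orb (arev (r (Suc n))) \<or> E = orb (r n)"
proof -
  interpret Q: bidirected_digraph X Xrev by (rule bidirected_quotient)
  have "head X E = tail X (orb (arev (r n))) \<longleftrightarrow> head X (orb (r n)) = tail X (Xrev E)"
    using composable_rev[OF E orb_R_arcs(2)[OF r, of n]] Xrev_orb[OF arc_R(2)[OF r]] by simp
  also have "\<dots> \<longleftrightarrow> Xrev E = orb (r (Suc n)) \<or> Xrev E = orb (arev (r n))"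
    using up_successors[OF r n Q.arev_in_arcs[OF E]] .
  finally show ?thesis using Xrev_eq_iff[OF E] arc_R[OF r] by auto
qed

text \<open>Of the edges at the origin of \<open>r n\<close> only \<open>r n\<close> itself is in its orbit, since all others are in the orbit of
an inward edge.\<close>

lemma wt_up:
  assumes r: "r \<in> R" and n: "n > N"
  shows "wt (orb (r n)) = 1"
proof -
  have "{e \<in> orb (r n). tail Y e = tail Y (r n)} = {r n}"
  proof (intro equalityI subsetI)
    fix e assume e: "e \<in> {e \<in> orb (r n). tail Y e = tail Y (r n)}"
    then have eY: "e \<in> arcs Y" using orb_subset[OF arc_R(1)[OF r]] by blast
    have "orb e = orb (r n)" using orb_mem_eq[OF arc_R(1)[OF r]] e by blast
    moreover have "orb (r n) \<noteq> orb (arev (r (n - 1)))" using no_reversal[OF r r, of "n - 1" n] n by simp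
    ultimately show "e \<in> {r n}" using neighbours[OF r n eY] e by auto
  qed (use orb_self[OF arc_R(1)[OF r]] in auto)
  then show ?thesis using wt_eq[OF arc_R(1)[OF r, of n]] by simp
qed

text \<open>At the terminus of \<open>r n\<close>, all edges but the outward one are in the orbit of the reverse of \<open>r n\<close>.\<close>

lemma wt_down:
  assumes r: "r \<in> R" and n: "n \<ge> N"
  shows "real (wt (orb (arev (r n)))) = real (out_degree Y (tail Y (r (Suc n)))) - 1"
proof -
  let ?v = "tail Y (r (Suc n))"
  have t: "tail Y (arev (r n)) = ?v" using raysD(2)[OF rays_R[OF r]] arc_R(1)[OF r] by simp
  have "{e \<in> orb (arev (r n)). tail Y e = ?v} = out_arcs Y ?v - {r (Suc n)}"
  proof (intro equalityI subsetI)
    fix e assume e: "e \<in> {e \<in> orb (arev (r n)). tail Y e = ?v}"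
    have "e \<noteq> r (Suc n)"
      using e orb_mem_eq[OF arc_R(2)[OF r], of e n] no_reversal[OF r r n, of "Suc n"] by auto
    then show "e \<in> out_arcs Y ?v - {r (Suc n)}" using e orb_subset[OF arc_R(2)[OF r]] by auto
  next
    fix e assume e: "e \<in> out_arcs Y ?v - {r (Suc n)}"
    then have "orb e = orb (arev (r n))" using neighbours[OF r, of "Suc n" e] n by auto
    then have "e \<in> orb (arev (r n))" using orb_self[of e] e by auto
    then show "e \<in> {e \<in> orb (arev (r n)). tail Y e = ?v}" using e by auto
  qed
  then have "wt (orb (arev (r n))) = card (out_arcs Y ?v - {r (Suc n)})"
    using wt_eq[OF arc_R(2)[OF r, of n]] t by simp
  moreover have "finite (out_arcs Y ?v)" using finite_out raysD(4)[OF rays_R[OF r]] by blast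
  moreover have "r (Suc n) \<in> out_arcs Y ?v" using arc_R(1)[OF r] by simp
  ultimately have "wt (orb (arev (r n))) = card (out_arcs Y ?v) - 1" and "card (out_arcs Y ?v) > 0"
    by (simp_all add: card_gt_0_iff, blast)
  then show ?thesis unfolding out_degree_def by (simp add: of_nat_diff)
qed

text \<open>The level counts from the edge after \<open>r N\<close>; the edges \<open>orb (r N)\<close> and \<open>orb (arev (r N))\<close> belong to the core
and attach the cusp to it.\<close>

fun enc :: "('e set, nat \<Rightarrow> 'e) cusp_edge \<Rightarrow> 'e set" where
  "enc (Core E) = E"
| "enc (Up r n) = orb (r (Suc (N + n)))"
| "enc (Down r n) = orb (arev (r (Suc (N + n))))"

definition branch :: "(nat \<Rightarrow> 'e) \<Rightarrow> nat \<Rightarrow> real" where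
  "branch r n = real (out_degree Y (tail Y (r (Suc (N + n))))) - 1"

lemma core_iff: "E \<in> core \<longleftrightarrow> E \<in> arcs X \<and> (\<forall>r\<in>R. \<forall>n. E \<noteq> orb (r (Suc (N + n))) \<and> E \<noteq> orb (arev (r (Suc (N + n)))))"
proof (intro iffI conjI ballI allI)
  assume "E \<in> core"
  then show "E \<in> arcs X" by (simp add: core_def)
  fix r n assume "r \<in> R"
  moreover have "Suc (N + n) > N" by simp
  ultimately show "E \<noteq> orb (r (Suc (N + n)))" "E \<noteq> orb (arev (r (Suc (N + n))))"
    using \<open>E \<in> core\<close> unfolding core_def by blast+
next
  assume E: "E \<in> arcs X \<and> (\<forall>r\<in>R. \<forall>n. E \<noteq> orb (r (Suc (N + n))) \<and> E \<noteq> orb (arev (r (Suc (N + n)))))"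
  have "E \<noteq> orb (r n) \<and> E \<noteq> orb (arev (r n))" if "r \<in> R" "n > N" for r n
    using E that less_imp_Suc_add[OF that(2)] by auto
  then show "E \<in> core" using E unfolding core_def by blast
qed

lemma enc_bij: "bij_betw enc (cusp_edges core R) (arcs X)"
  unfolding bij_betw_def
proof
  show "inj_on enc (cusp_edges core R)"
  proof (rule inj_onI)
    fix x y assume "x \<in> cusp_edges core R" "y \<in> cusp_edges core R" "enc x = enc y"
    then show "x = y"
      by (cases x; cases y)
         (auto simp: cusp_edges_def core_iff ray_arc_eqs no_reversal[symmetric] down_ne_up[symmetric])
  qed
  show "enc ` cusp_edges core R = arcs X"
  proof (intro equalityI subsetI)
    fix E assume E: "E \<in> arcs X"
    show "E \<in> enc ` cusp_edges core R"
    proof (cases "E \<in> core")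
      case True
      then show ?thesis by (intro image_eqI[of _ _ "Core E"]) (auto simp: cusp_edges_def)
    next
      case False
      then obtain r n where "r \<in> R" "E = enc (Up r n) \<or> E = enc (Down r n)" using E unfolding core_iff by auto
      moreover have "Up r n \<in> cusp_edges core R" "Down r n \<in> cusp_edges core R"
        using \<open>r \<in> R\<close> by (auto simp: cusp_edges_def)
      ultimately show ?thesis by blast
    qed
  qed (auto simp: cusp_edges_def core_iff orb_R_arcs)
qed

definition attach_up :: "(nat \<Rightarrow> 'e) \<Rightarrow> 'e set" where "attach_up r = orb (r N)"
definition attach_down :: "(nat \<Rightarrow> 'e) \<Rightarrow> 'e set" where "attach_down r = orb (arev (r N))"

lemma attach_core: "r \<in> R \<Longrightarrow> attach_up r \<in> core \<and> attach_down r \<in> core"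
  by (auto simp: core_iff attach_up_def attach_down_def orb_R_arcs ray_arc_eqs no_reversal[symmetric] down_ne_up[symmetric])

abbreviation "cusp_K \<equiv> cusp_kernel transition attach_up attach_down branch"

lemma transition_eq:
  "transition E E' = (if head X E = tail X E' then if E' = Xrev E then real (wt E') - 1 else real (wt E') else 0)"
  by (simp add: transition_def step_weight_def)

lemma core_ne:
  assumes "E \<in> core" "r \<in> R"
  shows "E \<noteq> orb (r (Suc (N + n)))" "E \<noteq> orb (arev (r (Suc (N + n))))"
    "E = orb (r (N + n)) \<longleftrightarrow> n = 0 \<and> E = attach_up r" "E = orb (arev (r (N + n))) \<longleftrightarrow> n = 0 \<and> E = attach_down r"
proof -
  show up: "E \<noteq> orb (r (Suc (N + n)))" and down: "E \<noteq> orb (arev (r (Suc (N + n))))" for n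
    using assms by (simp_all add: core_iff)
  show "E = orb (r (N + n)) \<longleftrightarrow> n = 0 \<and> E = attach_up r"
    using up[of "n - 1"] by (cases n) (simp_all add: attach_up_def)
  show "E = orb (arev (r (N + n))) \<longleftrightarrow> n = 0 \<and> E = attach_down r"
    using down[of "n - 1"] by (cases n) (simp_all add: attach_down_def)
qed

lemma wt_up': "r \<in> R \<Longrightarrow> wt (orb (r (Suc (N + n)))) = 1"
  by (rule wt_up) auto

lemma wt_down': "r \<in> R \<Longrightarrow> real (wt (orb (arev (r (N + n))))) = real (out_degree Y (tail Y (r (Suc (N + n))))) - 1"
  by (rule wt_down) auto

lemma transition_from_core_up:
  assumes E: "E \<in> core" and s: "s \<in> R"
  shows "transition E (orb (s (Suc (N + k)))) = of_bool (k = 0 \<and> E = attach_up s)"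
proof -
  have EX: "E \<in> arcs X" using E by (simp add: core_iff)
  have 1: "head X E = tail X (orb (s (Suc (N + k)))) \<longleftrightarrow> k = 0 \<and> E = attach_up s"
    using up_predecessors[OF s _ EX, of "N + k"] core_ne[OF E s] by simp
  have 2: "orb (s (Suc (N + k))) \<noteq> Xrev (attach_up s)"
    unfolding attach_up_def Xrev_orb[OF arc_R(1)[OF s]] by (rule no_reversal[OF s s]) simp
  show ?thesis unfolding transition_eq 1 using 2 wt_up'[OF s, of k] by (cases "k = 0 \<and> E = attach_up s") auto
qed

lemma transition_from_core_down:
  assumes E: "E \<in> core" and s: "s \<in> R"
  shows "transition E (orb (arev (s (Suc (N + k))))) = 0"
proof -
  have EX: "E \<in> arcs X" using E by (simp add: core_iff)
  have "head X E \<noteq> tail X (orb (arev (s (Suc (N + k)))))"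
    using down_predecessors[OF s _ EX, of "Suc (N + k)"] core_ne[OF E s] core_ne(2)[OF E s, of "Suc k"] by simp
  then show ?thesis by (simp add: transition_eq)
qed

lemma transition_from_up:
  assumes r: "r \<in> R" and E: "E \<in> arcs X"
  shows "transition (orb (r (Suc (N + n)))) E =
    of_bool (E = orb (r (Suc (Suc (N + n))))) + of_bool (E = orb (arev (r (Suc (N + n))))) * (branch r (Suc n) - 1)"
proof -
  have 1: "head X (orb (r (Suc (N + n)))) = tail X E \<longleftrightarrow>
      E = orb (r (Suc (Suc (N + n)))) \<or> E = orb (arev (r (Suc (N + n))))"
    by (rule up_successors[OF r _ E]) simp
  have 2: "Xrev (orb (r (Suc (N + n)))) = orb (arev (r (Suc (N + n))))" by (rule Xrev_orb[OF arc_R(1)[OF r]])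
  have 3: "orb (r (Suc (Suc (N + n)))) \<noteq> orb (arev (r (Suc (N + n))))" by (rule no_reversal[OF r r]) simp
  have 4: "real (wt (orb (arev (r (Suc (N + n)))))) = branch r (Suc n)"
    using wt_down'[OF r, of "Suc n"] by (simp add: branch_def)
  have 5: "wt (orb (r (Suc (Suc (N + n))))) = 1" using wt_up'[OF r, of "Suc n"] by simp
  show ?thesis unfolding transition_eq 1 2 using 3 4 5 by auto
qed

text \<open>The outward successor is the reverse of the inward edge and has \<open>wt = 1\<close>, so its step weight is \<open>1 - 1 = 0\<close>.\<close>

lemma transition_from_down:
  assumes r: "r \<in> R" and E: "E \<in> arcs X"
  shows "transition (orb (arev (r (Suc (N + n))))) E = of_bool (E = orb (arev (r (N + n)))) * branch r n"
proof -
  have 1: "head X (orb (arev (r (Suc (N + n))))) = tail X E \<longleftrightarrow>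
      E = orb (r (Suc (N + n))) \<or> E = orb (arev (r (N + n)))"
    by (rule down_successors[OF r _ E]) simp
  have 2: "Xrev (orb (arev (r (Suc (N + n))))) = orb (r (Suc (N + n)))"
    using Xrev_orb[OF arc_R(2)[OF r]] by simp
  have 3: "orb (r (Suc (N + n))) \<noteq> orb (arev (r (N + n)))" by (rule no_reversal[OF r r]) simp
  have 4: "real (wt (orb (arev (r (N + n))))) = branch r n"
    using wt_down'[OF r, of n] by (simp add: branch_def)
  show ?thesis unfolding transition_eq 1 2 using 3 4 wt_up'[OF r, of n] by auto
qed

text \<open>Under the encoding, the step weights of the quotient are those of a finite core with cusps.\<close>

lemma transition_enc:
  assumes x: "x \<in> cusp_edges core R" and y: "y \<in> cusp_edges core R"
  shows "transition (enc x) (enc y) = cusp_K x y"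
proof (cases x)
  case (Core E)
  then have E: "E \<in> core" using x by (auto simp: cusp_edges_def)
  show ?thesis
  proof (cases y)
    case (Up s k)
    then have "s \<in> R" using y by (auto simp: cusp_edges_def)
    then show ?thesis using transition_from_core_up[OF E, of s k] Core Up by simp
  next
    case (Down s k)
    then have "s \<in> R" using y by (auto simp: cusp_edges_def)
    then show ?thesis using transition_from_core_down[OF E, of s k] Core Down by simp
  qed (simp add: Core)
next
  case (Up r n)
  then have r: "r \<in> R" using x by (auto simp: cusp_edges_def)
  have EX: "enc y \<in> arcs X" using y enc_bij by (auto simp: bij_betw_def)
  show ?thesis
  proof (cases y)
    case (Core E)
    then have "E \<in> core" using y by (auto simp: cusp_edges_def)
    then show ?thesis
      using transition_from_up[OF r, of E n] core_ne(1)[OF _ r, of E "Suc n"] core_ne(2)[OF _ r, of E n] Up Core EX by simp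
  next
    case (Up s k)
    then have s: "s \<in> R" using y by (auto simp: cusp_edges_def)
    have "orb (s (Suc (N + k))) = orb (r (Suc (Suc (N + n)))) \<longleftrightarrow> s = r \<and> k = Suc n"
      using up_eq_iff[OF r s, of "Suc (Suc (N + n))"] by simp
    moreover have "orb (s (Suc (N + k))) \<noteq> orb (arev (r (Suc (N + n))))" by (rule no_reversal[OF r s]) simp
    ultimately show ?thesis using transition_from_up[OF r EX, of n] \<open>x = Up r n\<close> Up by simp
  next
    case (Down s k)
    then have s: "s \<in> R" using y by (auto simp: cusp_edges_def)
    have "orb (arev (s (Suc (N + k)))) = orb (arev (r (Suc (N + n)))) \<longleftrightarrow> s = r \<and> k = n"
      using down_eq_iff[OF r s, of "Suc (N + n)"] by simp
    moreover have "orb (arev (s (Suc (N + k)))) \<noteq> orb (r (Suc (Suc (N + n))))" by (rule down_ne_up[OF r s]) simp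
    ultimately show ?thesis using transition_from_up[OF r EX, of n] \<open>x = Up r n\<close> Down by simp
  qed
next
  case (Down r n)
  then have r: "r \<in> R" using x by (auto simp: cusp_edges_def)
  have EX: "enc y \<in> arcs X" using y enc_bij by (auto simp: bij_betw_def)
  show ?thesis
  proof (cases y)
    case (Core E)
    then have "E \<in> core" using y by (auto simp: cusp_edges_def)
    then show ?thesis
      using transition_from_down[OF r, of E n] core_ne(4)[OF _ r, of E n] Down Core EX by auto
  next
    case (Up s k)
    then have s: "s \<in> R" using y by (auto simp: cusp_edges_def)
    have "orb (s (Suc (N + k))) \<noteq> orb (arev (r (N + n)))" by (rule no_reversal[OF r s]) simp
    then show ?thesis using transition_from_down[OF r EX, of n] \<open>x = Down r n\<close> Up by simp
  next
    case (Down s k)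
    then have s: "s \<in> R" using y by (auto simp: cusp_edges_def)
    have "orb (arev (s (Suc (N + k)))) = orb (arev (r (N + n))) \<longleftrightarrow> s = r \<and> n = Suc k"
      using down_eq_iff[OF r s, of "N + n" "Suc (N + k)"] by auto
    then show ?thesis using transition_from_down[OF r EX, of n] \<open>x = Down r n\<close> Down by simp
  qed
qed

lemma cusp_system_transition: "\<exists>D. cusp_system transition attach_up attach_down branch core R D"
proof -
  obtain D where D: "\<And>v. v \<in> verts Y \<Longrightarrow> out_degree Y v \<le> D" using bounded_degree by blast
  have in_X: "enc x \<in> arcs X" if "x \<in> cusp_edges core R" for x using that enc_bij by (auto simp: bij_betw_def)
  have "cusp_system transition attach_up attach_down branch core R (real (D + 1))"
  proof
    show "finite core" "finite R" by (rule finite_core, rule finite_R)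
    show "1 \<le> real (D + 1)" by simp
    show "attach_up r \<in> core \<and> attach_down r \<in> core" if "r \<in> R" for r by (rule attach_core[OF that])
    show "0 \<le> cusp_K x y" if "x \<in> cusp_edges core R" "y \<in> cusp_edges core R" for x y
      using transition_enc[OF that] transition_nonneg[OF in_X[OF that(2)], of "enc x"] by simp
    show "(\<Sum>y\<in>T. cusp_K x y) \<le> real (D + 1)" if T: "x \<in> cusp_edges core R" "finite T" "T \<subseteq> cusp_edges core R" for x T
    proof -
      obtain e where e: "e \<in> arcs Y" "enc x = orb e" using in_X[OF T(1)] by (auto simp: arcs_X)
      have "(\<Sum>y\<in>T. cusp_K x y) = (\<Sum>y\<in>T. transition (enc x) (enc y))"
        using transition_enc[OF T(1)] T(3) by (intro sum.cong) auto
      also have "\<dots> = (\<Sum>E\<in>enc ` T. transition (orb e) E)"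
        unfolding e(2)[symmetric] using enc_bij T(3)
        by (intro sum.reindex[symmetric, unfolded o_def]) (auto simp: bij_betw_def intro: inj_on_subset)
      also have "\<dots> \<le> real (out_degree Y (head Y e))"
        using T in_X by (intro transition_row[OF e(1)]) auto
      also have "\<dots> \<le> real (D + 1)" using D[OF head_in_verts[OF e(1)]] by simp
      finally show ?thesis .
    qed
    show "\<exists>p>0. \<exists>M. \<forall>n\<ge>M. branch r (n + p) = branch r n" if r: "r \<in> R" for r
    proof -
      obtain p M where p: "p > 0" "\<And>n. n \<ge> M \<Longrightarrow> out_degree Y (tail Y (r (n + p))) = out_degree Y (tail Y (r n))"
        using periodic_R[OF r] by blast
      have "branch r (n + p) = branch r n" if "n \<ge> M" for n
        using p(2)[of "Suc (N + n)"] that by (simp add: branch_def add_ac)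
      then show ?thesis using p(1) by blast
    qed
  qed
  then show ?thesis by blast
qed

end

section \<open>Rationality\<close>

context cusp_decomposition
begin

lemma cycle_weight_transition:
  assumes c: "c \<in> prime_cycles X" and p: "p \<in> c"
  shows "of_int (cycle_weight wt Xrev c) * u ^ cycle_length c = cyclic_prod (\<lambda>E E'. u * complex_of_real (transition E E')) p"
proof -
  interpret Q: bidirected_digraph X Xrev by (rule bidirected_quotient)
  \<comment> \<open>the representative by which length and weight of the cycle are defined\<close>
  define q where "q = (SOME q. q \<in> c)"
  have q: "q \<in> c" unfolding q_def using p by (rule someI)
  have cl: "Q.closed_w q" using Q.prime_cycle_mem(1)[OF c q] by (simp add: Q.primitive_closed_def)
  have "cyclic_prod (\<lambda>E E'. u * complex_of_real (transition E E')) p = cyclic_prod (\<lambda>E E'. u * complex_of_real (transition E E')) q"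
    using p Q.prime_cycle_mem(2)[OF c q] by (intro cyclic_prod_shift_class) simp
  also have "\<dots> = (\<Prod>j<length q. u * of_int (step_weight wt Xrev (q ! j) (q ! (Suc j mod length q))))"
    unfolding cyclic_prod_def using cl by (intro prod.cong) (auto simp: transition_def Q.closed_w_iff)
  also have "\<dots> = of_int (path_weight wt Xrev q) * u ^ length q"
    by (simp add: path_weight_def prod.distrib)
  finally show ?thesis by (simp add: cycle_weight_def cycle_length_def q_def)
qed

text \<open>The encoding carries the sum over words of edges of the quotient to that over words of encoded edges, to which
\<open>cusp_system_zeta_rational\<close> applies.\<close>

theorem quotient_zeta_rational:
  "\<exists>(P :: complex poly) (Q :: complex poly) (\<epsilon> :: real). \<epsilon> > 0 \<and> Q \<noteq> 0 \<and>
    (\<forall>u. norm u < \<epsilon> \<longrightarrow> poly Q u \<noteq> 0 \<and>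
      has_prod_on (zeta_factor \<Gamma> Y arev \<phi> \<psi> u) (poly P u / poly Q u) (prime_cycles X))"
proof -
  interpret Q: bidirected_digraph X Xrev by (rule bidirected_quotient)
  obtain D where "cusp_system transition attach_up attach_down branch core R D"
    using cusp_system_transition by blast
  then interpret K: cusp_system transition attach_up attach_down branch core R D .
  from K.cusp_system_zeta_rational obtain P Q e where e: "0 < e" "e \<le> 1 / D"
    and all: "\<forall>u. norm u < e \<longrightarrow> poly P u \<noteq> 0 \<and> poly Q u \<noteq> 0 \<and>
       (\<exists>S. has_word_sum (\<lambda>x y. u * complex_of_real (cusp_K x y)) (cusp_edges core R) S \<and>
       exp S = poly P u / poly Q u)"
    by (elim exE conjE)
  have main: "has_prod_on (zeta_factor \<Gamma> Y arev \<phi> \<psi> u) (poly P u / poly Q u) (prime_cycles X)" if u: "norm u < e" for u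
  proof -
    define t where "t E E' = u * complex_of_real (transition E E')" for E E'
    obtain S where S: "has_word_sum (\<lambda>x y. u * complex_of_real (cusp_K x y)) (cusp_edges core R) S"
      and eS: "exp S = poly P u / poly Q u"
      using all u by blast
    have "((\<lambda>p. cyclic_prod t (map enc p) / of_nat (length (map enc p))) has_sum S) (lists (cusp_edges core R))"
    proof (rule has_sum_cong[THEN iffD1, OF _ S])
      fix p assume p: "p \<in> lists (cusp_edges core R)"
      have "cyclic_prod (\<lambda>x y. u * complex_of_real (cusp_K x y)) p = cyclic_prod (\<lambda>x y. t (enc x) (enc y)) p"
        unfolding cyclic_prod_def
      proof (intro prod.cong refl)
        fix j assume "j \<in> {..<length p}"
        then have j: "j < length p" by simp
        then have "Suc j mod length p < length p" by (intro mod_less_divisor) linarith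
        then have "p ! j \<in> cusp_edges core R" "p ! (Suc j mod length p) \<in> cusp_edges core R"
          using p j by (auto simp: in_lists_conv_set)
        then show "u * complex_of_real (cusp_K (p ! j) (p ! (Suc j mod length p))) = t (enc (p ! j)) (enc (p ! (Suc j mod length p)))"
          unfolding t_def by (simp only: transition_enc)
      qed
      then show "cyclic_prod (\<lambda>x y. u * complex_of_real (cusp_K x y)) p / of_nat (length p)
          = cyclic_prod t (map enc p) / of_nat (length (map enc p))"
        by (simp add: cyclic_prod_map)
    qed
    then have sum: "has_word_sum t (arcs X) S"
      using has_sum_reindex_bij_betw[OF bij_betw_lists_map[OF enc_bij],
          where f = "\<lambda>p. cyclic_prod t p / of_nat (length p)" and S = S] by simp
    have "norm u * D < 1" using K.small_disc(1)[of u] u e by simp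
    have small_t: "norm (t E E') \<le> norm u * D" if EE: "E \<in> arcs X" "E' \<in> arcs X" for E E'
    proof -
      obtain x y where xy: "x \<in> cusp_edges core R" "E = enc x" "y \<in> cusp_edges core R" "E' = enc y"
        using EE unfolding bij_betw_imp_surj_on[OF enc_bij, symmetric] by blast
      have "transition E E' \<le> D" "0 \<le> transition E E'"
        using K.row[OF xy(1), of "{y}"] K.nonneg[OF xy(1,3)] transition_enc[OF xy(1,3)] xy by simp_all
      then show ?thesis by (auto simp: t_def norm_mult intro!: mult_left_mono)
    qed
    define z where "z c = of_int (cycle_weight wt Xrev c) * u ^ cycle_length c" for c
    have z: "z c = cyclic_prod t p" if "c \<in> prime_cycles X" "p \<in> c" for c p
      using cycle_weight_transition[OF that, of u] by (simp add: z_def t_def[abs_def])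
    have small: "norm (z c) < 1" if c: "c \<in> prime_cycles X" for c
    proof -
      obtain p where p: "p \<in> c" "Q.closed_w p"
        using c shift_class_self by (auto simp: prime_cycles_def cycles_def)
      have len: "length p > 0" using p(2) by (simp add: Q.closed_w_def)
      have "norm (z c) = (\<Prod>j<length p. norm (t (p ! j) (p ! (Suc j mod length p))))"
        using z[OF c p(1)] by (simp add: cyclic_prod_def prod_norm)
      also have "\<dots> \<le> (\<Prod>j<length p. norm u * D)"
      proof (rule prod_mono, intro conjI)
        fix j assume "j \<in> {..<length p}"
        then have "p ! j \<in> arcs X" "p ! (Suc j mod length p) \<in> arcs X"
          using p(2) len unfolding Q.closed_w_iff by (auto intro!: subsetD[of "set p" "arcs X"])
        then show "norm (t (p ! j) (p ! (Suc j mod length p))) \<le> norm u * D" by (rule small_t)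
      qed simp
      also have "\<dots> = (norm u * D) ^ length p" by simp
      also have "\<dots> < 1" using \<open>norm u * D < 1\<close> len K.D by (simp add: power_less_one_iff)
      finally show ?thesis .
    qed
    have "has_prod_on (\<lambda>c. inverse (1 - z c)) (exp S) (prime_cycles X)"
      by (rule Q.has_prod_prime_cycles[OF _ sum z small]) (auto simp: t_def transition_def split: if_splits)
    then show ?thesis unfolding eS by (simp add: zeta_factor_def[abs_def] z_def)
  qed
  have "poly Q 0 \<noteq> 0" using all e(1) by simp
  then have "Q \<noteq> 0" by auto
  then show ?thesis
    using e(1) all main by (intro exI[of _ P] exI[of _ Q] exI[of _ e]) blast
qed

end

context cusp_cover
begin

lemma representatives:
  "\<exists>R'\<subseteq>R. (\<forall>s\<in>R. \<exists>r\<in>R'. tail_equiv r s) \<and> (\<forall>r\<in>R'. \<forall>s\<in>R'. tail_equiv r s \<longrightarrow> r = s)"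
proof -
  define rep where "rep r = (SOME s. s \<in> R \<and> tail_equiv r s)" for r
  have rep: "rep r \<in> R \<and> tail_equiv r (rep r)" if "r \<in> R" for r
    unfolding rep_def by (rule someI[of _ r]) (use that tail_equiv_refl in blast)
  have rep_eq: "rep r = rep s" if "tail_equiv r s" for r s
  proof -
    have "tail_equiv r x \<longleftrightarrow> tail_equiv s x" for x
      using that tail_equiv_trans tail_equiv_sym by blast
    then show ?thesis by (simp add: rep_def)
  qed
  show ?thesis
  proof (intro exI[of _ "rep ` R"] conjI ballI impI)
    show "rep ` R \<subseteq> R" using rep by blast
    show "\<exists>r\<in>rep ` R. tail_equiv r s" if "s \<in> R" for s
      using rep[OF that] tail_equiv_sym that by blast
    fix x y assume "x \<in> rep ` R" "y \<in> rep ` R" and xy: "tail_equiv x y"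
    then obtain r s where rs: "r \<in> R" "x = rep r" "s \<in> R" "y = rep s" by blast
    have "tail_equiv r s"
      using rep[OF rs(1)] rep[OF rs(3)] xy rs(2,4) tail_equiv_trans tail_equiv_sym by metis
    then show "x = y" using rep_eq rs by simp
  qed
qed

text \<open>Of the given rays keep one from each class of tail equivalent ones. By the finiteness results above, a common \<open>N\<close>
works for all conditions, and every other given ray leaves the core together with its representative.\<close>

lemma decomposition: "\<exists>core R' N. cusp_decomposition \<Gamma> Y arev \<phi> \<psi> core R' N"
proof -
  obtain R' where R': "R' \<subseteq> R" and reps: "\<And>s. s \<in> R \<Longrightarrow> \<exists>r\<in>R'. tail_equiv r s"
    and uniq: "\<And>r s. r \<in> R' \<Longrightarrow> s \<in> R' \<Longrightarrow> tail_equiv r s \<Longrightarrow> r = s"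
    using representatives by metis
  have finR': "finite R'" using R' finite_R finite_subset by blast
  have "eventually (\<lambda>n. \<forall>r\<in>R'. \<forall>s\<in>R'. \<forall>m. orb (s m) = orb (r n) \<longrightarrow> s = r \<and> m = n) sequentially"
  proof (intro eventually_ball_finite[OF finR'] ballI)
    fix r s assume rs: "r \<in> R'" "s \<in> R'"
    show "eventually (\<lambda>n. \<forall>m. orb (s m) = orb (r n) \<longrightarrow> s = r \<and> m = n) sequentially"
    proof (cases "s = r")
      case True
      then show ?thesis using eventually_distinct[of r] rs R' by auto
    next
      case False
      then have "\<not> tail_equiv r s" using uniq rs by blast
      then have "eventually (\<lambda>n. \<forall>m. orb (s m) \<noteq> orb (r n)) sequentially"
        using eventually_no_meeting[of r s] rs R' by blast
      then show ?thesis by (rule eventually_mono) simp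
    qed
  qed
  moreover have "eventually (\<lambda>n. \<forall>r\<in>R'. \<forall>s\<in>R. \<forall>m. orb (s m) \<noteq> orb (arev (r n))) sequentially"
    using eventually_no_reversal R' by (intro eventually_ball_finite[OF finR']) blast
  moreover have "eventually (\<lambda>n. \<forall>r\<in>R'. \<forall>f\<in>arcs Y. tail Y f = tail Y (r n) \<longrightarrow>
      f = r n \<or> orb f = orb (arev (r (n - 1)))) sequentially"
    using eventually_neighbours R' by (intro eventually_ball_finite[OF finR']) blast
  ultimately have "eventually (\<lambda>n. (\<forall>r\<in>R'. \<forall>s\<in>R'. \<forall>m. orb (s m) = orb (r n) \<longrightarrow> s = r \<and> m = n) \<and>
      (\<forall>r\<in>R'. \<forall>s\<in>R. \<forall>m. orb (s m) \<noteq> orb (arev (r n))) \<and>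
      (\<forall>r\<in>R'. \<forall>f\<in>arcs Y. tail Y f = tail Y (r n) \<longrightarrow> f = r n \<or> orb f = orb (arev (r (n - 1))))) sequentially"
    by (intro eventually_conj)
  then obtain N where N: "\<forall>n\<ge>N. (\<forall>r\<in>R'. \<forall>s\<in>R'. \<forall>m. orb (s m) = orb (r n) \<longrightarrow> s = r \<and> m = n) \<and>
      (\<forall>r\<in>R'. \<forall>s\<in>R. \<forall>m. orb (s m) \<noteq> orb (arev (r n))) \<and>
      (\<forall>r\<in>R'. \<forall>f\<in>arcs Y. tail Y f = tail Y (r n) \<longrightarrow> f = r n \<or> orb f = orb (arev (r (n - 1))))"
    unfolding eventually_sequentially by (elim exE)
  define core where "core = arcs X - {orb (r n) | r n. r \<in> R' \<and> n > N} - {orb (arev (r n)) | r n. r \<in> R' \<and> n > N}"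
  have exits: "\<exists>M. \<forall>n\<ge>M. orb (s n) \<notin> core \<and> orb (arev (s n)) \<notin> core" if s: "s \<in> R" for s
  proof -
    obtain r where r: "r \<in> R'" "tail_equiv r s" using reps[OF s] by blast
    then obtain a b where ab: "\<And>j. orb (r (a + j)) = orb (s (b + j))" by (auto simp: tail_equiv_def)
    have "orb (s n) \<notin> core \<and> orb (arev (s n)) \<notin> core" if n: "n \<ge> b + Suc N" for n
    proof -
      let ?k = "a + (n - b)"
      have k: "?k > N" "orb (r ?k) = orb (s n)" using ab[of "n - b"] n by auto
      have "r ?k \<in> arcs Y" "s n \<in> arcs Y" using R_arcs r(1) R' s by auto
      from orb_arev_cong[OF this k(2)] have "orb (arev (r ?k)) = orb (arev (s n))" .
      then show ?thesis using k r(1) unfolding core_def by (metis (mono_tags, lifting) Diff_iff mem_Collect_eq)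
    qed
    then show ?thesis by blast
  qed
  have "\<forall>s\<in>R. \<exists>M. \<forall>n\<ge>M. orb (s n) \<notin> core \<and> orb (arev (s n)) \<notin> core" using exits by blast
  from bchoice[OF this] obtain M where "\<forall>s\<in>R. \<forall>n\<ge>M s. orb (s n) \<notin> core \<and> orb (arev (s n)) \<notin> core" by (elim exE)
  note M = this[rule_format]
  have "core \<subseteq> FA \<union> (\<Union>s\<in>R. (\<lambda>n. orb (s n)) ` {..<M s} \<union> (\<lambda>n. orb (arev (s n))) ` {..<M s})"
  proof
    fix E assume E: "E \<in> core"
    then obtain e where e: "e \<in> arcs Y" "E = orb e" by (auto simp: core_def arcs_X)
    show "E \<in> FA \<union> (\<Union>s\<in>R. (\<lambda>n. orb (s n)) ` {..<M s} \<union> (\<lambda>n. orb (arev (s n))) ` {..<M s})"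
    proof (cases "E \<in> FA")
      case False
      then obtain s n where s: "s \<in> R" "E = orb (s n) \<or> E = orb (arev (s n))" using cover[OF e(1)] e(2) by blast
      then have "n < M s" using M[OF s(1), of n] E by (metis leI)
      then show ?thesis using s by auto
    qed simp
  qed
  then have fin_core: "finite core"
    by (rule finite_subset) (use finite_FA finite_R in simp)
  have "cusp_decomposition \<Gamma> Y arev \<phi> \<psi> core R' N"
  proof
    show "core = arcs X - {orb (r n) | r n. r \<in> R' \<and> n > N} - {orb (arev (r n)) | r n. r \<in> R' \<and> n > N}"
      by (rule core_def)
    show "finite core" "finite R'" by (rule fin_core, rule finR')
    show "r \<in> Rays" if "r \<in> R'" for r using that R' R_rays by blast
    show "\<exists>p>0. \<exists>M. \<forall>n\<ge>M. out_degree Y (tail Y (r (n + p))) = out_degree Y (tail Y (r n))" if r: "r \<in> R'" for r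
    proof -
      obtain c where "c \<in> Cusps" "periodic_end Y c" "r \<in> c" using cusp_R r R' by blast
      then show ?thesis using cusp_periodic_degree cusp_boundary by blast
    qed
    show "s = r \<and> m = n" if "r \<in> R'" "s \<in> R'" "n \<ge> N" "orb (s m) = orb (r n)" for r s m n
      using N that by blast
    show "orb (s m) \<noteq> orb (arev (r n))" if "r \<in> R'" "s \<in> R'" "n \<ge> N" for r s m n
      using N that R' by blast
    show "f = r n \<or> orb f = orb (arev (r (n - 1)))"
      if "r \<in> R'" "n > N" "f \<in> arcs Y" "tail Y f = tail Y (r n)" for r n f
      using N that by (meson less_imp_le)
  qed
  then show ?thesis by blast
qed

end

lemma (in cuspidal_tree_lattice) cover_exists: "\<exists>FA R. cusp_cover \<Gamma> Y arev \<phi> \<psi> FA R"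
proof -
  obtain F R where "subgraph F X" and F: "fin_digraph F" and R: "finite R" "\<forall>r\<in>R. \<exists>c\<in>Cusps. periodic_end Y c \<and> r \<in> c"
    and A: "arcs X = arcs F \<union> {orb (r n) | r n. r \<in> R} \<union> {orb (arev (r n)) | r n. r \<in> R}"
    using cuspidal by (elim exE conjE)
  have "cusp_cover \<Gamma> Y arev \<phi> \<psi> (arcs F) R"
  proof
    show "finite (arcs F)" using F by (simp add: fin_digraph.finite_arcs)
    show "orb e \<in> arcs F \<or> (\<exists>r\<in>R. \<exists>n. orb e = orb (r n) \<or> orb e = orb (arev (r n)))" if "e \<in> arcs Y" for e
    proof -
      have "orb e \<in> arcs X" using that by (simp add: arcs_X)
      then show ?thesis unfolding A by blast
    qed
  qed (use R in auto)
  then show ?thesis by blast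
qed

theorem theorem2p2:
  fixes \<Gamma> :: "('g, 'm) monoid_scheme"
    and Y :: "('v, 'e) pre_digraph" and arev :: "'e \<Rightarrow> 'e"
    and \<phi> :: "'g \<Rightarrow> 'v \<Rightarrow> 'v" and \<psi> :: "'g \<Rightarrow> 'e \<Rightarrow> 'e"
  assumes "cuspidal_tree_lattice \<Gamma> Y arev \<phi> \<psi>"
  shows "\<exists>(P :: complex poly) (Q :: complex poly) (\<epsilon> :: real). \<epsilon> > 0 \<and> Q \<noteq> 0 \<and>
    (\<forall>u. norm u < \<epsilon> \<longrightarrow> poly Q u \<noteq> 0 \<and>
      has_prod_on (zeta_factor \<Gamma> Y arev \<phi> \<psi> u) (poly P u / poly Q u)
        (prime_cycles (quotient_graph \<Gamma> Y \<phi> \<psi>)))"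
proof -
  obtain FA R where "cusp_cover \<Gamma> Y arev \<phi> \<psi> FA R"
    using cuspidal_tree_lattice.cover_exists[OF assms] by blast
  then obtain core R' N where "cusp_decomposition \<Gamma> Y arev \<phi> \<psi> core R' N"
    using cusp_cover.decomposition by blast
  then show ?thesis by (rule cusp_decomposition.quotient_zeta_rational)
qed

end
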